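(* Let $n\geq 1$ be an integer and let $L=\{l_1,\ldots,l_n\}$ be a language consisting of $n$ unary function symbols. Let $M$ be an $L$-structure such that the map $(l_1,\ldots,l_n): M\to M^n$, $x\mapsto (l_1(x),\ldots,l_n(x))$, is a bijection. Assume furthermore that for every term $t(x)$ obtained as a composition of at least one function symbol among $l_1,\ldots,l_n$, one has $t(x)\neq x$ for all $x\in M$. Then $K_0(M)\cong \mathbb{Z}[X]/(X-X^n)$ as rings.
   Context: Structures are non-empty. For a structure $M$, $\operatorname{Def}(M)$ is the set of subsets of the disjoint union of all finite Cartesian powers of $M$ that are definable with parameters; $A\sim B$ means that there is a definable (with parameters) bijection between $A$ and $B$, and $[A]$ is the $\sim$-class of $A$. The quotient $\operatorname{Def}(M)/\!\sim$ is a commutative semiring under $[A]+[B]=[A'\sqcup B']$, where $A'\sim A$, $B'\sim B$ and $A',B'$ are disjoint (addition is disjoint union), and $[A]\times[B]=[A\times B]$. Identify two classes $a,b$ if there is a class $c$ with $a+c=b+c$; the quotient is an additively cancellative semiring. The Grothendieck ring $K_0(M)$ is the minimal ring in which this cancellative semiring embeds (its ring of formal differences). *)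

theory Defs
  imports "HOL-Algebra.UnivPoly" "HOL-Algebra.QuotRing" "HOL-Algebra.IntRing"
begin

section \<open>First-order formulas with parameters in unary languages\<close>

text \<open>
  A structure for the language with unary function symbols \<open>0, \<dots>, n - 1\<close> is given by a type
  \<open>'a\<close> (its non-empty universe) and an interpretation \<open>l :: nat \<Rightarrow> 'a \<Rightarrow> 'a\<close>, of which only the
  values \<open>l i\<close> with \<open>i < n\<close> matter. Formulas may mention elements of the structure as constants,
  so they are formulas with parameters.
\<close>

datatype 'a trm = Var nat | Param 'a | App nat "'a trm"

datatype 'a fml =
    Equal "'a trm" "'a trm"
  | Neg "'a fml"
  | Conj "'a fml" "'a fml"
  | Exist nat "'a fml"

primrec trm_vars :: "'a trm \<Rightarrow> nat set" where
  "trm_vars (Var i) = {i}"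
| "trm_vars (Param a) = {}"
| "trm_vars (App f t) = trm_vars t"

primrec trm_syms :: "'a trm \<Rightarrow> nat set" where
  "trm_syms (Var i) = {}"
| "trm_syms (Param a) = {}"
| "trm_syms (App f t) = insert f (trm_syms t)"

primrec free_vars :: "'a fml \<Rightarrow> nat set" where
  "free_vars (Equal s t) = trm_vars s \<union> trm_vars t"
| "free_vars (Neg \<phi>) = free_vars \<phi>"
| "free_vars (Conj \<phi> \<psi>) = free_vars \<phi> \<union> free_vars \<psi>"
| "free_vars (Exist i \<phi>) = free_vars \<phi> - {i}"

primrec fml_syms :: "'a fml \<Rightarrow> nat set" where
  "fml_syms (Equal s t) = trm_syms s \<union> trm_syms t"
| "fml_syms (Neg \<phi>) = fml_syms \<phi>"
| "fml_syms (Conj \<phi> \<psi>) = fml_syms \<phi> \<union> fml_syms \<psi>"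
| "fml_syms (Exist i \<phi>) = fml_syms \<phi>"

primrec trm_val :: "(nat \<Rightarrow> 'a \<Rightarrow> 'a) \<Rightarrow> (nat \<Rightarrow> 'a) \<Rightarrow> 'a trm \<Rightarrow> 'a" where
  "trm_val l v (Var i) = v i"
| "trm_val l v (Param a) = a"
| "trm_val l v (App f t) = l f (trm_val l v t)"

primrec sat :: "(nat \<Rightarrow> 'a \<Rightarrow> 'a) \<Rightarrow> (nat \<Rightarrow> 'a) \<Rightarrow> 'a fml \<Rightarrow> bool" where
  "sat l v (Equal s t) \<longleftrightarrow> trm_val l v s = trm_val l v t"
| "sat l v (Neg \<phi>) \<longleftrightarrow> \<not> sat l v \<phi>"
| "sat l v (Conj \<phi> \<psi>) \<longleftrightarrow> sat l v \<phi> \<and> sat l v \<psi>"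
| "sat l v (Exist i \<phi>) \<longleftrightarrow> (\<exists>a. sat l (v(i := a)) \<phi>)"


section \<open>Definable sets and definable bijections\<close>

text \<open>
  The \<open>k\<close>-th Cartesian power is the set of lists of length \<open>k\<close>, so that \<open>'a list\<close> is the disjoint
  union of all finite powers (including the one-point zeroth power).
\<close>

definition definable_in :: "nat \<Rightarrow> (nat \<Rightarrow> 'a \<Rightarrow> 'a) \<Rightarrow> nat \<Rightarrow> 'a list set \<Rightarrow> bool" where
  "definable_in n l k A \<longleftrightarrow>
     (\<exists>\<phi>. fml_syms \<phi> \<subseteq> {..<n} \<and> free_vars \<phi> \<subseteq> {..<k} \<and>
          A = {xs. length xs = k \<and> sat l (nth xs) \<phi>})"

text \<open>
  A definable subset of the disjoint union meets only finitely many powers, and meets each of them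
  in a definable set.
\<close>

definition Def :: "nat \<Rightarrow> (nat \<Rightarrow> 'a \<Rightarrow> 'a) \<Rightarrow> 'a list set set" where
  "Def n l =
     {A. finite (length ` A) \<and> (\<forall>k. definable_in n l k {xs \<in> A. length xs = k})}"

text \<open>
  A map is definable if, for all \<open>k\<close> and \<open>m\<close>, the part of its graph lying in the product of the
  \<open>k\<close>-th and the \<open>m\<close>-th power is definable as a subset of the \<open>(k + m)\<close>-th power.
\<close>

definition definable_bij ::
  "nat \<Rightarrow> (nat \<Rightarrow> 'a \<Rightarrow> 'a) \<Rightarrow> 'a list set \<Rightarrow> 'a list set \<Rightarrow> ('a list \<Rightarrow> 'a list) \<Rightarrow> bool" where
  "definable_bij n l A B f \<longleftrightarrow>
     bij_betw f A B \<and>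
     (\<forall>k m. definable_in n l (k + m)
              {xs @ f xs | xs. xs \<in> A \<and> length xs = k \<and> length (f xs) = m})"

definition def_equiv :: "nat \<Rightarrow> (nat \<Rightarrow> 'a \<Rightarrow> 'a) \<Rightarrow> 'a list set rel" where
  "def_equiv n l = {(A, B). A \<in> Def n l \<and> B \<in> Def n l \<and> (\<exists>f. definable_bij n l A B f)}"


section \<open>The Grothendieck ring\<close>

text \<open>
  Operations on classes are the unions of the classes obtained from all admissible choices of
  representatives. For sums, the representatives have to be disjoint.

  For products, concatenation identifies the product of the \<open>i\<close>-th and the \<open>j\<close>-th power with the
  \<open>(i + j)\<close>-th power, but different pairs \<open>(i, j)\<close> may have the same sum. Hence \<open>A \<times> B\<close> is represented
  by the set of all concatenations only when concatenation is injective on \<open>A \<times> B\<close>. Such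
  representatives exist in any two classes: append constant coordinates so that the lengths of the
  elements of the two sets determine, and are determined by, their sum.
\<close>

definition def_semiring :: "nat \<Rightarrow> (nat \<Rightarrow> 'a \<Rightarrow> 'a) \<Rightarrow> 'a list set set ring" where
  "def_semiring n l =
     \<lparr>carrier = Def n l // def_equiv n l,
      monoid.mult = (\<lambda>a b. \<Union>A\<in>a. \<Union>B\<in>{B \<in> b. inj_on (\<lambda>(xs, ys). xs @ ys) (A \<times> B)}.
                def_equiv n l `` {(\<lambda>(xs, ys). xs @ ys) ` (A \<times> B)}),
      one = def_equiv n l `` {{[]}},
      zero = def_equiv n l `` {{}},
      add = (\<lambda>a b. \<Union>A\<in>a. \<Union>B\<in>{B \<in> b. A \<inter> B = {}}. def_equiv n l `` {A \<union> B})\<rparr>"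

definition cancel_rel :: "('b, 'm) ring_scheme \<Rightarrow> 'b rel" where
  "cancel_rel S =
     {(a, b). a \<in> carrier S \<and> b \<in> carrier S \<and> (\<exists>c\<in>carrier S. a \<oplus>\<^bsub>S\<^esub> c = b \<oplus>\<^bsub>S\<^esub> c)}"

definition cancel_quotient :: "('b, 'm) ring_scheme \<Rightarrow> 'b set ring" where
  "cancel_quotient S =
     \<lparr>carrier = carrier S // cancel_rel S,
      monoid.mult = (\<lambda>X Y. \<Union>a\<in>X. \<Union>b\<in>Y. cancel_rel S `` {a \<otimes>\<^bsub>S\<^esub> b}),
      one = cancel_rel S `` {\<one>\<^bsub>S\<^esub>},
      zero = cancel_rel S `` {\<zero>\<^bsub>S\<^esub>},
      add = (\<lambda>X Y. \<Union>a\<in>X. \<Union>b\<in>Y. cancel_rel S `` {a \<oplus>\<^bsub>S\<^esub> b})\<rparr>"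

text \<open>
  For an additively cancellative commutative semiring \<open>S\<close>, the class of \<open>(a, b)\<close> below is the
  formal difference \<open>a - b\<close>.
\<close>

definition diff_rel :: "('b, 'm) ring_scheme \<Rightarrow> ('b \<times> 'b) rel" where
  "diff_rel S =
     {((a, b), (c, d)). a \<in> carrier S \<and> b \<in> carrier S \<and> c \<in> carrier S \<and> d \<in> carrier S \<and>
                        a \<oplus>\<^bsub>S\<^esub> d = c \<oplus>\<^bsub>S\<^esub> b}"

definition difference_ring :: "('b, 'm) ring_scheme \<Rightarrow> ('b \<times> 'b) set ring" where
  "difference_ring S =
     \<lparr>carrier = (carrier S \<times> carrier S) // diff_rel S,
      monoid.mult = (\<lambda>X Y. \<Union>(a, b)\<in>X. \<Union>(c, d)\<in>Y.
                diff_rel S `` {(a \<otimes>\<^bsub>S\<^esub> c \<oplus>\<^bsub>S\<^esub> b \<otimes>\<^bsub>S\<^esub> d, a \<otimes>\<^bsub>S\<^esub> d \<oplus>\<^bsub>S\<^esub> b \<otimes>\<^bsub>S\<^esub> c)}),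
      one = diff_rel S `` {(\<one>\<^bsub>S\<^esub>, \<zero>\<^bsub>S\<^esub>)},
      zero = diff_rel S `` {(\<zero>\<^bsub>S\<^esub>, \<zero>\<^bsub>S\<^esub>)},
      add = (\<lambda>X Y. \<Union>(a, b)\<in>X. \<Union>(c, d)\<in>Y. diff_rel S `` {(a \<oplus>\<^bsub>S\<^esub> c, b \<oplus>\<^bsub>S\<^esub> d)})\<rparr>"

definition K0 :: "nat \<Rightarrow> (nat \<Rightarrow> 'a \<Rightarrow> 'a) \<Rightarrow> ('a list set set set \<times> 'a list set set set) set ring"
  where "K0 n l = difference_ring (cancel_quotient (def_semiring n l))"


section \<open>The ring of integer polynomials\<close>

abbreviation ZX :: "(int, nat \<Rightarrow> int) up_ring" where
  "ZX \<equiv> UP \<Z>"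

abbreviation X_ZX :: "nat \<Rightarrow> int" where
  "X_ZX \<equiv> monom ZX \<one>\<^bsub>\<Z>\<^esub> 1"

end

theory Submission
  imports Defs Complex_Main
begin

text \<open>
  Write \<open>M\<close> for the structure and \<open>join\<close> for the inverse of the given bijection from \<open>M\<close> to
  \<open>M\<^sup>n\<close>. An element \<open>x\<close> is a node whose children are the elements \<open>l i x\<close>, and the acyclicity
  hypothesis is an occurs check: no element is a proper subtree of itself. Systems of equations
  between trees with variables and parameters can therefore be solved by unification (\<open>unify\<close>), and
  the solutions of a solvable system are parametrised by free variables. The sets
  parametrised by tuples of trees, called loci here, behave like irreducible closed sets. Two of
  them meet in a locus or not at all (\<open>locus_Int\<close>), a locus covered by finitely many loci lies in
  one of them (\<open>locus_irreducible\<close>), and a locus with \<open>r\<close> variables is in definable bijection with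
  \<open>M\<^sup>r\<close> (\<open>locus_equi_power\<close>).

  Irreducibility gives quantifier elimination: a fibre of a locus fails to be covered by the fibres
  of finitely many smaller loci as soon as it is not contained in any single one of them. So the
  definable sets are the Boolean combinations of loci (\<open>definable_iff_constr\<close>).

  Let \<open>X\<close> be the class of \<open>M\<close>. By inclusion and exclusion, the class of a definable set is a
  difference of sums of powers of \<open>X\<close> (\<open>power_difference_Def\<close>), and \<open>X = X\<^sup>n\<close> because \<open>join\<close> is a
  definable bijection. This bounds the Grothendieck ring from above by \<open>\<int>[X]/(X - X\<^sup>n)\<close>.

  For the bound from below, fix a complex number \<open>z\<close> with \<open>z ^ n = z\<close> and let a locus with \<open>r\<close>
  variables have the weight \<open>z ^ r\<close>. Different parametrisations of the same locus have the same
  weight (\<open>power_rk_unique\<close>), and by irreducibility the indicator functions of different loci are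
  linearly independent. So the weight extends to a linear functional, an Euler characteristic
  (\<open>ev_eq_0\<close>). Summing over the fibres of a projection shows that it is invariant under definable
  bijections (\<open>euler_bij\<close>), and it is additive and multiplicative.

  An integer polynomial that vanishes at all \<open>z\<close> with \<open>z ^ n = z\<close> lies in the ideal of \<open>X - X\<^sup>n\<close>: for
  \<open>n \<ge> 2\<close> it is congruent to one of degree less than \<open>n\<close>, which has \<open>n\<close> distinct zeros and so is
  zero; for \<open>n = 1\<close> it vanishes everywhere. Hence the Euler characteristics for all these \<open>z\<close> together
  separate exactly what has to be separated. Cancellation of classes is equality of all Euler
  characteristics (\<open>cancel_rel_SR\<close>), and both the Grothendieck ring and \<open>\<int>[X]/(X - X\<^sup>n)\<close> become the
  same ring of functions on the set of fixed points of \<open>z \<mapsto> z ^ n\<close>.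
\<close>

section \<open>Trees over an acyclic Cantor structure\<close>

text \<open>
  Terms in the constructor \<open>join\<close>, with variables and parameters from the structure. They replace
  the terms of the language, which only take elements apart: a tuple of trees parametrises a set.
\<close>

datatype 'a tree = Leaf nat | Const 'a | Node "'a tree list"

fun vars :: "'a tree \<Rightarrow> nat set" where
  "vars (Leaf j) = {j}"
| "vars (Const a) = {}"
| "vars (Node ts) = (\<Union>t\<in>set ts. vars t)"

fun subst :: "(nat \<Rightarrow> 'a tree) \<Rightarrow> 'a tree \<Rightarrow> 'a tree" where
  "subst \<sigma> (Leaf j) = \<sigma> j"
| "subst \<sigma> (Const a) = Const a"
| "subst \<sigma> (Node ts) = Node (map (subst \<sigma>) ts)"

text \<open>
  The termination measure of unification. Constants weigh nothing because a constant compared with a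
  node is broken up into \<open>n\<close> constants.
\<close>

fun weight :: "'a tree \<Rightarrow> nat" where
  "weight (Leaf j) = 1"
| "weight (Const a) = 0"
| "weight (Node ts) = Suc (sum_list (map weight ts))"

abbreviation varsl :: "'a tree list \<Rightarrow> nat set" where
  "varsl ts \<equiv> \<Union>t\<in>set ts. vars t"

lemma finite_vars [simp]: "finite (vars t)"
  by (induction t) auto

lemma vars_subst: "vars (subst \<sigma> t) = (\<Union>j\<in>vars t. vars (\<sigma> j))"
  by (induction t) auto

text \<open>
  Sets with a bijection to their \<open>n\<close>-th power are also known as Cantor or Jonsson--Tarski algebras.
\<close>

locale acyclic_cantor =
  fixes n :: nat and l :: "nat \<Rightarrow> 'a \<Rightarrow> 'a"
  assumes n_pos: "n \<ge> 1"
    and bij: "bij_betw (\<lambda>x. map (\<lambda>i. l i x) [0..<n]) UNIV {xs. length xs = n}"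
    and acyclic: "\<And>w x. w \<noteq> [] \<Longrightarrow> set w \<subseteq> {..<n} \<Longrightarrow> foldr l w x \<noteq> x"
begin

definition join :: "'a list \<Rightarrow> 'a" where
  "join = inv_into UNIV (\<lambda>x. map (\<lambda>i. l i x) [0..<n])"

lemma join_l: "join (map (\<lambda>i. l i x) [0..<n]) = x"
  unfolding join_def using bij by (intro inv_into_f_f) (auto simp: bij_betw_def)

lemma map_l_join: "length xs = n \<Longrightarrow> map (\<lambda>i. l i (join xs)) [0..<n] = xs"
  unfolding join_def using bij by (intro f_inv_into_f[of _ "\<lambda>x. map (\<lambda>i. l i x) [0..<n]"]) (auto simp: bij_betw_def)

lemma l_join: "length xs = n \<Longrightarrow> i < n \<Longrightarrow> l i (join xs) = xs ! i"
  using arg_cong[OF map_l_join, of xs "\<lambda>ys. ys ! i"] by simp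

lemma join_inj: "length xs = n \<Longrightarrow> length ys = n \<Longrightarrow> join xs = join ys \<longleftrightarrow> xs = ys"
  by (metis map_l_join)

text \<open>
  By acyclicity, iterating a single function never returns to an earlier element.
\<close>

lemma infinite_UNIV_M: "infinite (UNIV :: 'a set)"
proof -
  fix x :: 'a
  have pow: "foldr l (replicate k 0) y = (l 0 ^^ k) y" for k y
    by (induction k) auto
  have "(l 0 ^^ i) x \<noteq> (l 0 ^^ j) x" if "i < j" for i j
  proof -
    have "foldr l (replicate (j - i) 0) ((l 0 ^^ i) x) \<noteq> (l 0 ^^ i) x"
      by (rule acyclic) (use that n_pos in auto)
    moreover have "(l 0 ^^ (j - i)) ((l 0 ^^ i) x) = (l 0 ^^ j) x"
      using that by (metis comp_apply funpow_add le_add_diff_inverse2 less_imp_le)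
    ultimately show ?thesis by (simp add: pow)
  qed
  then have "inj (\<lambda>k. (l 0 ^^ k) x)"
    by (intro injI) (metis linorder_neqE_nat)
  then show ?thesis
    using finite_imageD infinite_UNIV_nat by (metis finite_subset subset_UNIV)
qed

lemma two_points: "\<exists>a b :: 'a. a \<noteq> b"
proof (rule ccontr)
  assume "\<nexists>a b :: 'a. a \<noteq> b"
  then have "(UNIV :: 'a set) = {undefined}" by auto
  then show False using infinite_UNIV_M by (metis finite.emptyI finite_insert)
qed

fun wf_tree :: "'a tree \<Rightarrow> bool" where
  "wf_tree (Leaf j) \<longleftrightarrow> True"
| "wf_tree (Const a) \<longleftrightarrow> True"
| "wf_tree (Node ts) \<longleftrightarrow> length ts = n \<and> (\<forall>t\<in>set ts. wf_tree t)"

fun val :: "(nat \<Rightarrow> 'a) \<Rightarrow> 'a tree \<Rightarrow> 'a" where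
  "val z (Leaf j) = z j"
| "val z (Const a) = a"
| "val z (Node ts) = join (map (val z) ts)"

text \<open>
  The action of a substitution on assignments: evaluating \<open>subst \<sigma> t\<close> at \<open>z\<close> means evaluating \<open>t\<close> at
  \<open>pull \<sigma> z\<close>.
\<close>

definition pull :: "(nat \<Rightarrow> 'a tree) \<Rightarrow> (nat \<Rightarrow> 'a) \<Rightarrow> nat \<Rightarrow> 'a" where
  "pull \<sigma> z = (\<lambda>j. val z (\<sigma> j))"

lemma val_subst: "val z (subst \<sigma> t) = val (pull \<sigma> z) t"
proof (induction t)
  case (Node ts)
  then have "map (val z \<circ> subst \<sigma>) ts = map (val (pull \<sigma> z)) ts" by simp
  then show ?case by (simp only: subst.simps val.simps(3) map_map)
qed (auto simp: pull_def)

lemma wf_subst: "wf_tree t \<Longrightarrow> (\<And>j. wf_tree (\<sigma> j)) \<Longrightarrow> wf_tree (subst \<sigma> t)"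
  by (induction t) auto

lemma val_cong: "(\<And>j. j \<in> vars t \<Longrightarrow> z j = z' j) \<Longrightarrow> val z t = val z' t"
proof (induction t)
  case (Node ts)
  then have "map (val z) ts = map (val z') ts" by (intro map_cong) auto
  then show ?case by (simp only: val.simps(3))
qed auto

lemma val_inj: "wf_tree t \<Longrightarrow> val z t = val z' t \<Longrightarrow> j \<in> vars t \<Longrightarrow> z j = z' j"
  by (induction t) (auto simp: join_inj)

text \<open>
  Variables can be recovered from the value of a tree by functions of the language. This gives the
  occurs check, the injectivity of parametrisations, and the equations that define a locus.
\<close>

lemma path_to_leaf:
  assumes "wf_tree t" "j \<in> vars t"
  shows "\<exists>w. set w \<subseteq> {..<n} \<and> (\<forall>z. foldr l w (val z t) = z j) \<and> (w = [] \<longrightarrow> t = Leaf j)"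
  using assms
proof (induction t)
  case (Node ts)
  then obtain i where i: "i < n" "j \<in> vars (ts ! i)" by (auto simp: in_set_conv_nth)
  with Node obtain w where w: "set w \<subseteq> {..<n}" "\<And>z. foldr l w (val z (ts ! i)) = z j"
    by (metis nth_mem wf_tree.simps(3))
  have "foldr l (w @ [i]) (val z (Node ts)) = z j" for z
    using w i Node.prems by (simp add: l_join)
  then show ?case using w(1) i(1) by (intro exI[of _ "w @ [i]"]) auto
qed (auto intro: exI[of _ "[]"])

lemma occurs_check: "wf_tree t \<Longrightarrow> j \<in> vars t \<Longrightarrow> t \<noteq> Leaf j \<Longrightarrow> val z t \<noteq> z j"
  by (metis path_to_leaf acyclic)

section \<open>Unification\<close>

definition solves :: "(nat \<Rightarrow> 'a) \<Rightarrow> ('a tree \<times> 'a tree) list \<Rightarrow> bool" where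
  "solves z E \<longleftrightarrow> (\<forall>(s, t)\<in>set E. val z s = val z t)"

definition wf_eqs :: "('a tree \<times> 'a tree) list \<Rightarrow> bool" where
  "wf_eqs E \<longleftrightarrow> (\<forall>(s, t)\<in>set E. wf_tree s \<and> wf_tree t)"

abbreviation wf_sub :: "(nat \<Rightarrow> 'a tree) \<Rightarrow> bool" where
  "wf_sub \<sigma> \<equiv> \<forall>j. wf_tree (\<sigma> j)"

definition vars_eqs :: "('a tree \<times> 'a tree) list \<Rightarrow> nat set" where
  "vars_eqs E = (\<Union>(s, t)\<in>set E. vars s \<union> vars t)"

lemma solves_Nil [simp]: "solves z []"
  and solves_Cons [simp]: "solves z ((s, t) # E) \<longleftrightarrow> val z s = val z t \<and> solves z E"
  and solves_append [simp]: "solves z (E @ E') \<longleftrightarrow> solves z E \<and> solves z E'"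
  by (auto simp: solves_def)

lemma wf_eqs_simps [simp]: "wf_eqs []"
  "wf_eqs ((s, t) # E) \<longleftrightarrow> wf_tree s \<and> wf_tree t \<and> wf_eqs E"
  "wf_eqs (E @ E') \<longleftrightarrow> wf_eqs E \<and> wf_eqs E'"
  by (auto simp: wf_eqs_def)

lemma vars_eqs_simps [simp]: "vars_eqs [] = {}"
  "vars_eqs ((s, t) # E) = vars s \<union> vars t \<union> vars_eqs E"
  "vars_eqs (E @ E') = vars_eqs E \<union> vars_eqs E'"
  by (auto simp: vars_eqs_def)

lemma finite_vars_eqs [simp]: "finite (vars_eqs E)"
  by (auto simp: vars_eqs_def)

lemma solves_zip: "length ss = length ts \<Longrightarrow> solves z (zip ss ts) \<longleftrightarrow> map (val z) ss = map (val z) ts"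
  by (induction ss ts rule: list_induct2) auto

lemma wf_eqs_zip: "(\<forall>t\<in>set ss. wf_tree t) \<Longrightarrow> (\<forall>t\<in>set ts. wf_tree t) \<Longrightarrow> wf_eqs (zip ss ts)"
  by (auto simp: wf_eqs_def dest: set_zip_leftD set_zip_rightD)

lemma vars_eqs_zip: "vars_eqs (zip ss ts) \<subseteq> varsl ss \<union> varsl ts"
  by (fastforce simp: vars_eqs_def dest: set_zip_leftD set_zip_rightD)

definition subst_eqs :: "(nat \<Rightarrow> 'a tree) \<Rightarrow> ('a tree \<times> 'a tree) list \<Rightarrow> ('a tree \<times> 'a tree) list" where
  "subst_eqs \<sigma> E = map (\<lambda>(s, t). (subst \<sigma> s, subst \<sigma> t)) E"

lemma solves_subst: "solves z (subst_eqs \<sigma> E) \<longleftrightarrow> solves (pull \<sigma> z) E"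
  by (auto simp: subst_eqs_def solves_def val_subst)

lemma wf_subst_eqs: "wf_sub \<sigma> \<Longrightarrow> wf_eqs E \<Longrightarrow> wf_eqs (subst_eqs \<sigma> E)"
  by (auto simp: subst_eqs_def wf_eqs_def wf_subst)

lemma vars_subst_eqs: "vars_eqs (subst_eqs \<sigma> E) = (\<Union>j\<in>vars_eqs E. vars (\<sigma> j))"
  unfolding subst_eqs_def by (induction E) (auto simp: vars_subst)

definition eqs_weight :: "('a tree \<times> 'a tree) list \<Rightarrow> nat" where
  "eqs_weight E = sum_list (map (\<lambda>(s, t). weight s + weight t) E)"

lemma eqs_weight_simps [simp]: "eqs_weight [] = 0"
  "eqs_weight ((s, t) # E) = weight s + weight t + eqs_weight E"
  "eqs_weight (E @ E') = eqs_weight E + eqs_weight E'"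
  by (auto simp: eqs_weight_def)

lemma eqs_weight_zip: "length ss = length ts \<Longrightarrow>
    eqs_weight (zip ss ts) = sum_list (map weight ss) + sum_list (map weight ts)"
  by (induction ss ts rule: list_induct2) auto

text \<open>
  The substitution is a most general unifier in a semantic sense: it parametrises the solutions.
\<close>

definition solved_by :: "('a tree \<times> 'a tree) list \<Rightarrow> (nat \<Rightarrow> 'a tree) \<Rightarrow> bool" where
  "solved_by E \<sigma> \<longleftrightarrow> wf_sub \<sigma> \<and> (\<forall>z. solves z E \<longleftrightarrow> (\<exists>z'. z = pull \<sigma> z'))"

lemma pull_Leaf_upd: "pull (Leaf(j := t)) z = z(j := val z t)"
  by (auto simp: pull_def)

text \<open>
  Binding a variable \<open>j\<close> to a tree \<open>t\<close> without \<open>j\<close>: every solution is fixed by the substitution of \<open>t\<close>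
  for \<open>j\<close>, so it is enough to solve the remaining equations after this substitution.
\<close>

lemma unify_bind:
  assumes "wf_tree t" "j \<notin> vars t"
    and IH: "(\<forall>z. \<not> solves z (subst_eqs (Leaf(j := t)) E)) \<or> (\<exists>\<sigma>. solved_by (subst_eqs (Leaf(j := t)) E) \<sigma>)"
  shows "(\<forall>z. \<not> solves z ((Leaf j, t) # E)) \<or> (\<exists>\<sigma>. solved_by ((Leaf j, t) # E) \<sigma>)"
proof -
  let ?\<tau> = "Leaf(j := t)"
  have bound: "pull ?\<tau> z = z" if "z j = val z t" for z
    using that by (auto simp: pull_Leaf_upd)
  have self: "pull ?\<tau> z j = val (pull ?\<tau> z) t" for z
  proof -
    have "val (z(j := val z t)) t = val z t"
      using assms(2) by (intro val_cong) auto
    then show ?thesis by (simp add: pull_Leaf_upd)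
  qed
  show ?thesis
  proof (cases "\<exists>\<sigma>. solved_by (subst_eqs ?\<tau> E) \<sigma>")
    case True
    then obtain \<sigma> where \<sigma>: "wf_sub \<sigma>" "\<And>z. solves (pull ?\<tau> z) E \<longleftrightarrow> (\<exists>z'. z = pull \<sigma> z')"
      by (auto simp: solved_by_def solves_subst)
    have comp: "pull (\<lambda>i. subst \<sigma> (?\<tau> i)) z = pull ?\<tau> (pull \<sigma> z)" for z
      by (auto simp: pull_def val_subst)
    have "solves z ((Leaf j, t) # E) \<longleftrightarrow> (\<exists>z'. z = pull (\<lambda>i. subst \<sigma> (?\<tau> i)) z')" for z
    proof
      assume "solves z ((Leaf j, t) # E)"
      then have "z = pull ?\<tau> z" "solves (pull ?\<tau> z) E" using bound[of z] by auto
      then show "\<exists>z'. z = pull (\<lambda>i. subst \<sigma> (?\<tau> i)) z'" unfolding comp using \<sigma>(2) by metis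
    next
      assume "\<exists>z'. z = pull (\<lambda>i. subst \<sigma> (?\<tau> i)) z'"
      then obtain z' where z': "z = pull ?\<tau> (pull \<sigma> z')" unfolding comp by blast
      then have "solves z E" using \<sigma>(2) by blast
      then show "solves z ((Leaf j, t) # E)" using self z' by simp
    qed
    moreover have "wf_sub (\<lambda>i. subst \<sigma> (?\<tau> i))"
      using \<sigma>(1) assms(1) by (auto intro!: wf_subst)
    ultimately have "solved_by ((Leaf j, t) # E) (\<lambda>i. subst \<sigma> (?\<tau> i))" unfolding solved_by_def by simp
    then show ?thesis by blast
  next
    case False
    then have none: "\<not> solves (pull ?\<tau> z) E" for z using IH by (simp add: solves_subst)
    have "\<not> solves z ((Leaf j, t) # E)" for z using bound[of z] none[of z] by auto
    then show ?thesis by blast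
  qed
qed

lemma unify_weaken:
  assumes "(\<forall>z. \<not> solves z E') \<or> (\<exists>\<sigma>. solved_by E' \<sigma>)" "\<And>z. solves z E \<longleftrightarrow> solves z E'"
  shows "(\<forall>z. \<not> solves z E) \<or> (\<exists>\<sigma>. solved_by E \<sigma>)"
  using assms by (simp add: solved_by_def)

text \<open>
  The usual unification algorithm. The lexicographic measure consists of the number of variables,
  which decreases when a variable is bound, the total weight, which decreases when nodes are
  decomposed, and the number of equations.
\<close>

theorem unify:
  assumes "wf_eqs E"
  shows "(\<forall>z. \<not> solves z E) \<or> (\<exists>\<sigma>. solved_by E \<sigma>)"
proof -
  let ?R = "measures [\<lambda>E. card (vars_eqs E), eqs_weight, length]"
  have "wf ?R" by simp
  then show ?thesis using assms
  proof (induction E rule: wf_induct_rule)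
    case (less E)
    let ?goal = "\<lambda>E. (\<forall>z. \<not> solves z E) \<or> (\<exists>\<sigma>. solved_by E \<sigma>)"
    have IH: "?goal E'" if "card (vars_eqs E') < card (vars_eqs E) \<or> vars_eqs E' \<subseteq> vars_eqs E \<and>
      (eqs_weight E' < eqs_weight E \<or> eqs_weight E' = eqs_weight E \<and> length E' < length E)" "wf_eqs E'" for E'
    proof (rule less.IH[OF _ that(2)])
      have "card (vars_eqs E') \<le> card (vars_eqs E)" if "vars_eqs E' \<subseteq> vars_eqs E"
        using that by (intro card_mono) auto
      then show "(E', E) \<in> ?R" using that(1) by auto
    qed
    have bind: "?goal ((Leaf j, t) # E')"
      if E': "vars_eqs E = insert j (vars t \<union> vars_eqs E')" "wf_tree t" "wf_eqs E'" "j \<notin> vars t" for j t E'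
    proof (rule unify_bind[OF E'(2,4) IH])
      have "vars_eqs (subst_eqs (Leaf(j := t)) E') \<subseteq> vars_eqs E - {j}"
        using E' by (auto simp: vars_subst_eqs split: if_splits)
      then have "vars_eqs (subst_eqs (Leaf(j := t)) E') \<subset> vars_eqs E" using E'(1) by blast
      then show "card (vars_eqs (subst_eqs (Leaf(j := t)) E')) < card (vars_eqs E) \<or>
          vars_eqs (subst_eqs (Leaf(j := t)) E') \<subseteq> vars_eqs E \<and>
          (eqs_weight (subst_eqs (Leaf(j := t)) E') < eqs_weight E \<or>
           eqs_weight (subst_eqs (Leaf(j := t)) E') = eqs_weight E \<and> length (subst_eqs (Leaf(j := t)) E') < length E)"
        by (simp add: psubset_card_mono)
      show "wf_eqs (subst_eqs (Leaf(j := t)) E')" using E' by (intro wf_subst_eqs) auto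
    qed
    have leaf: "?goal ((Leaf j, t) # E')"
      if E': "vars_eqs E = insert j (vars t \<union> vars_eqs E')" "wf_tree t" "wf_eqs E'"
        "eqs_weight E' < eqs_weight E" for j t E'
    proof (cases "j \<in> vars t")
      case False
      then show ?thesis using bind E' by blast
    next
      case True
      show ?thesis
      proof (cases "t = Leaf j")
        case True
        have "?goal E'" by (rule IH) (use E' in auto)
        then show ?thesis by (rule unify_weaken) (use True in auto)
      next
        case False
        then have "\<not> solves z ((Leaf j, t) # E')" for z
          using occurs_check[OF E'(2) True] by (metis solves_Cons val.simps(1))
        then show ?thesis by blast
      qed
    qed
    have cnode: "?goal ((Const a, Node ts) # E')"
      if E': "vars_eqs E = vars (Node ts) \<union> vars_eqs E'" "wf_tree (Node ts)" "wf_eqs E'"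
         "eqs_weight E = weight (Node ts) + eqs_weight E'" for a ts E'
    proof (rule unify_weaken)
      let ?cs = "map (\<lambda>i. Const (l i a)) [0..<n]"
      have w0: "sum_list (map weight ?cs) = 0" by (simp add: o_def)
      have vs0: "varsl ?cs = {}" by auto
      show "?goal (zip ?cs ts @ E')"
      proof (rule IH)
        have "wf_eqs (zip ?cs ts)" by (rule wf_eqs_zip) (use E' in simp_all)
        then show "wf_eqs (zip ?cs ts @ E')" using E' by simp
        have "vars_eqs (zip ?cs ts @ E') \<subseteq> vars_eqs E"
          using E' vars_eqs_zip[of ?cs ts] vs0 by auto
        moreover have "eqs_weight (zip ?cs ts @ E') < eqs_weight E"
          using E' w0 by (simp add: eqs_weight_zip)
        ultimately show "card (vars_eqs (zip ?cs ts @ E')) < card (vars_eqs E) \<or>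
          vars_eqs (zip ?cs ts @ E') \<subseteq> vars_eqs E \<and>
          (eqs_weight (zip ?cs ts @ E') < eqs_weight E \<or>
           eqs_weight (zip ?cs ts @ E') = eqs_weight E \<and> length (zip ?cs ts @ E') < length E)" by blast
      qed
      fix z
      have "val z (Const a) = val z (Node ts) \<longleftrightarrow> map (val z) ?cs = map (val z) ts"
        using E'(2) join_inj[of "map (\<lambda>i. l i a) [0..<n]" "map (val z) ts"] by (simp add: join_l o_def)
      then show "solves z ((Const a, Node ts) # E') \<longleftrightarrow> solves z (zip ?cs ts @ E')"
        using E'(2) by (simp add: solves_zip)
    qed
    show ?case
    proof (cases E)
      case Nil
      have "solved_by [] Leaf" by (auto simp: solved_by_def pull_def)
      then show ?thesis using Nil by blast
    next
      case (Cons e E')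
      obtain s t where e: "e = (s, t)" by (cases e)
      have wf: "wf_tree s" "wf_tree t" "wf_eqs E'" using less.prems Cons e by auto
      have sym: "?goal ((s, t) # E')" if "?goal ((t, s) # E')"
        by (rule unify_weaken[OF that]) auto
      note E = Cons[unfolded e]
      consider j where "s = Leaf j" | j where "t = Leaf j"
        | a ts where "s = Const a" "t = Node ts" | a ts where "t = Const a" "s = Node ts"
        | a b where "s = Const a" "t = Const b" | ss ts where "s = Node ss" "t = Node ts"
        by (cases s; cases t) auto
      then show ?thesis
      proof cases
        case 1
        then show ?thesis using leaf[of j t E'] wf by (auto simp: E)
      next
        case 2
        then show ?thesis using sym leaf[of j s E'] wf by (auto simp: E)
      next
        case 3
        then show ?thesis using cnode[of ts E' a] wf by (auto simp: E)
      next
        case 4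
        then show ?thesis using sym cnode[of ts E' a] wf by (auto simp: E)
      next
        case 5
        show ?thesis
        proof (cases "a = b")
          case True
          have "?goal E'" by (rule IH) (use 5 wf in \<open>auto simp: E\<close>)
          then show ?thesis by (rule unify_weaken) (use 5 True in \<open>auto simp: E\<close>)
        next
          case False
          then show ?thesis using 5 by (auto simp: E)
        qed
      next
        case 6
        have "wf_eqs (zip ss ts)" by (rule wf_eqs_zip) (use 6 wf in simp_all)
        moreover have "length ss = length ts" using 6 wf by simp
        ultimately have "?goal (zip ss ts @ E')"
          by (intro IH) (use 6 wf vars_eqs_zip[of ss ts] in \<open>auto simp: E eqs_weight_zip\<close>)
        then show ?thesis
          by (rule unify_weaken) (use 6 wf in \<open>auto simp: E join_inj solves_zip\<close>)
      qed
    qed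
  qed
qed

section \<open>Irreducibility\<close>

text \<open>
  As an equation for the value of the single variable \<open>j\<close>, an equation between trees holds always or
  for at most one value. If \<open>j\<close> occurs on one side only, that side determines its value; if it occurs
  on both sides, either the nodes can be decomposed or the occurs check applies.
\<close>

lemma line_closed_eq:
  assumes "wf_tree s" "wf_tree t" "a \<noteq> b"
    "val (z(j := a)) s = val (z(j := a)) t" "val (z(j := b)) s = val (z(j := b)) t"
  shows "val (z(j := y)) s = val (z(j := y)) t"
  using assms
proof (induction s arbitrary: t)
  have free: "val (z(j := c)) u = val (z(j := d)) u" if "j \<notin> vars u" for c d u
    using that by (intro val_cong) auto
  have both: "j \<in> vars s \<longleftrightarrow> j \<in> vars t"
    if "wf_tree s" "wf_tree t" "val (z(j := a)) s = val (z(j := a)) t" "val (z(j := b)) s = val (z(j := b)) t"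
    for s t
    using that assms(3) free[of s a b] free[of t a b] val_inj[of s "z(j := a)" "z(j := b)" j]
      val_inj[of t "z(j := a)" "z(j := b)" j] by auto
  have rest: "val (z(j := y)) s = val (z(j := y)) t"
    if "wf_tree s" "wf_tree t" "val (z(j := a)) s = val (z(j := a)) t" "val (z(j := b)) s = val (z(j := b)) t"
      "j \<notin> vars s" for s t
    using both[OF that(1-4)] that(3,5) free[of s a y] free[of t a y] by metis
  {
    case (Leaf i)
    show ?case
    proof (cases "i = j")
      case True
      then have "j \<in> vars t" using both[OF Leaf(1,2,4,5)] by simp
      moreover have "val (z(j := a)) t = (z(j := a)) j" using Leaf(4) True by (metis val.simps(1))
      ultimately have "t = Leaf j" using occurs_check[OF Leaf(2)] by blast
      then show ?thesis using True by simp
    next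
      case False
      then have "j \<notin> vars (Leaf i)" by simp
      then show ?thesis by (rule rest[OF Leaf(1,2,4,5)])
    qed
  next
    case (Const c)
    have "j \<notin> vars (Const c)" by simp
    then show ?case by (rule rest[OF Const(1,2,4,5)])
  next
    case (Node ss)
    show ?case
    proof (cases t)
      case (Node ts)
      then have len: "length ss = n" "length ts = n" using Node.prems by auto
      have "map (val (z(j := y))) ss = map (val (z(j := y))) ts"
      proof (rule nth_equalityI)
        fix i assume i: "i < length (map (val (z(j := y))) ss)"
        have eq: "val (z(j := c)) (ss ! i) = val (z(j := c)) (ts ! i)" if "c = a \<or> c = b" for c
        proof -
          have "map (val (z(j := c))) ss = map (val (z(j := c))) ts"
            using Node.prems(4,5) that \<open>t = _\<close> len join_inj by (metis length_map val.simps(3))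
          then show ?thesis using i len by (metis length_map nth_map)
        qed
        have wf: "wf_tree (ss ! i)" "wf_tree (ts ! i)" "ss ! i \<in> set ss"
          using i len Node.prems(1,2) \<open>t = _\<close> by auto
        have "val (z(j := y)) (ss ! i) = val (z(j := y)) (ts ! i)"
          by (rule Node.IH[OF wf(3,1,2) assms(3)]) (rule eq; simp)+
        then show "map (val (z(j := y))) ss ! i = map (val (z(j := y))) ts ! i"
          using i len by simp
      qed (use len in auto)
      then show ?thesis using \<open>t = _\<close> by (metis val.simps(3))
    next
      case (Const c)
      then have "j \<notin> vars (Node ss)" using both[OF Node.prems(1,2,4,5)] by simp
      then show ?thesis by (rule rest[OF Node.prems(1,2,4,5)])
    next
      case (Leaf i)
      show ?thesis
      proof (cases "i = j")
        case True
        then have "j \<in> vars (Node ss)" using both[OF Node.prems(1,2,4,5)] Leaf by simp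
        then have "val (z(j := a)) (Node ss) \<noteq> (z(j := a)) j"
          by (intro occurs_check Node.prems(1)) auto
        then show ?thesis using Node.prems(4) Leaf True by (metis val.simps(1))
      next
        case False
        then have "j \<notin> vars (Node ss)" using both[OF Node.prems(1,2,4,5)] Leaf by simp
        then show ?thesis by (rule rest[OF Node.prems(1,2,4,5)])
      qed
    qed
  }
qed

text \<open>
  On each parallel to a coordinate axis, such a set behaves like the zero set of a linear polynomial.
\<close>

definition line_closed :: "(nat \<Rightarrow> 'a) set \<Rightarrow> bool" where
  "line_closed F \<longleftrightarrow> (\<forall>z j a b y. a \<noteq> b \<longrightarrow> z(j := a) \<in> F \<longrightarrow> z(j := b) \<in> F \<longrightarrow> z(j := y) \<in> F)"

lemma line_closed_solves: "wf_eqs E \<Longrightarrow> line_closed {z. solves z E}"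
proof -
  assume "wf_eqs E"
  then have wf: "\<And>e. e \<in> set E \<Longrightarrow> wf_tree (fst e)" "\<And>e. e \<in> set E \<Longrightarrow> wf_tree (snd e)"
    by (auto simp: wf_eqs_def)
  show "line_closed {z. solves z E}"
    unfolding line_closed_def solves_def mem_Collect_eq split_beta
  proof (intro allI impI ballI)
    fix z j a b y e
    assume "a \<noteq> b" "e \<in> set E" "\<forall>e\<in>set E. val (z(j := a)) (fst e) = val (z(j := a)) (snd e)"
      "\<forall>e\<in>set E. val (z(j := b)) (fst e) = val (z(j := b)) (snd e)"
    then show "val (z(j := y)) (fst e) = val (z(j := y)) (snd e)"
      using line_closed_eq[OF wf[of e]] by blast
  qed
qed

text \<open>
  The affine space obtained by varying the coordinates in \<open>J\<close> is irreducible with respect to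
  line-closed sets. By induction on \<open>J\<close>: on each line in direction \<open>j\<close>, some member of the finite
  family contains two points, hence the whole line, since the structure is infinite. The sets of
  lines contained in the members are again line-closed and cover a space with one dimension less.
\<close>

lemma irreducible:
  assumes "finite J" "finite \<F>" "\<forall>F\<in>\<F>. line_closed F"
    "\<And>z. (\<forall>j. j \<notin> J \<longrightarrow> z j = z0 j) \<Longrightarrow> \<exists>F\<in>\<F>. z \<in> F"
  shows "\<exists>F\<in>\<F>. \<forall>z. (\<forall>j. j \<notin> J \<longrightarrow> z j = z0 j) \<longrightarrow> z \<in> F"
  using assms
proof (induction J arbitrary: \<F>)
  case empty
  then obtain F where F: "F \<in> \<F>" "z0 \<in> F" by auto
  have "z = z0" if "\<forall>j. j \<notin> {} \<longrightarrow> z j = z0 j" for z using that by auto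
  then show ?case using F by blast
next
  case (insert j J)
  define all where "all F = {z. \<forall>y. z(j := y) \<in> F}" for F :: "(nat \<Rightarrow> 'a) set"
  have "\<exists>F\<in>all ` \<F>. \<forall>z. (\<forall>i. i \<notin> J \<longrightarrow> z i = z0 i) \<longrightarrow> z \<in> F"
  proof (rule insert.IH)
    show "\<forall>F\<in>all ` \<F>. line_closed F"
    proof clarify
      fix F assume "F \<in> \<F>"
      then have F: "line_closed F" using insert.prems by blast
      show "line_closed (all F)" unfolding line_closed_def
      proof (intro allI impI)
        fix z i a b y assume ab: "(a :: 'a) \<noteq> b" "z(i := a) \<in> all F" "z(i := b) \<in> all F"
        show "z(i := y) \<in> all F"
        proof (cases "i = j")
          case True
          then show ?thesis using ab by (auto simp: all_def)
        next
          case False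
          have "(z(j := u))(i := y) \<in> F" for u
          proof -
            have "(z(j := u))(i := a) \<in> F" "(z(j := u))(i := b) \<in> F"
              using ab(2,3) False by (auto simp: all_def fun_upd_twist)
            then show ?thesis using F ab(1) unfolding line_closed_def by blast
          qed
          then show ?thesis using False by (auto simp: all_def fun_upd_twist)
        qed
      qed
    qed
    fix z assume z: "\<forall>i. i \<notin> J \<longrightarrow> z i = z0 i"
    have cover: "\<exists>F\<in>\<F>. z(j := y) \<in> F" for y using insert.prems(3) z by simp
    then obtain G where G: "\<And>y. G y \<in> \<F>" "\<And>y. z(j := y) \<in> G y" by metis
    \<comment> \<open>Infinitely many points on the line, but only finitely many sets.\<close>
    have "\<not> inj G" using infinite_UNIV_M insert.prems(1) G(1)
      by (metis finite_imageD finite_subset image_subsetI)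
    then obtain a b where "a \<noteq> b" "G a = G b" by (auto simp: inj_def)
    moreover have "z(j := a) \<in> G a" "z(j := b) \<in> G b" using G(2) by blast+
    moreover have "line_closed (G a)" using G(1) insert.prems(2) by blast
    ultimately have "z(j := y) \<in> G a" for y
      using line_closed_def[THEN iffD1, rule_format, of "G a" a b z j y] by simp
    then have "z \<in> all (G a)" unfolding all_def by blast
    then show "\<exists>F\<in>all ` \<F>. z \<in> F" using G(1) by blast
  qed (use insert.prems in auto)
  then obtain F where F: "F \<in> \<F>" "\<And>z. (\<forall>i. i \<notin> J \<longrightarrow> z i = z0 i) \<Longrightarrow> z \<in> all F" by blast
  have "z \<in> F" if "\<forall>i. i \<notin> insert j J \<longrightarrow> z i = z0 i" for z
  proof -
    have "z(j := z0 j) \<in> all F" using that by (intro F(2)) auto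
    then have "(z(j := z0 j))(j := z j) \<in> F" unfolding all_def by blast
    then show ?thesis by simp
  qed
  then show ?case using F(1) by blast
qed

text \<open>
  Universal quantification over variables can be eliminated from equations between trees: an equation
  that holds for two different values of a variable holds for all values.
\<close>

lemma eqs_for_all_values:
  assumes "finite J" "wf_eqs E"
  shows "\<exists>E'. wf_eqs E' \<and> (\<forall>z. (\<forall>z'. (\<forall>j. j \<notin> J \<longrightarrow> z' j = z j) \<longrightarrow> solves z' E) \<longleftrightarrow> solves z E')"
  using assms(1)
proof (induction J)
  case empty
  have "z' = z" if "\<forall>j. j \<notin> {} \<longrightarrow> z' j = z j" for z z' :: "nat \<Rightarrow> 'a" using that by auto
  then show ?case using assms(2) by (intro exI[of _ E]) auto
next
  case (insert j J)
  then obtain E' where E': "wf_eqs E'"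
    "\<And>z. (\<forall>z'. (\<forall>j. j \<notin> J \<longrightarrow> z' j = z j) \<longrightarrow> solves z' E) \<longleftrightarrow> solves z E'" by blast
  obtain a b :: 'a where ab: "a \<noteq> b" using two_points by blast
  let ?E = "subst_eqs (Leaf(j := Const a)) E' @ subst_eqs (Leaf(j := Const b)) E'"
  have "(\<forall>z'. (\<forall>i. i \<notin> insert j J \<longrightarrow> z' i = z i) \<longrightarrow> solves z' E) \<longleftrightarrow> (\<forall>y. solves (z(j := y)) E')" for z
  proof
    assume *: "\<forall>z'. (\<forall>i. i \<notin> insert j J \<longrightarrow> z' i = z i) \<longrightarrow> solves z' E"
    show "\<forall>y. solves (z(j := y)) E'" unfolding E'(2)[symmetric] using * by auto
  next
    assume *: "\<forall>y. solves (z(j := y)) E'"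
    show "\<forall>z'. (\<forall>i. i \<notin> insert j J \<longrightarrow> z' i = z i) \<longrightarrow> solves z' E"
    proof (intro allI impI)
      fix z' assume "\<forall>i. i \<notin> insert j J \<longrightarrow> z' i = z i"
      then have "\<forall>i. i \<notin> J \<longrightarrow> z' i = (z(j := z' j)) i" by auto
      then show "solves z' E" using *[rule_format, of "z' j"] E'(2) by blast
    qed
  qed
  moreover have "(\<forall>y. solves (z(j := y)) E') \<longleftrightarrow> solves z ?E" for z
    using line_closed_solves[OF E'(1)] ab
    by (auto simp: solves_subst pull_Leaf_upd line_closed_def)
  moreover have "wf_eqs ?E" using E'(1) by (simp add: wf_subst_eqs)
  ultimately show ?case by blast
qed

section \<open>Loci\<close>

text \<open>
  The analogue of an irreducible variety, given by a parametrisation.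
\<close>

definition locus :: "'a tree list \<Rightarrow> 'a list set" where
  "locus ts = range (\<lambda>z. map (val z) ts)"

abbreviation wfl :: "'a tree list \<Rightarrow> bool" where
  "wfl ts \<equiv> \<forall>t\<in>set ts. wf_tree t"

text \<open>
  The number of parameters. It depends on the trees, since a parameter can be replaced by a node with
  \<open>n\<close> new parameters; only its residue modulo \<open>n - 1\<close>, and whether it is zero, depend on the locus.
\<close>

definition rk :: "'a tree list \<Rightarrow> nat" where
  "rk ts = card (varsl ts)"

lemma locusI: "map (val z) ts \<in> locus ts"
  by (auto simp: locus_def)

lemma locusE: "xs \<in> locus ts \<Longrightarrow> (\<And>z. xs = map (val z) ts \<Longrightarrow> P) \<Longrightarrow> P"
  by (auto simp: locus_def)

lemma length_locus: "xs \<in> locus ts \<Longrightarrow> length xs = length ts"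
  by (auto simp: locus_def)

lemma mapval_cong: "(\<And>j. j \<in> varsl ts \<Longrightarrow> z j = z' j) \<Longrightarrow> map (val z) ts = map (val z') ts"
  by (intro map_cong refl val_cong) auto

lemma mapval_inj: "wfl ts \<Longrightarrow> map (val z) ts = map (val z') ts \<Longrightarrow> j \<in> varsl ts \<Longrightarrow> z j = z' j"
  using val_inj by auto

lemma mapval_subst: "map (val z) (map (subst \<sigma>) ts) = map (val (pull \<sigma> z)) ts"
  by (simp add: val_subst)

lemma image_of_solutions:
  assumes "wf_eqs E" "wfl us"
  shows "{xs. \<exists>z. xs = map (val z) us \<and> solves z E} = {} \<or>
    (\<exists>us'. wfl us' \<and> length us' = length us \<and> {xs. \<exists>z. xs = map (val z) us \<and> solves z E} = locus us')"
proof (cases "\<forall>z. \<not> solves z E")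
  case False
  then obtain \<sigma> where \<sigma>: "wf_sub \<sigma>" "\<And>z. solves z E \<longleftrightarrow> (\<exists>z'. z = pull \<sigma> z')"
    using unify[OF assms(1)] by (auto simp: solved_by_def)
  have "{xs. \<exists>z. xs = map (val z) us \<and> solves z E} = locus (map (subst \<sigma>) us)"
    unfolding locus_def mapval_subst by (auto simp: \<sigma>(2))
  moreover have "wfl (map (subst \<sigma>) us)" using \<sigma>(1) assms(2) by (auto intro: wf_subst)
  ultimately show ?thesis by (metis length_map)
qed simp

text \<open>
  The preimage of a locus under a parametrisation is given by equations between trees once the
  variables of the two sides are renamed apart: even numbers for one side, odd ones for the other.
\<close>

lemma image_of_preimage:
  assumes "wfl us" "wfl ts" "wfl ss" "length ts = length ss"
  shows "{xs. \<exists>z. xs = map (val z) us \<and> map (val z) ts \<in> locus ss} = {} \<or>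
    (\<exists>us'. wfl us' \<and> length us' = length us \<and>
       {xs. \<exists>z. xs = map (val z) us \<and> map (val z) ts \<in> locus ss} = locus us')"
proof -
  define ev od :: "nat \<Rightarrow> 'a tree" where "ev = (\<lambda>j. Leaf (2 * j))" and "od = (\<lambda>j. Leaf (2 * j + 1))"
  let ?E = "zip (map (subst ev) ts) (map (subst od) ss)"
  let ?us = "map (subst ev) us"
  have wfs: "wf_sub ev" "wf_sub od" by (auto simp: ev_def od_def)
  have wf: "wf_eqs ?E" "wfl ?us"
    using assms wfs by (auto intro!: wf_eqs_zip wf_subst simp del: set_zip)
  have solves: "solves z ?E \<longleftrightarrow> map (val (pull ev z)) ts = map (val (pull od z)) ss" for z
    using assms(4) by (simp add: solves_zip mapval_subst[unfolded map_map] del: map_eq_conv)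
  have merge: "\<exists>z. pull ev z = x \<and> pull od z = y" for x y
    by (intro exI[of _ "\<lambda>k. if even k then x (k div 2) else y (k div 2)"]) (auto simp: pull_def ev_def od_def)
  have "{xs. \<exists>z. xs = map (val z) us \<and> map (val z) ts \<in> locus ss} =
        {xs. \<exists>z. xs = map (val z) ?us \<and> solves z ?E}"
  proof (intro Collect_cong iffI)
    fix xs assume "\<exists>z. xs = map (val z) us \<and> map (val z) ts \<in> locus ss"
    then obtain x y where xy: "xs = map (val x) us" "map (val x) ts = map (val y) ss"
      by (auto simp: locus_def)
    obtain z where "pull ev z = x" "pull od z = y" using merge by blast
    then show "\<exists>z. xs = map (val z) ?us \<and> solves z ?E"
      using xy by (intro exI[of _ z]) (simp only: solves mapval_subst simp_thms)
  next
    fix xs assume "\<exists>z. xs = map (val z) ?us \<and> solves z ?E"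
    then obtain z where "xs = map (val (pull ev z)) us" "map (val (pull ev z)) ts = map (val (pull od z)) ss"
      by (auto simp only: solves mapval_subst)
    then show "\<exists>z. xs = map (val z) us \<and> map (val z) ts \<in> locus ss" by (metis locusI)
  qed
  then show ?thesis using image_of_solutions[OF wf] by fastforce
qed

section \<open>Expanding variables\<close>

text \<open>
  The variable \<open>j\<close> becomes a node with the children \<open>j * n, \<dots>, j * n + n - 1\<close>. As \<open>(j, i) \<mapsto> j * n + i\<close>
  is a bijection, all variables can be expanded at once without losing any assignment.
\<close>

definition spread :: "nat \<Rightarrow> 'a tree" where
  "spread j = Node (map (\<lambda>i. Leaf (j * n + i)) [0..<n])"

definition expand :: "'a tree \<Rightarrow> 'a tree" where
  "expand = subst spread"

lemma wf_spread: "wf_sub spread"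
  by (auto simp: spread_def)

lemma pull_spread_surj: "\<exists>z'. pull spread z' = z"
proof -
  have "pull spread (\<lambda>k. l (k mod n) (z (k div n))) = z"
  proof
    fix j
    have "map (\<lambda>i. l ((j * n + i) mod n) (z ((j * n + i) div n))) [0..<n] = map (\<lambda>i. l i (z j)) [0..<n]"
      by (intro map_cong) auto
    then show "pull spread (\<lambda>k. l (k mod n) (z (k div n))) j = z j"
      by (simp add: pull_def spread_def o_def join_l del: map_eq_conv)
  qed
  then show ?thesis by blast
qed

lemma wfl_expand: "wfl ts \<Longrightarrow> wfl (map (expand ^^ d) ts)"
  by (induction d) (auto simp: expand_def intro: wf_subst wf_spread[rule_format])

lemma expand_Suc: "map (expand ^^ Suc d) ts = map expand (map (expand ^^ d) ts)"
  by simp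

lemma locus_expand1: "locus (map expand ts) = locus ts"
proof -
  have "range (pull spread) = UNIV" using pull_spread_surj by (metis surj_def)
  then have "range (\<lambda>z. map (val (pull spread z)) ts) = range (\<lambda>z. map (val z) ts)"
    using image_image[of "\<lambda>z. map (val z) ts" "pull spread" UNIV] by simp
  then show ?thesis by (simp add: locus_def expand_def val_subst o_def)
qed

lemma locus_expand: "locus (map (expand ^^ d) ts) = locus ts"
  by (induction d) (simp_all only: expand_Suc locus_expand1 funpow_0 list.map_ident map_idI[of _ "expand ^^ 0"])

lemma rk_expand1: "rk (map expand ts) = rk ts * n"
proof -
  have "vars (spread j) = (\<lambda>i. j * n + i) ` {..<n}" for j by (auto simp: spread_def)
  then have "varsl (map expand ts) = (\<lambda>(j, i). j * n + i) ` (varsl ts \<times> {..<n})"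
    by (fastforce simp: expand_def vars_subst)
  moreover have "inj_on (\<lambda>(j, i). j * n + i) (varsl ts \<times> {..<n})"
  proof (rule inj_onI, clarify)
    fix j i j' i' assume "i < n" "i' < n" "j * n + i = j' * n + i'"
    then have "(j * n + i) div n = (j' * n + i') div n" "(j * n + i) mod n = (j' * n + i') mod n" by auto
    then show "j = j' \<and> i = i'" using \<open>i < n\<close> \<open>i' < n\<close> by simp
  qed
  ultimately show ?thesis by (simp add: rk_def card_image)
qed

text \<open>
  Expanding multiplies the number of parameters by \<open>n\<close>, and \<open>z ^ (r * n) = (z ^ n) ^ r = z ^ r\<close>.
\<close>

lemma power_rk_expand:
  assumes "(z :: complex) ^ n = z"
  shows "z ^ rk (map (expand ^^ d) ts) = z ^ rk ts"
proof (induction d)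
  case 0
  then show ?case by (simp add: id_def)
next
  case (Suc d)
  then show ?case
    unfolding expand_Suc rk_expand1 by (metis assms mult.commute power_mult)
qed

text \<open>
  A word of functions walks down a tree, and it gets stuck only at a variable. After \<open>length w\<close>
  expansions, every branch is long enough for the word \<open>w\<close>.
\<close>

lemma word_of_expand:
  assumes "wf_tree t" "set w \<subseteq> {..<n}" "length w \<le> d"
  shows "\<exists>t'. wf_tree t' \<and> (\<forall>z. foldr l w (val z ((expand ^^ d) t)) = val z t')"
  using assms(2,3)
proof (induction w arbitrary: d)
  case Nil
  then show ?case using wfl_expand[of "[t]" d] assms(1) by auto
next
  case (Cons i w)
  then obtain d' where d: "d = Suc d'" "length w \<le> d'" by (cases d) auto
  then obtain t' where t': "wf_tree t'" "\<And>z. foldr l w (val z ((expand ^^ d') t)) = val z t'"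
    using Cons by force
  have i: "i < n" using Cons by auto
  have "foldr l (i # w) (val z ((expand ^^ d) t)) = l i (val z (expand t'))" for z
    using t'(2)[of "pull spread z"] by (simp add: d expand_def val_subst)
  moreover have "\<exists>u. wf_tree u \<and> (\<forall>z. l i (val z (expand t')) = val z u)"
  proof (cases t')
    case (Leaf j)
    then show ?thesis using i
      by (intro exI[of _ "Leaf (j * n + i)"]) (simp add: expand_def spread_def l_join)
  next
    case (Const c)
    then show ?thesis by (intro exI[of _ "Const (l i c)"]) (simp add: expand_def)
  next
    case (Node ts)
    then have "length ts = n" "wf_tree (ts ! i)" using i t'(1) by auto
    then have "wf_tree (expand (ts ! i))" "l i (val z (expand t')) = val z (expand (ts ! i))" for z
      using i Node wf_spread wf_subst[of "ts ! i" spread] by (auto simp: expand_def l_join)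
    then show ?thesis by blast
  qed
  ultimately show ?case by simp
qed

text \<open>
  If a deeply expanded parametrisation \<open>ts\<close> takes a value in \<open>locus ss\<close>, the parameters of \<open>ss\<close> are
  trees in those of \<open>ts\<close>: they are reached by words, which have become subtrees of the expansion.
\<close>

lemma match_expand:
  assumes "wfl ts" "wfl ss" "length ts = length ss"
  shows "\<exists>d0. \<forall>d\<ge>d0. \<exists>\<tau>. wf_sub \<tau> \<and> (\<forall>z z'. map (val z) (map (expand ^^ d) ts) = map (val z') ss \<longrightarrow>
    (\<forall>j\<in>varsl ss. z' j = val z (\<tau> j)))"
proof -
  have "\<forall>j\<in>varsl ss. \<exists>i w. i < length ss \<and> set w \<subseteq> {..<n} \<and> (\<forall>z. foldr l w (val z (ss ! i)) = z j)"
  proof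
    fix j assume "j \<in> varsl ss"
    then obtain i where i: "i < length ss" "j \<in> vars (ss ! i)" by (auto simp: in_set_conv_nth)
    then show "\<exists>i w. i < length ss \<and> set w \<subseteq> {..<n} \<and> (\<forall>z. foldr l w (val z (ss ! i)) = z j)"
      using path_to_leaf[of "ss ! i" j] assms(2) by (metis nth_mem)
  qed
  then obtain p w where pw: "\<And>j. j \<in> varsl ss \<Longrightarrow> p j < length ss \<and> set (w j) \<subseteq> {..<n} \<and>
      (\<forall>z. foldr l (w j) (val z (ss ! p j)) = z j)"
    by metis
  show ?thesis
  proof (intro exI[of _ "\<Sum>j\<in>varsl ss. length (w j)"] allI impI)
    fix d assume d: "(\<Sum>j\<in>varsl ss. length (w j)) \<le> d"
    have "\<exists>t. wf_tree t \<and> (j \<in> varsl ss \<longrightarrow> (\<forall>z. foldr l (w j) (val z ((expand ^^ d) (ts ! p j))) = val z t))" for j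
    proof (cases "j \<in> varsl ss")
      case True
      then have "length (w j) \<le> (\<Sum>j\<in>varsl ss. length (w j))"
        by (intro member_le_sum) auto
      then show ?thesis
        using word_of_expand[of "ts ! p j" "w j" d] pw[OF True] assms d by (metis nth_mem order_trans)
    qed (auto intro: exI[of _ "Leaf 0"])
    then obtain \<tau> where \<tau>: "\<And>j. wf_tree (\<tau> j)"
      "\<And>j z. j \<in> varsl ss \<Longrightarrow> foldr l (w j) (val z ((expand ^^ d) (ts ! p j))) = val z (\<tau> j)"
      by metis
    have "z' j = val z (\<tau> j)"
      if "map (val z) (map (expand ^^ d) ts) = map (val z') ss" "j \<in> varsl ss" for z z' j
    proof -
      have "val z ((expand ^^ d) (ts ! p j)) = val z' (ss ! p j)"
        using arg_cong[OF that(1), of "\<lambda>xs. xs ! p j"] pw[OF that(2)] assms(3) by simp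
      then show ?thesis using \<tau>(2)[OF that(2), of z] pw[OF that(2)] by simp
    qed
    then show "\<exists>\<tau>. wf_sub \<tau> \<and> (\<forall>z z'. map (val z) (map (expand ^^ d) ts) = map (val z') ss \<longrightarrow>
        (\<forall>j\<in>varsl ss. z' j = val z (\<tau> j)))"
      using \<tau>(1) by blast
  qed
qed

text \<open>
  In deeply expanded coordinates, belonging to another locus is a system of equations between trees.
  Without the expansion it need not be line-closed: for \<open>n \<ge> 2\<close>, the elements with a given first
  child form a locus that is neither everything nor a single point.
\<close>

lemma membership_eqs:
  assumes "wfl ts" "finite SS" "\<And>ss. ss \<in> SS \<Longrightarrow> wfl ss \<and> length ss = length ts"
  shows "\<exists>d0. \<forall>d\<ge>d0. \<forall>ss\<in>SS. \<exists>E. wf_eqs E \<and>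
    (\<forall>z. map (val z) (map (expand ^^ d) ts) \<in> locus ss \<longleftrightarrow> solves z E)"
  using assms(2,3)
proof (induction SS)
  case (insert ss SS)
  then obtain d1 where d1: "\<forall>d\<ge>d1. \<forall>ss\<in>SS. \<exists>E. wf_eqs E \<and>
      (\<forall>z. map (val z) (map (expand ^^ d) ts) \<in> locus ss \<longleftrightarrow> solves z E)" by auto
  have ss: "wfl ss" "length ts = length ss" using insert.prems by auto
  from match_expand[OF assms(1) ss] obtain d2 where d2: "\<forall>d\<ge>d2. \<exists>\<tau>. wf_sub \<tau> \<and>
      (\<forall>z z'. map (val z) (map (expand ^^ d) ts) = map (val z') ss \<longrightarrow> (\<forall>j\<in>varsl ss. z' j = val z (\<tau> j)))"
    by blast
  have "\<exists>E. wf_eqs E \<and> (\<forall>z. map (val z) (map (expand ^^ d) ts) \<in> locus ss \<longleftrightarrow> solves z E)"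
    if d: "d \<ge> d2" for d
  proof -
    obtain \<tau> where \<tau>: "wf_sub \<tau>" "\<And>z z' j. map (val z) (map (expand ^^ d) ts) = map (val z') ss \<Longrightarrow>
        j \<in> varsl ss \<Longrightarrow> z' j = val z (\<tau> j)"
      using d2[rule_format, OF d] by (elim exE conjE) (rule that, assumption, blast)
    let ?E = "zip (map (expand ^^ d) ts) (map (subst \<tau>) ss)"
    have "wf_eqs ?E" using wfl_expand[OF assms(1)] \<tau>(1) ss(1) by (intro wf_eqs_zip) (auto intro: wf_subst)
    moreover have "map (val z) (map (expand ^^ d) ts) \<in> locus ss \<longleftrightarrow> solves z ?E" for z
    proof -
      have "solves z ?E \<longleftrightarrow> map (val z) (map (expand ^^ d) ts) = map (val (pull \<tau> z)) ss"
        unfolding mapval_subst[symmetric] using ss(2) by (intro solves_zip) simp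
      moreover have "map (val (pull \<tau> z)) ss = map (val z') ss"
        if "map (val z) (map (expand ^^ d) ts) = map (val z') ss" for z'
        using \<tau>(2)[OF that] by (intro mapval_cong) (auto simp: pull_def)
      ultimately show ?thesis by (metis locusE locusI)
    qed
    ultimately show ?thesis by blast
  qed
  then show ?case using d1 by (intro exI[of _ "max d1 d2"]) simp
qed auto

text \<open>
  Irreducibility of affine space, pulled back along the expanded parametrisation.
\<close>

theorem locus_irreducible:
  assumes "wfl ts" "finite SS" "\<And>ss. ss \<in> SS \<Longrightarrow> wfl ss" "locus ts \<subseteq> (\<Union>ss\<in>SS. locus ss)"
  shows "\<exists>ss\<in>SS. locus ts \<subseteq> locus ss"
proof -
  define SS' where "SS' = {ss \<in> SS. length ss = length ts}"
  have cover: "\<exists>ss\<in>SS'. map (val z) ts' \<in> locus ss" if "locus ts' = locus ts" for z ts'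
  proof -
    have "map (val z) ts' \<in> locus ts" using that locusI by metis
    then obtain ss where "ss \<in> SS" "map (val z) ts' \<in> locus ss" "length (map (val z) ts') = length ts"
      using assms(4) length_locus by blast
    moreover from this have "length ss = length ts" using length_locus by metis
    ultimately show ?thesis unfolding SS'_def by blast
  qed
  have fin: "finite SS'" "\<And>ss. ss \<in> SS' \<Longrightarrow> wfl ss \<and> length ss = length ts"
    using assms(2,3) by (auto simp: SS'_def)
  obtain d where "\<forall>ss\<in>SS'. \<exists>E. wf_eqs E \<and> (\<forall>z. map (val z) (map (expand ^^ d) ts) \<in> locus ss \<longleftrightarrow> solves z E)"
    using membership_eqs[OF assms(1) fin] by (meson order_refl)
  from bchoice[OF this] obtain E where E: "\<And>ss. ss \<in> SS' \<Longrightarrow> wf_eqs (E ss)"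
    "\<And>ss z. ss \<in> SS' \<Longrightarrow> map (val z) (map (expand ^^ d) ts) \<in> locus ss \<longleftrightarrow> solves z (E ss)" by blast
  let ?F = "(\<lambda>ss. {z. solves z (E ss)}) ` SS'"
  fix z0 :: "nat \<Rightarrow> 'a"
  let ?J = "varsl (map (expand ^^ d) ts)"
  have "\<exists>F\<in>?F. \<forall>z. (\<forall>j. j \<notin> ?J \<longrightarrow> z j = z0 j) \<longrightarrow> z \<in> F"
  proof (rule irreducible)
    show "finite ?J" by auto
    show "finite ?F" using assms(2) by (auto simp: SS'_def)
    show "\<forall>F\<in>?F. line_closed F" using line_closed_solves E(1) by blast
    show "\<exists>F\<in>?F. z \<in> F" for z
      using cover[OF locus_expand[of d ts], of z] E(2) by auto
  qed
  then obtain ss where ss: "ss \<in> SS'" "\<And>z. (\<forall>j. j \<notin> ?J \<longrightarrow> z j = z0 j) \<Longrightarrow> solves z (E ss)" by auto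
  have "xs \<in> locus ss" if "xs \<in> locus ts" for xs
  proof -
    obtain z where z: "xs = map (val z) (map (expand ^^ d) ts)"
      using \<open>xs \<in> locus ts\<close> unfolding locus_expand[of d ts, symmetric] by (rule locusE)
    let ?z = "\<lambda>j. if j \<in> ?J then z j else z0 j"
    have "xs = map (val ?z) (map (expand ^^ d) ts)" unfolding z by (rule mapval_cong) simp
    moreover have "solves ?z (E ss)" by (rule ss(2)) simp
    ultimately show ?thesis using E(2)[OF ss(1), of ?z] by simp
  qed
  then show ?thesis using ss(1) by (auto simp: SS'_def)
qed

section \<open>The dimension of a locus\<close>

text \<open>
  If a tuple of trees takes all values, none of its entries is a constant and its variable entries
  are distinct. A node among the entries can be replaced by its \<open>n\<close> children, which changes the number
  of entries by \<open>n - 1\<close> and keeps the set of variables.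
\<close>

lemma rk_of_full_locus:
  assumes "(z :: complex) ^ n = z" "wfl ts" "\<And>xs. length xs = length ts \<Longrightarrow> xs \<in> locus ts"
  shows "z ^ rk ts = z ^ length ts"
  using assms(2,3)
proof (induction "sum_list (map weight (filter (\<lambda>t. \<forall>j. t \<noteq> Leaf j) ts))" arbitrary: ts rule: less_induct)
  case (less ts)
  have pt: "\<exists>x. \<forall>i<length ts. val x (ts ! i) = f i" for f
  proof -
    have "map f [0..<length ts] \<in> locus ts" by (rule less.prems) simp
    then show ?thesis by (elim locusE) (metis add_0 length_map nth_map nth_upt)
  qed
  show ?case
  proof (cases "\<exists>us. Node us \<in> set ts")
    case True
    then obtain us as bs where ts: "ts = as @ [Node us] @ bs" by (metis append_Cons append_Nil split_list)
    have us: "length us = n" using less.prems(1) ts by auto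
    let ?ts = "as @ us @ bs"
    have "sum_list (map weight (filter P us)) \<le> sum_list (map weight us)" for P and us :: "'a tree list"
      by (induction us) auto
    then have smaller: "sum_list (map weight (filter (\<lambda>t. \<forall>j. t \<noteq> Leaf j) ?ts)) <
        sum_list (map weight (filter (\<lambda>t. \<forall>j. t \<noteq> Leaf j) ts))"
      by (simp add: ts le_imp_less_Suc)
    have "z ^ rk ?ts = z ^ length ?ts"
    proof (rule less.hyps[OF smaller])
      show "wfl ?ts" using less.prems(1) ts by auto
      fix xs :: "'a list" assume len: "length xs = length ?ts"
      let ?xa = "take (length as) xs" and ?xu = "take n (drop (length as) xs)" and ?xb = "drop (length as + n) xs"
      have xs: "xs = ?xa @ ?xu @ ?xb" by (metis append_take_drop_id drop_drop add.commute)
      have "?xa @ [join ?xu] @ ?xb \<in> locus ts"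
        by (rule less.prems(2)) (use len us ts in simp)
      then obtain x where "?xa @ [join ?xu] @ ?xb = map (val x) ts" by (rule locusE)
      then have x: "?xa @ [join ?xu] @ ?xb = map (val x) as @ [join (map (val x) us)] @ map (val x) bs"
        unfolding ts by simp
      then have "?xa = map (val x) as" "join ?xu = join (map (val x) us)" "?xb = map (val x) bs"
        using len us by (auto simp: append_eq_append_conv)
      moreover from this have "?xu = map (val x) us" using len us by (simp add: join_inj)
      ultimately have "xs = map (val x) ?ts" using xs by simp
      then show "xs \<in> locus ?ts" using locusI by metis
    qed
    moreover have "rk ?ts = rk ts" by (simp add: rk_def ts Un_left_commute)
    moreover have "z ^ length ?ts = z ^ length ts"
    proof -
      have "length ?ts = n + (length as + length bs)" "length ts = 1 + (length as + length bs)" using us ts by auto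
      then show ?thesis by (simp only: power_add assms(1) power_one_right)
    qed
    ultimately show ?thesis by simp
  next
    case False
    have leaf: "\<exists>j. ts ! i = Leaf j" if "i < length ts" for i
    proof (cases "ts ! i")
      case (Const a)
      obtain b where "b \<noteq> a" using two_points by metis
      then show ?thesis using pt[of "\<lambda>_. b"] that Const by auto
    next
      case (Node us)
      then show ?thesis using False that nth_mem by metis
    qed auto
    then obtain J where J: "\<And>i. i < length ts \<Longrightarrow> ts ! i = Leaf (J i)" by metis
    have "inj_on J {..<length ts}"
    proof (rule inj_onI, rule ccontr)
      fix i k assume ik: "i \<in> {..<length ts}" "k \<in> {..<length ts}" "J i = J k" "i \<noteq> k"
      obtain a b :: 'a where "a \<noteq> b" using two_points by blast
      then show False using pt[of "\<lambda>m. if m = i then a else b"] ik J by (metis lessThan_iff)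
    qed
    moreover have "varsl ts = J ` {..<length ts}"
      using J by (auto simp: set_conv_nth)
    ultimately show ?thesis by (simp add: rk_def card_image)
  qed
qed

text \<open>
  The coordinate change from an expanded parametrisation to another one of the same locus is a
  bijection given by a tuple of trees, and the preceding lemma applies to this tuple.
\<close>

theorem power_rk_unique:
  assumes z: "(z :: complex) ^ n = z" and "wfl ts" "wfl ss" and eq: "locus ts = locus ss"
  shows "z ^ rk ts = z ^ rk ss"
proof -
  have len: "length ts = length ss" using eq locusI length_locus by metis
  obtain d where "\<exists>\<tau>. wf_sub \<tau> \<and> (\<forall>z z'. map (val z) (map (expand ^^ d) ts) = map (val z') ss \<longrightarrow>
      (\<forall>j\<in>varsl ss. z' j = val z (\<tau> j)))"
    using match_expand[OF assms(2,3) len] by (meson order_refl)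
  then obtain \<tau> where \<tau>: "wf_sub \<tau>" "\<And>z z' j. map (val z) (map (expand ^^ d) ts) = map (val z') ss \<Longrightarrow>
      j \<in> varsl ss \<Longrightarrow> z' j = val z (\<tau> j)" by metis
  define ts' where "ts' = map (expand ^^ d) ts"
  have ts': "wfl ts'" "locus ts' = locus ss" "z ^ rk ts' = z ^ rk ts"
    using assms wfl_expand[OF assms(2)] locus_expand power_rk_expand[OF z] by (auto simp: ts'_def)
  \<comment> \<open>The coordinate change \<open>\<tau>\<close> is compatible with the parametrisations.\<close>
  have factor: "map (val x) ts' = map (val (pull \<tau> x)) ss" for x
  proof -
    have "map (val x) ts' \<in> locus ss" using ts'(2) locusI by metis
    then obtain y where y: "map (val x) ts' = map (val y) ss" by (rule locusE)
    then have "y j = val x (\<tau> j)" if "j \<in> varsl ss" for j using \<tau>(2)[of x y j] that by (simp add: ts'_def)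
    then have "map (val y) ss = map (val (pull \<tau> x)) ss" by (intro mapval_cong) (simp add: pull_def)
    then show ?thesis using y by simp
  qed
  obtain js where js: "set js = varsl ss" "distinct js"
    using finite_distinct_list[of "varsl ss"] by auto
  let ?us = "map \<tau> js"
  have "wfl ?us" using \<tau>(1) by auto
  have "z ^ rk ?us = z ^ length ?us"
  proof (rule rk_of_full_locus[OF z \<open>wfl ?us\<close>])
    fix xs :: "'a list" assume len: "length xs = length ?us"
    define y where "y = (\<lambda>j. the (map_of (zip js xs) j))"
    have y: "map y js = xs" using len js(2)
      by (auto simp: y_def map_of_zip_nth intro!: nth_equalityI)
    have "map (val y) ss \<in> locus ts'" using ts'(2) locusI by metis
    then obtain x where "map (val y) ss = map (val x) ts'" by (rule locusE)
    then have "y j = val x (\<tau> j)" if "j \<in> set js" for j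
      using \<tau>(2)[of x y j] that js(1) by (simp add: ts'_def)
    then have "xs = map (val x) ?us" using y by (auto simp: o_def)
    then show "xs \<in> locus ?us" using locusI by metis
  qed
  \<comment> \<open>Changing a variable that occurs on one side only would contradict injectivity of the other side.\<close>
  moreover have "varsl ?us = varsl ts'"
  proof -
    obtain a b :: 'a where ab: "a \<noteq> b" using two_points by blast
    fix x :: "nat \<Rightarrow> 'a"
    have "j \<in> varsl ?us" if "j \<in> varsl ts'" for j
    proof (rule ccontr)
      assume "j \<notin> varsl ?us"
      then have "val (x(j := a)) (\<tau> i) = val (x(j := b)) (\<tau> i)" if "i \<in> varsl ss" for i
        using that js(1) by (intro val_cong) auto
      then have "map (val (pull \<tau> (x(j := a)))) ss = map (val (pull \<tau> (x(j := b)))) ss"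
        by (intro mapval_cong) (simp add: pull_def)
      then have "map (val (x(j := a))) ts' = map (val (x(j := b))) ts'" by (simp only: factor)
      then show False using mapval_inj[OF ts'(1)] that ab by (metis fun_upd_same)
    qed
    moreover have "j \<in> varsl ts'" if "j \<in> varsl ?us" for j
    proof (rule ccontr)
      assume "j \<notin> varsl ts'"
      then have "map (val (x(j := a))) ts' = map (val (x(j := b))) ts'"
        by (intro mapval_cong) auto
      then have "map (val (pull \<tau> (x(j := a)))) ss = map (val (pull \<tau> (x(j := b)))) ss" by (simp only: factor)
      then have "pull \<tau> (x(j := a)) i = pull \<tau> (x(j := b)) i" if "i \<in> varsl ss" for i
        using mapval_inj[OF assms(3)] that by metis
      moreover have "\<exists>i\<in>set js. j \<in> vars (\<tau> i)" using that by auto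
      then obtain i where i: "i \<in> varsl ss" "j \<in> vars (\<tau> i)" using js(1) by blast
      ultimately have "val (x(j := a)) (\<tau> i) = val (x(j := b)) (\<tau> i)" unfolding pull_def by blast
      then show False using val_inj[OF \<tau>(1)[rule_format] _ i(2)] ab by (metis fun_upd_same)
    qed
    ultimately show ?thesis by blast
  qed
  moreover have "length ?us = rk ss" using js distinct_card by (fastforce simp: rk_def)
  ultimately show ?thesis using ts'(3) by (simp add: rk_def)
qed

section \<open>The Euler characteristic\<close>

text \<open>
  Formal linear combinations of loci: \<open>fn\<close> is the function represented by such a combination, and
  \<open>ev\<close> is its integral with respect to the weight \<open>z ^ r\<close>.
\<close>

definition fn :: "(complex \<times> 'a tree list) list \<Rightarrow> 'a list \<Rightarrow> complex" where
  "fn L xs = (\<Sum>(a, ts)\<leftarrow>L. a * of_bool (xs \<in> locus ts))"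

definition ev :: "complex \<Rightarrow> (complex \<times> 'a tree list) list \<Rightarrow> complex" where
  "ev z L = (\<Sum>(a, ts)\<leftarrow>L. a * z ^ rk ts)"

abbreviation wfL :: "(complex \<times> 'a tree list) list \<Rightarrow> bool" where
  "wfL L \<equiv> \<forall>(a, ts)\<in>set L. wfl ts"

lemma fn_simps [simp]: "fn [] xs = 0" "fn ((a, ts) # L) xs = a * of_bool (xs \<in> locus ts) + fn L xs"
  "fn (L @ L') xs = fn L xs + fn L' xs"
  by (simp_all add: fn_def)

lemma ev_simps [simp]: "ev z [] = 0" "ev z ((a, ts) # L) = a * z ^ rk ts + ev z L"
  "ev z (L @ L') = ev z L + ev z L'"
  by (simp_all add: ev_def)

text \<open>
  The integral depends only on the function. Choose a maximal locus in a combination that represents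
  zero. By irreducibility, it has a point outside the other loci, so the coefficients of its
  parametrisations add up to zero. They all have the same weight and can be removed.
\<close>

theorem ev_eq_0:
  assumes z: "z ^ n = z" and "wfL L" "\<And>xs. fn L xs = 0"
  shows "ev z L = 0"
  using assms(2,3)
proof (induction "length L" arbitrary: L rule: less_induct)
  case less
  show ?case
  proof (cases "L = []")
    case False
    have "finite ((locus \<circ> snd) ` set L)" "(locus \<circ> snd) ` set L \<noteq> {}" using False by auto
    \<comment> \<open>A maximal set among the loci in the combination; its parametrisations are collected in \<open>L1\<close>.\<close>
    from finite_has_maximal[OF this] obtain V where V: "V \<in> (locus \<circ> snd) ` set L"
      "\<And>W. W \<in> (locus \<circ> snd) ` set L \<Longrightarrow> V \<subseteq> W \<Longrightarrow> V = W" by blast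
    from V(1) obtain e where e1: "e \<in> set L" "V = locus (snd e)" by auto
    have e: "e \<in> set L"
      "\<And>e'. e' \<in> set L \<Longrightarrow> locus (snd e) \<subseteq> locus (snd e') \<Longrightarrow> locus (snd e) = locus (snd e')"
      using e1 V(2) by auto
    define t0 where "t0 = snd e"
    define L1 where "L1 = filter (\<lambda>e'. locus (snd e') = locus t0) L"
    define L2 where "L2 = filter (\<lambda>e'. locus (snd e') \<noteq> locus t0) L"
    have split: "fn L xs = fn L1 xs + fn L2 xs" "ev z L = ev z L1 + ev z L2" for xs
      unfolding L1_def L2_def by (induction L) auto
    have t0: "wfl t0" using e(1) less.prems(1) by (auto simp: t0_def)
    have L2: "wfL L2" "length L2 < length L"
      using less.prems(1) e(1) length_filter_less[of e L "\<lambda>e'. locus (snd e') \<noteq> locus t0"]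
      by (auto simp: L2_def t0_def)
    have "\<not> locus t0 \<subseteq> (\<Union>ss\<in>snd ` set L2. locus ss)"
    proof
      assume "locus t0 \<subseteq> (\<Union>ss\<in>snd ` set L2. locus ss)"
      then have "\<exists>ss\<in>snd ` set L2. locus t0 \<subseteq> locus ss"
        using L2(1) t0 by (intro locus_irreducible) auto
      then obtain e' where "e' \<in> set L2" "locus t0 \<subseteq> locus (snd e')" by blast
      then show False using e(2)[of e'] unfolding L2_def t0_def by auto
    qed
    then obtain x where x: "x \<in> locus t0" "\<And>e'. e' \<in> set L2 \<Longrightarrow> x \<notin> locus (snd e')" by auto
    define A where "A = (\<Sum>e'\<leftarrow>L1. fst e')"
    have "fn M x = 0" if "\<forall>e'\<in>set M. x \<notin> locus (snd e')" for M
      using that by (induction M) auto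
    then have "fn L2 x = 0" using x(2) by blast
    have "fn M xs = (\<Sum>e'\<leftarrow>M. fst e') * of_bool (xs \<in> locus t0)"
      if "\<forall>e'\<in>set M. locus (snd e') = locus t0" for M xs
      using that by (induction M) (auto simp: algebra_simps)
    then have fn1: "fn L1 xs = A * of_bool (xs \<in> locus t0)" for xs
      unfolding A_def L1_def by fastforce
    have "A = 0" using fn1[of x] split(1)[of x] less.prems(2)[of x] \<open>fn L2 x = 0\<close> x(1) by simp
    have "ev z M = (\<Sum>e'\<leftarrow>M. fst e') * z ^ rk t0"
      if "\<forall>e'\<in>set M. locus (snd e') = locus t0 \<and> wfl (snd e')" for M
      using that
    proof (induction M)
      case (Cons e M)
      then have "z ^ rk (snd e) = z ^ rk t0"
        using power_rk_unique[OF z _ t0] by simp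
      with Cons show ?case by (cases e) (simp add: algebra_simps)
    qed simp
    moreover have "\<forall>e'\<in>set L1. locus (snd e') = locus t0 \<and> wfl (snd e')"
      using less.prems(1) by (auto simp: L1_def)
    ultimately have "ev z L1 = A * z ^ rk t0" unfolding A_def by blast
    moreover have "ev z L2 = 0"
      using less.hyps[OF L2(2,1)] split(1) less.prems(2) fn1 \<open>A = 0\<close> by simp
    ultimately show ?thesis using split(2) \<open>A = 0\<close> by simp
  qed simp
qed

definition scale :: "complex \<Rightarrow> (complex \<times> 'a tree list) list \<Rightarrow> (complex \<times> 'a tree list) list" where
  "scale c L = map (\<lambda>(a, ts). (c * a, ts)) L"

lemma fn_scale [simp]: "fn (scale c L) xs = c * fn L xs"
  and ev_scale [simp]: "ev z (scale c L) = c * ev z L"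
  and wfL_scale [simp]: "wfL (scale c L) \<longleftrightarrow> wfL L"
  unfolding scale_def by (induction L) (auto simp: algebra_simps)

lemma ev_cong:
  assumes "z ^ n = z" "wfL L" "wfL L'" "fn L = fn L'"
  shows "ev z L = ev z L'"
proof -
  have "ev z (L @ scale (-1) L') = 0"
    by (rule ev_eq_0[OF assms(1)])
      (use assms(2,3) wfL_scale[of "-1" L'] in \<open>simp_all add: assms(4) ball_Un del: wfL_scale\<close>)
  then show ?thesis by simp
qed

definition spanned :: "('a list \<Rightarrow> complex) \<Rightarrow> bool" where
  "spanned f \<longleftrightarrow> (\<exists>L. wfL L \<and> f = fn L)"

definition chi :: "complex \<Rightarrow> ('a list \<Rightarrow> complex) \<Rightarrow> complex" where
  "chi z f = ev z (SOME L. wfL L \<and> f = fn L)"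

lemma chi_fn: 
  assumes "z ^ n = z" "wfL L"
  shows "chi z (fn L) = ev z L"
proof -
  define M where "M = (SOME L'. wfL L' \<and> fn L = fn L')"
  have "wfL M \<and> fn L = fn M" unfolding M_def by (rule someI[of _ L]) (use assms in simp)
  then show ?thesis unfolding chi_def M_def[symmetric] using ev_cong[OF assms(1,2), of M] by simp
qed

lemma spanned_add: "spanned f \<Longrightarrow> spanned g \<Longrightarrow> spanned (\<lambda>xs. f xs + g xs)"
  and chi_add: "z ^ n = z \<Longrightarrow> spanned f \<Longrightarrow> spanned g \<Longrightarrow> chi z (\<lambda>xs. f xs + g xs) = chi z f + chi z g"
proof -
  assume "spanned f" "spanned g"
  then obtain L L' where L: "wfL L" "f = fn L" "wfL L'" "g = fn L'" by (auto simp: spanned_def)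
  then have *: "wfL (L @ L')" "(\<lambda>xs. f xs + g xs) = fn (L @ L')" by (auto simp: fun_eq_iff)
  then show "spanned (\<lambda>xs. f xs + g xs)" unfolding spanned_def by blast
  assume "z ^ n = z"
  then show "chi z (\<lambda>xs. f xs + g xs) = chi z f + chi z g"
    unfolding *(2) using L * by (simp add: chi_fn)
qed

lemma spanned_scale: "spanned f \<Longrightarrow> spanned (\<lambda>xs. c * f xs)"
proof -
  assume "spanned f"
  then obtain L where "wfL L" "f = fn L" by (auto simp: spanned_def)
  then have "wfL (scale c L)" "(\<lambda>xs. c * f xs) = fn (scale c L)" by (simp_all add: fun_eq_iff)
  then show ?thesis unfolding spanned_def by blast
qed

lemma spanned_0: "spanned (\<lambda>xs. 0)"
  unfolding spanned_def by (rule exI[of _ "[]"]) (auto simp: fun_eq_iff)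

lemma spanned_locus: "wfl ts \<Longrightarrow> spanned (\<lambda>xs. of_bool (xs \<in> locus ts))"
  unfolding spanned_def by (rule exI[of _ "[(1, ts)]"]) (auto simp: fun_eq_iff)

lemma chi_locus: "z ^ n = z \<Longrightarrow> wfl ts \<Longrightarrow> chi z (\<lambda>xs. of_bool (xs \<in> locus ts)) = z ^ rk ts"
proof -
  assume z: "z ^ n = z" "wfl ts"
  have "fn [(1, ts)] = (\<lambda>xs. of_bool (xs \<in> locus ts))" by (rule ext) simp
  then show ?thesis using chi_fn[of z "[(1, ts)]"] z by simp
qed

lemma locus_Int:
  assumes "wfl ts" "wfl ss"
  shows "locus ts \<inter> locus ss = {} \<or> (\<exists>us. wfl us \<and> length us = length ts \<and> locus ts \<inter> locus ss = locus us)"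
proof (cases "length ts = length ss")
  case True
  have "locus ts \<inter> locus ss = {xs. \<exists>z. xs = map (val z) ts \<and> map (val z) ts \<in> locus ss}"
    by (auto simp: locus_def)
  then show ?thesis using image_of_preimage[OF assms(1,1,2) True] by simp
next
  case False
  then show ?thesis using length_locus by (metis disjoint_iff)
qed

lemma spanned_induct [consumes 1]:
  assumes "spanned f" "P (\<lambda>xs. 0)"
    "\<And>a ts g. wfl ts \<Longrightarrow> spanned g \<Longrightarrow> P g \<Longrightarrow> P (\<lambda>xs. a * of_bool (xs \<in> locus ts) + g xs)"
  shows "P f"
proof -
  obtain L where "wfL L" "f = fn L" using assms(1) by (auto simp: spanned_def)
  then show ?thesis
  proof (induction L arbitrary: f)
    case Nil
    moreover have "fn [] = (\<lambda>xs. 0)" by (rule ext) simp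
    ultimately show ?case using assms(2) by simp
  next
    case (Cons e L)
    obtain a ts where e: "e = (a, ts)" by (cases e)
    have "P (\<lambda>xs. a * of_bool (xs \<in> locus ts) + fn L xs)"
      using Cons e by (intro assms(3)) (auto simp: spanned_def)
    moreover have "f = (\<lambda>xs. a * of_bool (xs \<in> locus ts) + fn L xs)" using Cons e by (auto simp: fun_eq_iff)
    ultimately show ?case by simp
  qed
qed

lemma spanned_mult:
  assumes "spanned f" "spanned g"
  shows "spanned (\<lambda>xs. f xs * g xs)"
  using assms(2)
proof (induction rule: spanned_induct)
  case 1
  then show ?case using spanned_0 by simp
next
  case (2 b ss g)
  have "spanned (\<lambda>xs. of_bool (xs \<in> locus ss) * f xs)"
    using assms(1)
  proof (induction rule: spanned_induct)
    case 1
    then show ?case using spanned_0 by simp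
  next
    case (2 a ts h)
    have "spanned (\<lambda>xs. of_bool (xs \<in> locus ts \<inter> locus ss))"
      using locus_Int[OF 2(1) \<open>wfl ss\<close>]
    proof
      assume "\<exists>us. wfl us \<and> length us = length ts \<and> locus ts \<inter> locus ss = locus us"
      then show ?thesis using spanned_locus by metis
    qed (simp only: empty_iff of_bool_eq spanned_0)
    then have "spanned (\<lambda>xs. a * of_bool (xs \<in> locus ts \<inter> locus ss) + of_bool (xs \<in> locus ss) * h xs)"
      using 2 by (intro spanned_add spanned_scale)
    then show ?case by (rule back_subst[of spanned]) (auto simp: fun_eq_iff algebra_simps)
  qed
  then have "spanned (\<lambda>xs. b * (of_bool (xs \<in> locus ss) * f xs) + f xs * g xs)"
    using 2 by (intro spanned_add spanned_scale)
  then show ?case by (rule back_subst[of spanned]) (auto simp: fun_eq_iff algebra_simps)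
qed

section \<open>Constructible sets\<close>

text \<open>
  The Boolean combinations of loci within the \<open>k\<close>-th power, in disjunctive normal form.
\<close>

inductive constr :: "nat \<Rightarrow> 'a list set \<Rightarrow> bool" for k where
  cell: "wfl ts \<Longrightarrow> length ts = k \<Longrightarrow> finite SS \<Longrightarrow> \<forall>ss\<in>SS. wfl ss \<and> length ss = k \<Longrightarrow>
     constr k (locus ts - (\<Union>ss\<in>SS. locus ss))"
| empty: "constr k {}"
| union: "constr k S \<Longrightarrow> constr k T \<Longrightarrow> constr k (S \<union> T)"

abbreviation power_set :: "nat \<Rightarrow> 'a list set" where
  "power_set k \<equiv> {xs. length xs = k}"

lemma constr_locus: "wfl ts \<Longrightarrow> length ts = k \<Longrightarrow> constr k (locus ts)"
  using cell[of ts k "{}"] by simp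

lemma locus_Leaf: "locus (map Leaf [0..<k]) = power_set k"
proof -
  have "xs \<in> locus (map Leaf [0..<k])" if "length xs = k" for xs
  proof -
    have "xs = map (val (nth xs)) (map Leaf [0..<k])" using that map_nth[of xs] by (simp add: o_def)
    then show ?thesis using locusI by metis
  qed
  then show ?thesis using length_locus by force
qed

lemma constr_power: "constr k (power_set k)"
  using constr_locus[of "map Leaf [0..<k]" k] by (simp add: locus_Leaf)

lemma constr_length: "constr k S \<Longrightarrow> S \<subseteq> power_set k"
  by (induction rule: constr.induct) (use length_locus in auto)

lemma constr_cell_or_empty:
  "X = {} \<or> (\<exists>us. wfl us \<and> length us = k \<and> X = locus us) \<Longrightarrow> constr k X"
  using constr_locus constr.empty by blast

lemma constr_Int:
  assumes "constr k S" "constr k T"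
  shows "constr k (S \<inter> T)"
  using assms(1)
proof (induction rule: constr.induct)
  case (cell ts SS)
  note c = this
  show ?case using assms(2)
  proof (induction rule: constr.induct)
    case (cell ts' SS')
    have eq: "(locus ts - (\<Union>ss\<in>SS. locus ss)) \<inter> (locus ts' - (\<Union>ss\<in>SS'. locus ss)) =
      (locus ts \<inter> locus ts') - (\<Union>ss\<in>SS \<union> SS'. locus ss)" by auto
    consider "locus ts \<inter> locus ts' = {}"
      | us where "wfl us" "length us = k" "locus ts \<inter> locus ts' = locus us"
      using locus_Int[OF c(1) cell(1)] c(2) by auto
    then show ?case
    proof cases
      case 1
      then show ?thesis unfolding eq by (simp add: constr.empty)
    next
      case 2
      then show ?thesis unfolding eq 2(3) using c cell by (intro constr.cell) auto
    qed
  next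
    case (union S T)
    then show ?case by (simp add: Int_Un_distrib constr.union)
  qed (simp add: constr.empty)
next
  case (union S T)
  then show ?case by (simp add: Int_Un_distrib2 constr.union)
qed (simp add: constr.empty)

lemma constr_UN: "finite I \<Longrightarrow> (\<And>i. i \<in> I \<Longrightarrow> constr k (S i)) \<Longrightarrow> constr k (\<Union>i\<in>I. S i)"
  by (induction I rule: finite_induct) (auto intro: constr.intros)

lemma constr_compl:
  assumes "constr k S"
  shows "constr k (power_set k - S)"
  using assms
proof (induction rule: constr.induct)
  case (cell ts SS)
  have "power_set k - (locus ts - (\<Union>ss\<in>SS. locus ss)) = (power_set k - locus ts) \<union> (\<Union>ss\<in>SS. locus ss)"
    using cell length_locus by auto
  moreover have "constr k (power_set k - locus ts)"
    using constr.cell[of "map Leaf [0..<k]" k "{ts}"] cell by (simp add: locus_Leaf)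
  ultimately show ?case using cell by (auto intro!: constr.union constr_UN constr_locus)
next
  case (union S T)
  then show ?case using constr_Int by (simp add: Diff_Un)
qed (simp add: constr_power)

lemma constr_Diff: "constr k S \<Longrightarrow> constr k T \<Longrightarrow> constr k (S - T)"
  using constr_Int[OF _ constr_compl[of k T], of S] constr_length[of k S]
  by (metis Diff_Int_distrib inf.absorb2 Int_Diff inf.commute)

text \<open>
  Inclusion and exclusion, phrased with products of indicator functions.
\<close>

lemma spanned_constr:
  assumes "constr k S"
  shows "spanned (\<lambda>xs. of_bool (xs \<in> S))"
  using assms
proof (induction rule: constr.induct)
  case (cell ts SS)
  from cell(3,4) show ?case
  proof (induction SS rule: finite_induct)
    case empty
    then show ?case using spanned_locus[OF cell(1)] by simp
  next
    case (insert ss SS)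
    let ?f = "\<lambda>xs. of_bool (xs \<in> locus ts - (\<Union>ss\<in>SS. locus ss))"
    have "spanned ?f" "spanned (\<lambda>xs. of_bool (xs \<in> locus ss))"
      using insert by (auto intro: spanned_locus)
    then have "spanned (\<lambda>xs. ?f xs + (-1) * (?f xs * of_bool (xs \<in> locus ss)))"
      by (intro spanned_add spanned_scale spanned_mult)
    then show ?case by (rule back_subst[of spanned]) (auto simp: fun_eq_iff)
  qed
next
  case empty
  then show ?case using spanned_0 by simp
next
  case (union S T)
  then have "spanned (\<lambda>xs. of_bool (xs \<in> S) + (of_bool (xs \<in> T) + (-1) * (of_bool (xs \<in> S) * of_bool (xs \<in> T))))"
    by (intro spanned_add spanned_scale spanned_mult)
  then show ?case by (rule back_subst[of spanned]) (auto simp: fun_eq_iff)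
qed

text \<open>
  Constructible sets are closed under reindexing of coordinates and insertion of constants.
\<close>

lemma constr_pre:
  assumes "constr m S" "wfl us" "length us = m" "varsl us \<subseteq> {..<k}"
  shows "constr k {xs. length xs = k \<and> map (val (nth xs)) us \<in> S}"
  using assms(1)
proof (induction rule: constr.induct)
  have loc: "constr k {xs. length xs = k \<and> map (val (nth xs)) us \<in> locus ss}" if "wfl ss" "length ss = m" for ss
  proof -
    define A where "A = {xs. length xs = k \<and> map (val (nth xs)) us \<in> locus ss}"
    define B where "B = {xs. \<exists>z. xs = map (val z) (map Leaf [0..<k]) \<and> map (val z) us \<in> locus ss}"
    have "A = B"
    proof (intro equalityI subsetI)
      fix xs assume A: "xs \<in> A"
      then have "xs = map (val (nth xs)) (map Leaf [0..<k])"
        using map_nth[of xs] by (simp add: o_def A_def)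
      then show "xs \<in> B" using A unfolding A_def B_def by blast
    next
      fix xs assume "xs \<in> B"
      then obtain z where z: "xs = map z [0..<k]" "map (val z) us \<in> locus ss" by (auto simp: o_def B_def)
      moreover have "map (val (nth xs)) us = map (val z) us"
        by (rule mapval_cong) (use assms(4) z in auto)
      ultimately show "xs \<in> A" by (simp add: A_def del: map_eq_conv)
    qed
    moreover have "B = {} \<or> (\<exists>us'. wfl us' \<and> length us' = k \<and> B = locus us')"
      using image_of_preimage[of "map Leaf [0..<k]" us ss] assms(2,3) that unfolding B_def by simp
    ultimately show ?thesis using constr_cell_or_empty[of B k] unfolding A_def by simp
  qed
  case (cell ts SS)
  have "{xs. length xs = k \<and> map (val (nth xs)) us \<in> locus ts - (\<Union>ss\<in>SS. locus ss)} =
    {xs. length xs = k \<and> map (val (nth xs)) us \<in> locus ts} -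
    (\<Union>ss\<in>SS. {xs. length xs = k \<and> map (val (nth xs)) us \<in> locus ss})" by auto
  then show ?case using loc cell by (auto intro!: constr_Diff constr_UN)
next
  case (union S T)
  have "{xs. length xs = k \<and> map (val (nth xs)) us \<in> S \<union> T} = {xs. length xs = k \<and> map (val (nth xs)) us \<in> S} \<union>
    {xs. length xs = k \<and> map (val (nth xs)) us \<in> T}" by auto
  then show ?case using union constr.union by simp
qed (simp add: constr.empty)

section \<open>Quantifier elimination\<close>

text \<open>
  The projection of \<open>locus ts - (\<Union>ss\<in>SS. locus ss)\<close> along the coordinate \<open>i\<close>. Expand \<open>ts\<close> until the
  loci in \<open>SS\<close> are given by equations in the parameters, and let \<open>J\<close> be the set of the parameters
  that only occur in the coordinate \<open>i\<close>. A value for this coordinate exists unless the equations of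
  the members of \<open>SS\<close> together cover the fibre, in which \<open>J\<close> varies freely. By irreducibility, this
  means that one of these systems holds for all values of \<open>J\<close>, which is again a system of equations.
\<close>

lemma exists_cell:
  assumes ts: "wfl ts" "i < length ts" and SS: "finite SS" "\<And>ss. ss \<in> SS \<Longrightarrow> wfl ss \<and> length ss = length ts"
  shows "constr (length ts) {xs. length xs = length ts \<and> (\<exists>a. xs[i := a] \<in> locus ts - (\<Union>ss\<in>SS. locus ss))}"
proof -
  obtain d where "\<forall>ss\<in>SS. \<exists>E. wf_eqs E \<and> (\<forall>z. map (val z) (map (expand ^^ d) ts) \<in> locus ss \<longleftrightarrow> solves z E)"
    using membership_eqs[OF ts(1) SS] by (meson order_refl)
  from bchoice[OF this] obtain E where E: "\<And>ss. ss \<in> SS \<Longrightarrow> wf_eqs (E ss)"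
    "\<And>ss z. ss \<in> SS \<Longrightarrow> map (val z) (map (expand ^^ d) ts) \<in> locus ss \<longleftrightarrow> solves z (E ss)" by blast
  define ts' where "ts' = map (expand ^^ d) ts"
  have ts': "wfl ts'" "locus ts' = locus ts" "length ts' = length ts" "i < length ts'"
    using wfl_expand[OF ts(1)] locus_expand ts(2) by (auto simp: ts'_def)
  define W where "W = (\<Union>k\<in>{..<length ts'} - {i}. vars (ts' ! k))"
  define J where "J = vars (ts' ! i) - W"
  have "finite J" by (simp add: J_def)
  \<comment> \<open>A new variable for the coordinate \<open>i\<close>, which is arbitrary in the projection.\<close>
  obtain f where f: "f \<notin> varsl ts'" using ex_new_if_finite[of "varsl ts'"] by auto
  define us where "us = ts'[i := Leaf f]"
  have wfus: "wfl us" using ts'(1) set_update_subset_insert[of ts' i "Leaf f"] by (auto simp: us_def)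
  have varsts': "varsl ts' = vars (ts' ! i) \<union> W"
    using ts'(4) by (fastforce simp: W_def in_set_conv_nth)
  have "us ! k = ts' ! k" if "k \<noteq> i" for k using that by (simp add: us_def)
  then have varsus: "W \<subseteq> varsl us" 
    unfolding W_def by (auto simp: us_def) (metis length_list_update nth_list_update_neq nth_mem)
  have mapus: "map (val z) us = (map (val z) ts')[i := z f]" for z by (simp add: us_def map_update)
  from eqs_for_all_values[OF \<open>finite J\<close> E(1)] have "\<forall>ss\<in>SS. \<exists>E'. wf_eqs E' \<and>
      (\<forall>z. (\<forall>z'. (\<forall>j. j \<notin> J \<longrightarrow> z' j = z j) \<longrightarrow> solves z' (E ss)) \<longleftrightarrow> solves z E')" by blast
  from bchoice[OF this] obtain E' where E': "\<And>ss. ss \<in> SS \<Longrightarrow> wf_eqs (E' ss)"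
    "\<And>ss z. ss \<in> SS \<Longrightarrow> (\<forall>z'. (\<forall>j. j \<notin> J \<longrightarrow> z' j = z j) \<longrightarrow> solves z' (E ss)) \<longleftrightarrow> solves z (E' ss)" by blast
  define T where "T ss = {xs. \<exists>z. xs = map (val z) us \<and> solves z (E' ss)}" for ss
  have T: "T ss = {} \<or> (\<exists>us'. wfl us' \<and> length us' = length ts \<and> T ss = locus us')" if "ss \<in> SS" for ss
    unfolding T_def using image_of_solutions[OF E'(1)[OF that] wfus] ts' by (simp add: us_def)
  have Tmem: "map (val z) us \<in> T ss \<longleftrightarrow> solves z (E' ss)" if ss: "ss \<in> SS" for z ss
  proof
    assume "map (val z) us \<in> T ss"
    then obtain z' where z': "map (val z) us = map (val z') us" "solves z' (E' ss)" by (auto simp: T_def simp del: map_eq_conv)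
    have "solves y (E ss)" if y: "\<forall>j. j \<notin> J \<longrightarrow> y j = z j" for y
    proof -
      let ?y = "\<lambda>j. if j \<in> J then y j else z' j"
      have "solves ?y (E ss)" using z'(2) E'(2)[OF ss, of z'] by auto
      moreover have "map (val ?y) ts' = map (val y) ts'"
      proof (rule mapval_cong)
        fix j assume "j \<in> varsl ts'"
        then have "j \<in> J \<or> j \<in> varsl us" using varsts' varsus by (auto simp: J_def)
        then show "?y j = y j" using mapval_inj[OF wfus z'(1), of j] y by (cases "j \<in> J") auto
      qed
      ultimately show ?thesis using E(2)[OF ss, folded ts'_def] by metis
    qed
    then show "solves z (E' ss)" using E'(2)[OF ss] by blast
  qed (auto simp: T_def)
  have "{xs. length xs = length ts \<and> (\<exists>a. xs[i := a] \<in> locus ts - (\<Union>ss\<in>SS. locus ss))} =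
      locus us - (\<Union>ss\<in>SS. T ss)" (is "?A = ?B")
  proof (intro equalityI subsetI)
    fix xs assume "xs \<in> ?A"
    then obtain a where a: "length xs = length ts" "xs[i := a] \<in> locus ts'" "\<And>ss. ss \<in> SS \<Longrightarrow> xs[i := a] \<notin> locus ss"
      using ts'(2) by auto
    from a(2) obtain z where z: "xs[i := a] = map (val z) ts'" by (rule locusE)
    \<comment> \<open>The new variable takes over the value of the coordinate \<open>i\<close> of \<open>xs\<close>.\<close>
    let ?z = "z(f := xs ! i)"
    have same: "map (val ?z) ts' = map (val z) ts'" using f by (intro mapval_cong) auto
    then have xs: "map (val ?z) us = xs" unfolding mapus by (simp add: z[symmetric])
    have "\<not> solves ?z (E ss)" if "ss \<in> SS" for ss
      using E(2)[OF that, of ?z] a(3)[OF that] same z by (simp add: ts'_def del: map_eq_conv)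
    then have "\<not> solves ?z (E' ss)" if "ss \<in> SS" for ss using E'(2)[OF that, of ?z] that by blast
    then have "map (val ?z) us \<in> ?B" using Tmem locusI by auto
    then show "xs \<in> ?B" by (simp only: xs)
  next
    fix xs assume B: "xs \<in> ?B"
    then obtain z where z: "xs = map (val z) us" by (auto elim: locusE)
    then have no: "\<not> solves z (E' ss)" if "ss \<in> SS" for ss using B Tmem that by auto
    \<comment> \<open>None of the systems holds on the whole fibre over \<open>xs\<close>, so by irreducibility they do not cover it.\<close>
    let ?F = "(\<lambda>ss. {y. solves y (E ss)}) ` SS"
    have "\<not> (\<exists>F\<in>?F. \<forall>y. (\<forall>j. j \<notin> J \<longrightarrow> y j = z j) \<longrightarrow> y \<in> F)"
      using no E'(2)[of _ z] by blast
    moreover have "\<forall>F\<in>?F. line_closed F" "finite ?F" using line_closed_solves E(1) SS(1) by auto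
    ultimately have "\<not> (\<forall>y. (\<forall>j. j \<notin> J \<longrightarrow> y j = z j) \<longrightarrow> (\<exists>F\<in>?F. y \<in> F))"
      using irreducible[OF \<open>finite J\<close>, of ?F z] by satx
    then obtain y where y: "\<And>j. j \<notin> J \<Longrightarrow> y j = z j" "\<And>ss. ss \<in> SS \<Longrightarrow> \<not> solves y (E ss)"
      by auto
    have len: "length xs = length ts" using z ts'(3) by (simp add: us_def)
    have "xs[i := val y (ts' ! i)] = map (val y) ts'"
    proof (rule nth_equalityI)
      fix k assume k: "k < length (xs[i := val y (ts' ! i)])"
      show "xs[i := val y (ts' ! i)] ! k = map (val y) ts' ! k"
      proof (cases "k = i")
        case True
        then show ?thesis using k len ts' by simp
      next
        case False
        have "val z (ts' ! k) = val y (ts' ! k)"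
        proof (rule val_cong)
          fix j assume "j \<in> vars (ts' ! k)"
          then have "j \<in> W" using False k len ts' by (auto simp: W_def)
          then show "z j = y j" using y(1) by (auto simp: J_def)
        qed
        then show ?thesis using False k len ts'(3) by (simp add: z us_def)
      qed
    qed (use len ts' in auto)
    then have "xs[i := val y (ts' ! i)] \<in> locus ts - (\<Union>ss\<in>SS. locus ss)"
      using y(2) E(2) ts'(2) locusI[of y ts'] by (auto simp: ts'_def simp del: map_map)
    then show "xs \<in> ?A" using len by blast
  qed
  then show ?thesis
  proof -
    have "constr (length ts) (T ss)" if "ss \<in> SS" for ss
      using T[OF that] by (rule constr_cell_or_empty)
    moreover have "constr (length ts) (locus us)"
      using wfus ts'(3) by (intro constr_locus) (auto simp: us_def)
    ultimately have "constr (length ts) (locus us - (\<Union>ss\<in>SS. T ss))"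
      using SS(1) by (intro constr_Diff constr_UN)
    then show ?thesis by (simp only: \<open>?A = ?B\<close>)
  qed
qed

theorem constr_exists:
  assumes "constr k S" "i < k"
  shows "constr k {xs. length xs = k \<and> (\<exists>a. xs[i := a] \<in> S)}"
  using assms(1)
proof (induction rule: constr.induct)
  case (cell ts SS)
  then show ?case using exists_cell[of ts i SS] assms(2) by auto
next
  case (union S T)
  have "{xs. length xs = k \<and> (\<exists>a. xs[i := a] \<in> S \<union> T)} = {xs. length xs = k \<and> (\<exists>a. xs[i := a] \<in> S)} \<union>
    {xs. length xs = k \<and> (\<exists>a. xs[i := a] \<in> T)}" by auto
  then show ?case using union constr.union by simp
qed (simp add: constr.empty)

lemma constr_section:
  assumes "constr (k + m) S" "length cs = m"
  shows "constr k {xs. length xs = k \<and> xs @ cs \<in> S}"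
proof -
  have "map (val (nth xs)) (map Leaf [0..<k] @ map Const cs) = xs @ cs" if "length xs = k" for xs
    using that map_nth[of xs] by (simp add: o_def)
  then have "{xs. length xs = k \<and> xs @ cs \<in> S} =
      {xs. length xs = k \<and> map (val (nth xs)) (map Leaf [0..<k] @ map Const cs) \<in> S}" by metis
  moreover have "constr k {xs. length xs = k \<and> map (val (nth xs)) (map Leaf [0..<k] @ map Const cs) \<in> S}"
    by (rule constr_pre[OF assms(1)]) (use assms(2) in auto)
  ultimately show ?thesis by simp
qed

lemma constr_proj:
  assumes "constr (k + m) S"
  shows "constr k {xs. length xs = k \<and> (\<exists>ys. length ys = m \<and> xs @ ys \<in> S)}"
  using assms
proof (induction m arbitrary: S)
  case 0
  then show ?case using constr_section[of k 0 S "[]"] by simp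
next
  case (Suc m)
  fix c :: 'a
  \<comment> \<open>Quantify the last coordinate; then it is arbitrary and can be cut off at the constant \<open>c\<close>.\<close>
  let ?S = "{ws. length ws = k + m \<and> (\<exists>a. ws @ [a] \<in> S)}"
  have "constr ((k + m) + 1) {ws. length ws = k + m + 1 \<and> (\<exists>a. ws[k + m := a] \<in> S)}"
    using constr_exists[OF Suc.prems, of "k + m"] by simp
  from constr_section[OF this, of "[c]"]
  have "constr (k + m) {ws. length ws = k + m \<and> ws @ [c] \<in> {ws. length ws = k + m + 1 \<and> (\<exists>a. ws[k + m := a] \<in> S)}}"
    by simp
  moreover have "{ws. length ws = k + m \<and> ws @ [c] \<in> {ws. length ws = k + m + 1 \<and> (\<exists>a. ws[k + m := a] \<in> S)}} = ?S"
    by (auto simp: list_update_append)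
  ultimately have "constr (k + m) ?S" by simp
  from Suc.IH[OF this]
  have "constr k {xs. length xs = k \<and> (\<exists>ys. length ys = m \<and> xs @ ys \<in> ?S)}" .
  moreover have "{xs. length xs = k \<and> (\<exists>ys. length ys = m \<and> xs @ ys \<in> ?S)} =
      {xs. length xs = k \<and> (\<exists>ys. length ys = Suc m \<and> xs @ ys \<in> S)}"
  proof (intro Collect_cong conj_cong refl iffI)
    fix xs :: "'a list" assume len: "length xs = k" and "\<exists>ys. length ys = m \<and> xs @ ys \<in> ?S"
    then obtain ys a where "length ys = m" "xs @ ys @ [a] \<in> S" by auto
    then show "\<exists>ys. length ys = Suc m \<and> xs @ ys \<in> S" by (intro exI[of _ "ys @ [a]"]) simp
  next
    fix xs :: "'a list" assume len: "length xs = k" and "\<exists>ys. length ys = Suc m \<and> xs @ ys \<in> S"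
    then obtain ys where "length ys = Suc m" "xs @ ys \<in> S" by auto
    then show "\<exists>ys. length ys = m \<and> xs @ ys \<in> ?S"
      using len by (intro exI[of _ "butlast ys"]) (auto intro!: exI[of _ "last ys"] simp: append_assoc[symmetric] simp del: append_assoc, metis append_assoc append_butlast_last_id length_0_conv nat.distinct(1))
  qed
  ultimately show ?case by simp
qed

text \<open>
  The normal form in the definition is inconvenient for properties that are stable under Boolean
  operations.
\<close>

lemma constr_induct_bool [consumes 1, case_names locus Int compl]:
  assumes "constr k S" and loc: "\<And>ts. wfl ts \<Longrightarrow> length ts = k \<Longrightarrow> P (locus ts)"
    and int: "\<And>S T. constr k S \<Longrightarrow> constr k T \<Longrightarrow> P S \<Longrightarrow> P T \<Longrightarrow> P (S \<inter> T)"
    and compl: "\<And>S. constr k S \<Longrightarrow> P S \<Longrightarrow> P (power_set k - S)"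
  shows "P S"
proof -
  have full: "P (power_set k)" using loc[of "map Leaf [0..<k]"] by (simp add: locus_Leaf)
  have em: "P {}" using compl[OF constr_power full] by simp
  have un: "P (S \<union> T)" if "constr k S" "constr k T" "P S" "P T" for S T
  proof -
    have "P (power_set k - ((power_set k - S) \<inter> (power_set k - T)))"
      using that by (intro compl int constr_Int constr_compl)
    moreover have "power_set k - ((power_set k - S) \<inter> (power_set k - T)) = S \<union> T"
      using that(1,2)[THEN constr_length] by auto
    ultimately show ?thesis by simp
  qed
  show ?thesis using assms(1)
  proof (induction rule: constr.induct)
    case (cell ts SS)
    have U: "constr k (\<Union>ss\<in>SS. locus ss) \<and> P (\<Union>ss\<in>SS. locus ss)" using cell(3,4)
    proof (induction SS rule: finite_induct)
      case (insert ss SS)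
      then show ?case using un[of "locus ss" "\<Union>ss\<in>SS. locus ss"] loc[of ss] constr_locus[of ss k]
          constr.union[of k "locus ss"] by auto
    qed (use em constr.empty in auto)
    then have "P (locus ts \<inter> (power_set k - (\<Union>ss\<in>SS. locus ss)))"
      using cell by (intro int compl loc constr_locus constr_compl) auto
    moreover have "locus ts \<inter> (power_set k - (\<Union>ss\<in>SS. locus ss)) = locus ts - (\<Union>ss\<in>SS. locus ss)"
      using length_locus cell by auto
    ultimately show ?case by simp
  qed (use em un in auto)
qed

section \<open>Definable sets are the constructible sets\<close>

text \<open>
  With semantic closure properties for this notion, formulas need not be written down.
\<close>

definition definable_pred :: "nat set \<Rightarrow> ((nat \<Rightarrow> 'a) \<Rightarrow> bool) \<Rightarrow> bool" where
  "definable_pred V P \<longleftrightarrow> (\<exists>\<phi>. fml_syms \<phi> \<subseteq> {..<n} \<and> free_vars \<phi> \<subseteq> V \<and> (\<forall>v. sat l v \<phi> \<longleftrightarrow> P v))"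

lemma definable_pred_conj: "definable_pred V P \<Longrightarrow> definable_pred V Q \<Longrightarrow> definable_pred V (\<lambda>v. P v \<and> Q v)"
proof -
  assume "definable_pred V P" "definable_pred V Q"
  then obtain \<phi> \<psi> where "fml_syms \<phi> \<subseteq> {..<n} \<and> free_vars \<phi> \<subseteq> V \<and> (\<forall>v. sat l v \<phi> \<longleftrightarrow> P v)"
    "fml_syms \<psi> \<subseteq> {..<n} \<and> free_vars \<psi> \<subseteq> V \<and> (\<forall>v. sat l v \<psi> \<longleftrightarrow> Q v)" unfolding definable_pred_def by blast
  then show ?thesis unfolding definable_pred_def by (intro exI[of _ "Conj \<phi> \<psi>"]) simp
qed

lemma definable_pred_neg: "definable_pred V P \<Longrightarrow> definable_pred V (\<lambda>v. \<not> P v)"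
proof -
  assume "definable_pred V P"
  then obtain \<phi> where "fml_syms \<phi> \<subseteq> {..<n} \<and> free_vars \<phi> \<subseteq> V \<and> (\<forall>v. sat l v \<phi> \<longleftrightarrow> P v)"
    unfolding definable_pred_def by blast
  then show ?thesis unfolding definable_pred_def by (intro exI[of _ "Neg \<phi>"]) simp
qed

lemma definable_pred_True: "definable_pred V (\<lambda>v. True)"
  unfolding definable_pred_def by (intro exI[of _ "Equal (Param undefined) (Param undefined)"]) simp

lemma definable_pred_ball: "finite I \<Longrightarrow> (\<And>i. i \<in> I \<Longrightarrow> definable_pred V (P i)) \<Longrightarrow> definable_pred V (\<lambda>v. \<forall>i\<in>I. P i v)"
  by (induction I rule: finite_induct) (auto intro: definable_pred_True definable_pred_conj)

lemma definable_pred_exists: "definable_pred V P \<Longrightarrow> definable_pred (V - {i}) (\<lambda>v. \<exists>a. P (v(i := a)))"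
proof -
  assume "definable_pred V P"
  then obtain \<phi> where "fml_syms \<phi> \<subseteq> {..<n} \<and> free_vars \<phi> \<subseteq> V \<and> (\<forall>v. sat l v \<phi> \<longleftrightarrow> P v)"
    unfolding definable_pred_def by blast
  then show ?thesis unfolding definable_pred_def by (intro exI[of _ "Exist i \<phi>"]) auto
qed

lemma definable_pred_exists_block:
  assumes "finite I" "definable_pred V P"
  shows "definable_pred (V - I) (\<lambda>v. \<exists>v'. (\<forall>j. j \<notin> I \<longrightarrow> v' j = v j) \<and> P v')"
  using assms(1)
proof (induction I rule: finite_induct)
  case empty
  have "(\<lambda>v. \<exists>v'. (\<forall>j. j \<notin> {} \<longrightarrow> v' j = v j) \<and> P v') = P"
    by (auto simp: fun_eq_iff[symmetric])
  then show ?case using assms(2) by simp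
next
  case (insert i I)
  have "(\<lambda>v. \<exists>v'. (\<forall>j. j \<notin> insert i I \<longrightarrow> v' j = v j) \<and> P v') =
      (\<lambda>v. \<exists>a v'. (\<forall>j. j \<notin> I \<longrightarrow> v' j = (v(i := a)) j) \<and> P v')"
  proof (intro ext iffI)
    fix v assume "\<exists>v'. (\<forall>j. j \<notin> insert i I \<longrightarrow> v' j = v j) \<and> P v'"
    then obtain v' where "\<forall>j. j \<notin> insert i I \<longrightarrow> v' j = v j" "P v'" by blast
    then show "\<exists>a v'. (\<forall>j. j \<notin> I \<longrightarrow> v' j = (v(i := a)) j) \<and> P v'"
      by (intro exI[of _ "v' i"] exI[of _ v']) auto
  next
    fix v assume "\<exists>a v'. (\<forall>j. j \<notin> I \<longrightarrow> v' j = (v(i := a)) j) \<and> P v'"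
    then obtain a v' where "\<forall>j. j \<notin> I \<longrightarrow> v' j = (v(i := a)) j" "P v'" by blast
    then show "\<exists>v'. (\<forall>j. j \<notin> insert i I \<longrightarrow> v' j = v j) \<and> P v'"
      by (intro exI[of _ v']) auto
  qed
  moreover have "V - insert i I = V - I - {i}" by blast
  ultimately show ?case using definable_pred_exists[OF insert.IH, of i] by (simp only:)
qed

text \<open>
  The constructor \<open>join\<close> is not in the language, so an equation with a node is expressed by comparing
  the children.
\<close>

lemma definable_pred_tree_eq:
  assumes "wf_tree t" "trm_syms e \<subseteq> {..<n}" "trm_vars e \<subseteq> V" "(+) k ` vars t \<subseteq> V"
  shows "definable_pred V (\<lambda>v. trm_val l v e = val (\<lambda>j. v (k + j)) t)"
  using assms
proof (induction t arbitrary: e)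
  case (Leaf j)
  then show ?case unfolding definable_pred_def by (intro exI[of _ "Equal e (Var (k + j))"]) auto
next
  case (Const a)
  then show ?case unfolding definable_pred_def by (intro exI[of _ "Equal e (Param a)"]) auto
next
  case (Node ts)
  then have len: "length ts = n" by simp
  have "definable_pred V (\<lambda>v. \<forall>i\<in>{..<n}. trm_val l v (App i e) = val (\<lambda>j. v (k + j)) (ts ! i))"
  proof (intro definable_pred_ball Node.IH)
    fix i assume i: "i \<in> {..<n}"
    then show *: "ts ! i \<in> set ts" using len by simp
    show "wf_tree (ts ! i)" using Node.prems(1) * by simp
    show "(+) k ` vars (ts ! i) \<subseteq> V" using Node.prems(4) * by auto
    show "trm_syms (App i e) \<subseteq> {..<n}" "trm_vars (App i e) \<subseteq> V" using Node.prems i by auto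
  qed simp
  moreover have "(\<forall>i\<in>{..<n}. trm_val l v (App i e) = val (\<lambda>j. v (k + j)) (ts ! i)) \<longleftrightarrow>
      trm_val l v e = val (\<lambda>j. v (k + j)) (Node ts)" for v
  proof
    assume *: "\<forall>i\<in>{..<n}. trm_val l v (App i e) = val (\<lambda>j. v (k + j)) (ts ! i)"
    have "map (\<lambda>i. l i (trm_val l v e)) [0..<n] = map (val (\<lambda>j. v (k + j))) ts"
      by (rule nth_equalityI) (use * len in auto)
    from arg_cong[OF this, of join] show "trm_val l v e = val (\<lambda>j. v (k + j)) (Node ts)" by (simp add: join_l)
  qed (use len in \<open>simp add: l_join\<close>)
  ultimately show ?case by simp
qed

lemma definable_in_pred:
  assumes "definable_pred {..<k} P"
  shows "definable_in n l k {xs. length xs = k \<and> P (nth xs)}"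
proof -
  obtain \<phi> where "fml_syms \<phi> \<subseteq> {..<n}" "free_vars \<phi> \<subseteq> {..<k}" "\<And>v. sat l v \<phi> \<longleftrightarrow> P v"
    using assms unfolding definable_pred_def by blast
  then show ?thesis unfolding definable_in_def by (intro exI[of _ \<phi>]) simp
qed

lemma definable_in_predE:
  assumes "definable_in n l k S"
  obtains P where "definable_pred {..<k} P" "S = {xs. length xs = k \<and> P (nth xs)}"
proof -
  obtain \<phi> where "fml_syms \<phi> \<subseteq> {..<n}" "free_vars \<phi> \<subseteq> {..<k}" "S = {xs. length xs = k \<and> sat l (nth xs) \<phi>}"
    using assms unfolding definable_in_def by blast
  then show ?thesis by (intro that[of "\<lambda>v. sat l v \<phi>"]) (auto simp: definable_pred_def)
qed

text \<open>
  The parameters are quantified existentially; they are stored in the variables from \<open>k\<close> on.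
\<close>

lemma definable_locus:
  assumes "wfl ts" "length ts = k"
  shows "definable_in n l k (locus ts)"
proof -
  let ?I = "(+) k ` varsl ts"
  let ?P = "\<lambda>v. \<forall>i\<in>{..<k}. v i = val (\<lambda>j. v (k + j)) (ts ! i)"
  have "definable_pred ({..<k} \<union> ?I) ?P"
  proof (intro definable_pred_ball)
    fix i assume i: "i \<in> {..<k}"
    have "definable_pred ({..<k} \<union> ?I) (\<lambda>v. trm_val l v (Var i) = val (\<lambda>j. v (k + j)) (ts ! i))"
    proof (rule definable_pred_tree_eq)
      have "ts ! i \<in> set ts" using i assms(2) by simp
      then show "wf_tree (ts ! i)" "(+) k ` vars (ts ! i) \<subseteq> {..<k} \<union> ?I" using assms(1) by blast+
    qed (use i in auto)
    then show "definable_pred ({..<k} \<union> ?I) (\<lambda>v. v i = val (\<lambda>j. v (k + j)) (ts ! i))" by simp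
  qed simp
  then have "definable_pred ({..<k} \<union> ?I - ?I) (\<lambda>v. \<exists>v'. (\<forall>j. j \<notin> ?I \<longrightarrow> v' j = v j) \<and> ?P v')"
    by (intro definable_pred_exists_block) auto
  moreover have "{..<k} \<union> ?I - ?I = {..<k}" by auto
  ultimately have "definable_in n l k {xs. length xs = k \<and> (\<exists>v'. (\<forall>j. j \<notin> ?I \<longrightarrow> v' j = xs ! j) \<and> ?P v')}"
    by (intro definable_in_pred) simp
  moreover have "{xs. length xs = k \<and> (\<exists>v'. (\<forall>j. j \<notin> ?I \<longrightarrow> v' j = xs ! j) \<and> ?P v')} = locus ts"
  proof (intro equalityI subsetI)
    fix xs assume "xs \<in> {xs. length xs = k \<and> (\<exists>v'. (\<forall>j. j \<notin> ?I \<longrightarrow> v' j = xs ! j) \<and> ?P v')}"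
    then obtain v' where v': "length xs = k" "\<And>j. j \<notin> ?I \<Longrightarrow> v' j = xs ! j" "?P v'" by blast
    have "xs = map (val (\<lambda>j. v' (k + j))) ts"
    proof (rule nth_equalityI)
      fix i assume i: "i < length xs"
      then have "xs ! i = v' i" using v'(1) v'(2)[of i] by fastforce
      then show "xs ! i = map (val (\<lambda>j. v' (k + j))) ts ! i" using v' i assms(2) by simp
    qed (use v' assms in auto)
    then show "xs \<in> locus ts" using locusI by metis
  next
    fix xs assume "xs \<in> locus ts"
    then obtain z where z: "xs = map (val z) ts" by (rule locusE)
    let ?v = "\<lambda>i. if i \<in> ?I then z (i - k) else xs ! i"
    have "val (\<lambda>j. ?v (k + j)) (ts ! i) = val z (ts ! i)" if "i < k" for i
    proof (rule val_cong)
      fix j assume "j \<in> vars (ts ! i)"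
      then have "j \<in> varsl ts" using that assms(2) nth_mem by blast
      then show "?v (k + j) = z j" by simp
    qed
    then have "?P ?v" using assms(2) z by auto
    then show "xs \<in> {xs. length xs = k \<and> (\<exists>v'. (\<forall>j. j \<notin> ?I \<longrightarrow> v' j = xs ! j) \<and> ?P v')}"
      using z assms(2) by (auto intro!: exI[of _ ?v])
  qed
  ultimately show ?thesis by simp
qed

lemma constr_definable: "constr k S \<Longrightarrow> definable_in n l k S"
proof (induction rule: constr_induct_bool)
  case (locus ts)
  then show ?case by (rule definable_locus)
next
  case (Int S T)
  obtain P where P: "definable_pred {..<k} P" "S = {xs. length xs = k \<and> P (nth xs)}"
    using Int(3) by (rule definable_in_predE)
  obtain Q where Q: "definable_pred {..<k} Q" "T = {xs. length xs = k \<and> Q (nth xs)}"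
    using Int(4) by (rule definable_in_predE)
  have "S \<inter> T = {xs. length xs = k \<and> P (nth xs) \<and> Q (nth xs)}" using P Q by auto
  then show ?case using definable_in_pred[OF definable_pred_conj[OF P(1) Q(1)]] by simp
next
  case (compl S)
  obtain P where P: "definable_pred {..<k} P" "S = {xs. length xs = k \<and> P (nth xs)}"
    using compl(2) by (rule definable_in_predE)
  have "power_set k - S = {xs. length xs = k \<and> \<not> P (nth xs)}" using P by auto
  then show ?case using definable_in_pred[OF definable_pred_neg[OF P(1)]] by simp
qed

lemma trm_as_word:
  assumes "trm_syms s \<subseteq> {..<n}"
  shows "\<exists>w t. set w \<subseteq> {..<n} \<and> ((\<exists>i\<in>trm_vars s. t = Leaf i) \<or> (\<exists>a. t = Const a)) \<and>
    (\<forall>v. trm_val l v s = foldr l w (val v t))"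
  using assms
proof (induction s)
  case (Var i)
  show ?case by (intro exI[of _ "[]"] exI[of _ "Leaf i"]) simp
next
  case (Param a)
  show ?case by (intro exI[of _ "[]"] exI[of _ "Const a"]) simp
next
  case (App f s)
  then obtain w t where "set w \<subseteq> {..<n} \<and> ((\<exists>i\<in>trm_vars s. t = Leaf i) \<or> (\<exists>a. t = Const a)) \<and>
    (\<forall>v. trm_val l v s = foldr l w (val v t))" by auto
  then show ?case using App.prems by (intro exI[of _ "f # w"] exI[of _ t]) auto
qed

lemma expand_Const: "(expand ^^ d) (Const a) = Const a"
  by (induction d) (auto simp: expand_def)

text \<open>
  In expanded coordinates, the terms of the language become trees.
\<close>

lemma constr_Equal:
  assumes s: "trm_syms s \<subseteq> {..<n}" "trm_vars s \<subseteq> {..<k}" and t: "trm_syms t \<subseteq> {..<n}" "trm_vars t \<subseteq> {..<k}"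
  shows "constr k {xs. length xs = k \<and> trm_val l (nth xs) s = trm_val l (nth xs) t}"
proof -
  obtain ws bs where s': "set ws \<subseteq> {..<n}" "(\<exists>i\<in>trm_vars s. bs = Leaf i) \<or> (\<exists>a. bs = Const a)"
    "\<And>v. trm_val l v s = foldr l ws (val v bs)" using trm_as_word[OF s(1)] by blast
  obtain wt bt where t': "set wt \<subseteq> {..<n}" "(\<exists>i\<in>trm_vars t. bt = Leaf i) \<or> (\<exists>a. bt = Const a)"
    "\<And>v. trm_val l v t = foldr l wt (val v bt)" using trm_as_word[OF t(1)] by blast
  define d where "d = max (length ws) (length wt)"
  define us where "us = map (expand ^^ d) (map Leaf [0..<k])"
  have wfus: "wfl us" "length us = k" "locus us = power_set k"
    using wfl_expand[of "map Leaf [0..<k]" d] locus_expand[of d "map Leaf [0..<k]"] locus_Leaf[of k]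
    by (auto simp: us_def)
  have base: "val (nth (map (val z) us)) b = val z ((expand ^^ d) b)"
    if "(\<exists>i\<in>{..<k}. b = Leaf i) \<or> (\<exists>a. b = Const a)" for b z
    using that by (auto simp: us_def expand_Const)
  have "wf_tree bs" "wf_tree bt" using s'(2) t'(2) by auto
  then obtain s1 t1 where s1: "wf_tree s1" "\<And>z. foldr l ws (val z ((expand ^^ d) bs)) = val z s1"
    and t1: "wf_tree t1" "\<And>z. foldr l wt (val z ((expand ^^ d) bt)) = val z t1"
    using word_of_expand[of bs ws d] word_of_expand[of bt wt d] s'(1) t'(1) unfolding d_def
    by (meson max.cobounded1 max.cobounded2)
  have vs: "trm_val l (nth (map (val z) us)) s = val z s1" for z
    using s1(2)[of z] s'(3) base[of bs z] s'(2) s(2) by (metis subsetD)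
  have vt: "trm_val l (nth (map (val z) us)) t = val z t1" for z
    using t1(2)[of z] t'(3) base[of bt z] t'(2) t(2) by (metis subsetD)
  have "{xs. length xs = k \<and> trm_val l (nth xs) s = trm_val l (nth xs) t} =
      {xs. \<exists>z. xs = map (val z) us \<and> solves z [(s1, t1)]}"
  proof (intro equalityI subsetI)
    fix xs assume xs: "xs \<in> {xs. length xs = k \<and> trm_val l (nth xs) s = trm_val l (nth xs) t}"
    then have "xs \<in> locus us" using wfus(3) by auto
    then obtain z where z: "xs = map (val z) us" by (rule locusE)
    then have "solves z [(s1, t1)]" using xs vs vt by simp
    then show "xs \<in> {xs. \<exists>z. xs = map (val z) us \<and> solves z [(s1, t1)]}" using z by blast
  next
    fix xs assume "xs \<in> {xs. \<exists>z. xs = map (val z) us \<and> solves z [(s1, t1)]}"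
    then obtain z where z: "xs = map (val z) us" "val z s1 = val z t1" by auto
    then show "xs \<in> {xs. length xs = k \<and> trm_val l (nth xs) s = trm_val l (nth xs) t}"
      using vs[of z] vt[of z] wfus(2) by simp
  qed
  then show ?thesis
    using image_of_solutions[of "[(s1, t1)]" us] s1(1) t1(1) wfus(1,2)
    by (intro constr_cell_or_empty) simp
qed

text \<open>
  Beyond the end, \<open>nth\<close> only depends on the distance to the end. So updating a list agrees with
  updating the assignment \<open>nth xs\<close>, even at indices that are out of range.
\<close>

lemma nth_beyond: "length xs \<le> j \<Longrightarrow> xs ! j = [] ! (j - length xs)"
  by (induction xs arbitrary: j) (auto simp: nth_Cons split: nat.split)

lemma nth_upd: "i < length xs \<Longrightarrow> (nth xs)(i := a) = nth (xs[i := a])"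
proof
  fix j assume i: "i < length xs"
  show "((nth xs)(i := a)) j = xs[i := a] ! j"
  proof (cases "j < length xs")
    case False
    then show ?thesis using i nth_beyond[of xs j] nth_beyond[of "xs[i := a]" j] by auto
  qed (use i in \<open>simp add: nth_list_update\<close>)
qed

text \<open>
  A bound \<open>K\<close> on the length of the lists leaves room for the bound variables of the formula.
\<close>

lemma constr_sat:
  assumes "fml_syms \<phi> \<subseteq> {..<n}"
  shows "\<exists>K. \<forall>k\<ge>K. constr k {xs. length xs = k \<and> sat l (nth xs) \<phi>}"
  using assms
proof (induction \<phi>)
  case (Equal s t)
  have "finite (trm_vars u)" for u :: "'a trm" by (induction u) auto
  then obtain K where K: "\<forall>i\<in>trm_vars s \<union> trm_vars t. i < K"
    using finite_nat_set_iff_bounded[of "trm_vars s \<union> trm_vars t"] by auto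
  have "constr k {xs. length xs = k \<and> trm_val l (nth xs) s = trm_val l (nth xs) t}" if "k \<ge> K" for k
  proof (rule constr_Equal)
    show "trm_vars s \<subseteq> {..<k}" "trm_vars t \<subseteq> {..<k}"
      using K[THEN bspec, THEN order_less_le_trans, OF _ that] by blast+
  qed (use Equal in auto)
  then show ?case by auto
next
  case (Neg \<phi>)
  then obtain K where K: "\<And>k. k \<ge> K \<Longrightarrow> constr k {xs. length xs = k \<and> sat l (nth xs) \<phi>}" by auto
  have "constr k {xs. length xs = k \<and> sat l (nth xs) (Neg \<phi>)}" if "k \<ge> K" for k
  proof -
    have "{xs. length xs = k \<and> sat l (nth xs) (Neg \<phi>)} = power_set k - {xs. length xs = k \<and> sat l (nth xs) \<phi>}" by auto
    then show ?thesis using constr_compl[OF K[OF that]] by simp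
  qed
  then show ?case by blast
next
  case (Conj \<phi> \<psi>)
  then obtain K K' where K: "\<And>k. k \<ge> K \<Longrightarrow> constr k {xs. length xs = k \<and> sat l (nth xs) \<phi>}"
    "\<And>k. k \<ge> K' \<Longrightarrow> constr k {xs. length xs = k \<and> sat l (nth xs) \<psi>}" by auto
  have "constr k {xs. length xs = k \<and> sat l (nth xs) (Conj \<phi> \<psi>)}" if "k \<ge> max K K'" for k
  proof -
    have "{xs. length xs = k \<and> sat l (nth xs) (Conj \<phi> \<psi>)} =
      {xs. length xs = k \<and> sat l (nth xs) \<phi>} \<inter> {xs. length xs = k \<and> sat l (nth xs) \<psi>}" by auto
    then show ?thesis using constr_Int[OF K(1) K(2)] that by simp
  qed
  then show ?case by blast
next
  case (Exist i \<phi>)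
  then obtain K where K: "\<And>k. k \<ge> K \<Longrightarrow> constr k {xs. length xs = k \<and> sat l (nth xs) \<phi>}" by auto
  have "constr k {xs. length xs = k \<and> sat l (nth xs) (Exist i \<phi>)}" if "k \<ge> max K (Suc i)" for k
  proof -
    have "{xs. length xs = k \<and> sat l (nth xs) (Exist i \<phi>)} =
      {xs. length xs = k \<and> (\<exists>a. xs[i := a] \<in> {xs. length xs = k \<and> sat l (nth xs) \<phi>})}"
      using that by (auto simp: nth_upd)
    then show ?thesis using constr_exists[OF K[of k], of i] that by simp
  qed
  then show ?case by blast
qed

lemma trm_val_cong: "(\<And>i. i \<in> trm_vars s \<Longrightarrow> v i = v' i) \<Longrightarrow> trm_val l v s = trm_val l v' s"
  by (induction s) auto

lemma sat_cong: "(\<And>i. i \<in> free_vars \<phi> \<Longrightarrow> v i = v' i) \<Longrightarrow> sat l v \<phi> \<longleftrightarrow> sat l v' \<phi>"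
proof (induction \<phi> arbitrary: v v')
  case (Equal s t)
  then show ?case using trm_val_cong[of s v v'] trm_val_cong[of t v v'] by simp
next
  case (Exist i \<phi>)
  have "sat l (v(i := a)) \<phi> \<longleftrightarrow> sat l (v'(i := a)) \<phi>" for a
    using Exist.prems by (intro Exist.IH) auto
  then show ?case by simp
next
  case (Conj \<phi> \<psi>)
  have "sat l v \<phi> \<longleftrightarrow> sat l v' \<phi>" "sat l v \<psi> \<longleftrightarrow> sat l v' \<psi>"
    using Conj.prems by (intro Conj.IH; simp)+
  then show ?case by simp
next
  case (Neg \<phi>)
  then show ?case by (metis free_vars.simps(2) sat.simps(2))
qed

theorem definable_iff_constr: "definable_in n l k S \<longleftrightarrow> constr k S"
proof
  assume "definable_in n l k S"
  then obtain \<phi> where \<phi>: "fml_syms \<phi> \<subseteq> {..<n}" "free_vars \<phi> \<subseteq> {..<k}" "S = {xs. length xs = k \<and> sat l (nth xs) \<phi>}"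
    unfolding definable_in_def by blast
  obtain K where "\<forall>m\<ge>K. constr m {xs. length xs = m \<and> sat l (nth xs) \<phi>}" using constr_sat[OF \<phi>(1)] by blast
  \<comment> \<open>The coordinates beyond \<open>k\<close> serve the bound variables only and may be filled with any constant.\<close>
  then have K: "constr (k + K) {xs. length xs = k + K \<and> sat l (nth xs) \<phi>}" by simp
  fix c :: 'a
  have "S = {xs. length xs = k \<and> xs @ replicate K c \<in> {xs. length xs = k + K \<and> sat l (nth xs) \<phi>}}"
  proof -
    have "sat l (nth (xs @ replicate K c)) \<phi> \<longleftrightarrow> sat l (nth xs) \<phi>" if "length xs = k" for xs
      using \<phi>(2) that by (intro sat_cong) (auto simp: nth_append)
    then show ?thesis unfolding \<phi>(3) by auto
  qed
  then show "constr k S" using constr_section[OF K, of "replicate K c"] by simp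
qed (rule constr_definable)

section \<open>Fubini and invariance of the Euler characteristic\<close>

definition ind :: "'a list set \<Rightarrow> 'a list \<Rightarrow> complex" where
  "ind A = (\<lambda>xs. of_bool (xs \<in> A))"

definition euler :: "complex \<Rightarrow> 'a list set \<Rightarrow> complex" where
  "euler z A = chi z (ind A)"

lemma spanned_ind: "constr k S \<Longrightarrow> spanned (ind S)"
  using spanned_constr by (simp add: ind_def)

lemma euler_locus: "z ^ n = z \<Longrightarrow> wfl ts \<Longrightarrow> euler z (locus ts) = z ^ rk ts"
  by (simp add: euler_def ind_def chi_locus)

lemma ind_empty: "ind {} = (\<lambda>xs. 0)"
  by (simp add: ind_def)

lemma chi_0: "z ^ n = z \<Longrightarrow> chi z (\<lambda>xs. 0) = 0"
proof -
  assume "z ^ n = z"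
  moreover have "fn [] = (\<lambda>xs. 0)" by (rule ext) simp
  ultimately show ?thesis using chi_fn[of z "[]"] by simp
qed

lemma euler_empty: "z ^ n = z \<Longrightarrow> euler z {} = 0"
  by (simp add: euler_def ind_empty chi_0)

lemma ind_Un: "A \<inter> B = {} \<Longrightarrow> ind (A \<union> B) = (\<lambda>xs. ind A xs + ind B xs)"
  by (auto simp: ind_def fun_eq_iff)

lemma euler_Un:
  assumes "z ^ n = z" "spanned (ind A)" "spanned (ind B)" "A \<inter> B = {}"
  shows "euler z (A \<union> B) = euler z A + euler z B"
  using chi_add[OF assms(1-3)] by (simp add: euler_def ind_Un assms(4))

lemma euler_UN:
  assumes "z ^ n = z" "finite I" "\<And>i. i \<in> I \<Longrightarrow> spanned (ind (S i))"
    "\<And>i j. i \<in> I \<Longrightarrow> j \<in> I \<Longrightarrow> i \<noteq> j \<Longrightarrow> S i \<inter> S j = {}"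
  shows "spanned (ind (\<Union>i\<in>I. S i)) \<and> euler z (\<Union>i\<in>I. S i) = (\<Sum>i\<in>I. euler z (S i))"
  using assms(2-4)
proof (induction I rule: finite_induct)
  case empty
  then show ?case using spanned_0 euler_empty[OF assms(1)] by (simp add: ind_empty)
next
  case (insert i I)
  have IH: "spanned (ind (\<Union>i\<in>I. S i))" "euler z (\<Union>i\<in>I. S i) = (\<Sum>i\<in>I. euler z (S i))"
    using insert by simp_all
  have disj: "S i \<inter> (\<Union>i\<in>I. S i) = {}" using insert.prems(2)[of i] insert.hyps by fastforce
  have Si: "spanned (ind (S i))" using insert.prems(1) by simp
  have "spanned (ind (S i \<union> (\<Union>i\<in>I. S i)))"
    unfolding ind_Un[OF disj] by (rule spanned_add[OF Si IH(1)])
  then show ?case using euler_Un[OF assms(1) Si IH(1) disj] IH(2) insert.hyps by simp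
qed

lemma representation:
  assumes "constr k S"
  obtains L where "wfL L" "\<forall>(a, ts)\<in>set L. length ts = k" "fn L = ind S"
proof -
  obtain M where M: "wfL M" "ind S = fn M" using spanned_ind[OF assms] by (auto simp: spanned_def)
  let ?L = "filter (\<lambda>(a, ts). length ts = k) M"
  have "fn (filter (\<lambda>(a, ts). length ts = k) N) xs = (if length xs = k then fn N xs else 0)" for N xs
    using length_locus by (induction N) auto
  then have "fn ?L xs = ind S xs" for xs
    using M(2)[symmetric] constr_length[OF assms] by (auto simp: ind_def)
  then have "fn ?L = ind S" by blast
  then show ?thesis using M(1) by (intro that[of ?L]) auto
qed

text \<open>
  Integration over the coordinates after the first \<open>k\<close>: over each point of its projection, a locus
  has a fibre parametrised by the variables that do not occur in the first \<open>k\<close> coordinates.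
\<close>

definition fibres :: "complex \<Rightarrow> nat \<Rightarrow> (complex \<times> 'a tree list) list \<Rightarrow> (complex \<times> 'a tree list) list" where
  "fibres z k L = map (\<lambda>(a, ts). (a * z ^ card (varsl (drop k ts) - varsl (take k ts)), take k ts)) L"

lemma varsl_take_drop: "varsl ts = varsl (take k ts) \<union> varsl (drop k ts)"
  by (metis UN_Un append_take_drop_id set_append)

lemma ev_fibres: "ev z (fibres z k L) = ev z L"
proof -
  have "rk ts = card (varsl (drop k ts) - varsl (take k ts)) + rk (take k ts)" for ts
  proof -
    have "varsl ts = (varsl (drop k ts) - varsl (take k ts)) \<union> varsl (take k ts)"
      using varsl_take_drop[of ts k] by blast
    moreover have "card ((varsl (drop k ts) - varsl (take k ts)) \<union> varsl (take k ts)) =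
        card (varsl (drop k ts) - varsl (take k ts)) + card (varsl (take k ts))"
      by (rule card_Un_disjoint) auto
    ultimately show ?thesis by (simp only: rk_def)
  qed
  then have *: "z ^ rk ts = z ^ card (varsl (drop k ts) - varsl (take k ts)) * z ^ rk (take k ts)" for ts
    by (metis power_add)
  show ?thesis
  proof (induction L)
    case (Cons e L)
    then show ?case using *[of "snd e"] by (cases e) (simp add: fibres_def)
  qed (simp add: fibres_def)
qed

lemma locus_fibre:
  assumes "wfl ts" "length ts = k + m" "length xs = k"
  shows "(xs \<notin> locus (take k ts) \<and> (\<forall>ys. xs @ ys \<notin> locus ts)) \<or>
    (xs \<in> locus (take k ts) \<and> (\<exists>us. wfl us \<and> rk us = card (varsl (drop k ts) - varsl (take k ts)) \<and>
       (\<forall>ys. xs @ ys \<in> locus ts \<longleftrightarrow> ys \<in> locus us)))"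
proof (cases "xs \<in> locus (take k ts)")
  case False
  have "xs @ ys \<notin> locus ts" for ys
  proof
    assume "xs @ ys \<in> locus ts"
    then obtain z where "xs @ ys = map (val z) ts" by (rule locusE)
    then have "xs = map (val z) (take k ts)" using assms(3) by (metis append_eq_conv_conj take_map)
    then show False using False locusI by metis
  qed
  then show ?thesis using False by blast
next
  case True
  then obtain w where w: "xs = map (val w) (take k ts)" by (rule locusE)
  let ?X = "varsl (take k ts)"
  define \<sigma> where "\<sigma> = (\<lambda>j. if j \<in> ?X then Const (w j) else Leaf j)"
  let ?us = "map (subst \<sigma>) (drop k ts)"
  have wf: "wfl (take k ts)" "wfl (drop k ts)" using assms(1) by (auto dest: in_set_takeD in_set_dropD)
  have "wfl ?us" using wf by (auto intro!: wf_subst simp: \<sigma>_def)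
  moreover have "varsl ?us = varsl (drop k ts) - ?X"
  proof -
    have "vars (\<sigma> j) = (if j \<in> ?X then {} else {j})" for j by (simp add: \<sigma>_def)
    then show ?thesis by (simp add: vars_subst) blast
  qed
  then have "rk ?us = card (varsl (drop k ts) - ?X)" by (simp only: rk_def)
  moreover have "xs @ ys \<in> locus ts \<longleftrightarrow> ys \<in> locus ?us" for ys
  proof
    assume "xs @ ys \<in> locus ts"
    then obtain z where z: "xs @ ys = map (val z) ts" by (rule locusE)
    then have xy: "xs = map (val z) (take k ts)" "ys = map (val z) (drop k ts)"
      using assms(3) by (metis append_eq_conv_conj take_map, metis append_eq_conv_conj drop_map)
    then have "w j = z j" if "j \<in> ?X" for j
      using mapval_inj[OF wf(1) _ that, of w z] w by simp
    then have "pull \<sigma> z = z" by (auto simp: pull_def \<sigma>_def)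
    then have "ys = map (val z) ?us" unfolding mapval_subst using xy(2) by simp
    then show "ys \<in> locus ?us" using locusI by metis
  next
    assume "ys \<in> locus ?us"
    then obtain z where "ys = map (val z) ?us" by (rule locusE)
    then have ys: "ys = map (val (pull \<sigma> z)) (drop k ts)" unfolding mapval_subst .
    have "xs = map (val (pull \<sigma> z)) (take k ts)"
      unfolding w by (rule mapval_cong) (simp add: pull_def \<sigma>_def)
    then have "xs @ ys = map (val (pull \<sigma> z)) ts"
      using ys by (metis append_take_drop_id map_append)
    then show "xs @ ys \<in> locus ts" using locusI by metis
  qed
  ultimately show ?thesis using True by blast
qed

text \<open>
  The fibrewise integral of a combination, computed term by term. It is well defined as a function
  because the integral of each fibre depends only on the fibre.
\<close>

lemma chi_fibres:
  assumes z: "z ^ n = z" and "wfL L" "\<forall>(a, ts)\<in>set L. length ts = k + m" "length xs = k"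
  shows "spanned (\<lambda>ys. fn L (xs @ ys)) \<and> chi z (\<lambda>ys. fn L (xs @ ys)) = fn (fibres z k L) xs"
  using assms(2,3)
proof (induction L)
  case Nil
  then show ?case using spanned_0 chi_0[OF z] by (simp add: fibres_def)
next
  case (Cons e L)
  obtain a ts where e: "e = (a, ts)" by (cases e)
  have IH: "spanned (\<lambda>ys. fn L (xs @ ys))" "chi z (\<lambda>ys. fn L (xs @ ys)) = fn (fibres z k L) xs"
    using Cons by auto
  let ?c = "card (varsl (drop k ts) - varsl (take k ts))"
  have "spanned (\<lambda>ys. a * of_bool (xs @ ys \<in> locus ts)) \<and>
    chi z (\<lambda>ys. a * of_bool (xs @ ys \<in> locus ts)) = a * z ^ ?c * of_bool (xs \<in> locus (take k ts))"
  proof (cases "xs \<in> locus (take k ts)")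
    case False
    then show ?thesis using locus_fibre[of ts k m xs] Cons.prems assms(4) e spanned_0 chi_0[OF z] by auto
  next
    case True
    then obtain us where us: "wfl us" "rk us = ?c" "\<And>ys. xs @ ys \<in> locus ts \<longleftrightarrow> ys \<in> locus us"
      using locus_fibre[of ts k m xs] Cons.prems assms(4) e by auto
    have "(\<lambda>ys. a * of_bool (xs @ ys \<in> locus ts)) = fn [(a, us)]" by (rule ext) (simp add: us(3))
    moreover have "chi z (fn [(a, us)]) = a * z ^ ?c" using us chi_fn[OF z, of "[(a, us)]"] by simp
    moreover have "spanned (fn [(a, us)])" unfolding spanned_def using us(1) by (intro exI[of _ "[(a, us)]"]) simp
    ultimately show ?thesis using True by simp
  qed
  then show ?case
    using spanned_add[OF _ IH(1), of "\<lambda>ys. a * of_bool (xs @ ys \<in> locus ts)"]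
      chi_add[OF z _ IH(1), of "\<lambda>ys. a * of_bool (xs @ ys \<in> locus ts)"] IH(2)
    by (simp add: e fibres_def)
qed

text \<open>
  If a projection is injective on \<open>S\<close>, the fibrewise integral of the indicator function of \<open>S\<close> is the
  indicator function of the image, since a point has the weight \<open>z ^ 0 = 1\<close>.
\<close>

lemma euler_projection:
  assumes z: "z ^ n = z" and S: "constr (k + m) S"
    and inj: "\<And>xs ys ys'. length xs = k \<Longrightarrow> xs @ ys \<in> S \<Longrightarrow> xs @ ys' \<in> S \<Longrightarrow> ys = ys'"
  shows "euler z {xs. length xs = k \<and> (\<exists>ys. xs @ ys \<in> S)} = euler z S"
proof -
  obtain L where L: "wfL L" "\<forall>(a, ts)\<in>set L. length ts = k + m" "fn L = ind S"
    using representation[OF S] by blast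
  let ?A = "{xs. length xs = k \<and> (\<exists>ys. xs @ ys \<in> S)}"
  have wf: "wfL (fibres z k L)" using L(1) by (fastforce simp: fibres_def dest: in_set_takeD)
  have "fn (fibres z k L) xs = ind ?A xs" for xs
  proof (cases "length xs = k")
    case len: True
    have chi: "chi z (\<lambda>ys. ind S (xs @ ys)) = fn (fibres z k L) xs"
      using chi_fibres[OF z L(1,2) len] L(3) by simp
    show ?thesis
    proof (cases "\<exists>ys. xs @ ys \<in> S")
      case True
      then obtain ys where ys: "xs @ ys \<in> S" by blast
      then have "xs @ ys' \<in> S \<longleftrightarrow> ys' \<in> locus (map Const ys)" for ys'
        using inj[OF len] by (auto simp: locus_def o_def)
      then have "(\<lambda>ys. ind S (xs @ ys)) = (\<lambda>ys'. of_bool (ys' \<in> locus (map Const ys)))"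
        by (simp add: ind_def)
      moreover have "chi z (\<lambda>ys'. of_bool (ys' \<in> locus (map Const ys))) = z ^ rk (map Const ys)"
        by (rule chi_locus[OF z]) auto
      moreover have "rk (map Const ys) = 0" by (simp add: rk_def)
      ultimately show ?thesis using chi len ys by (auto simp: ind_def)
    next
      case False
      then show ?thesis using chi chi_0[OF z] by (simp add: ind_def)
    qed
  next
    case False
    have "fn (fibres z k L) xs = 0" using L(2)
    proof (induction L)
      case (Cons e L)
      then have "length (take k (snd e)) = k" by (auto simp: min_def)
      then have "xs \<notin> locus (take k (snd e))" using False length_locus by metis
      then show ?case using Cons by (auto simp: fibres_def)
    qed (simp add: fibres_def)
    then show ?thesis using False by (simp add: ind_def)
  qed
  then have "fn (fibres z k L) = ind ?A" by blast
  then have "euler z ?A = ev z (fibres z k L)" using chi_fn[OF z wf] by (simp add: euler_def)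
  also have "\<dots> = ev z L" by (rule ev_fibres)
  also have "\<dots> = euler z S" using chi_fn[OF z L(1)] L(3) by (simp add: euler_def)
  finally show ?thesis .
qed

definition swap :: "nat \<Rightarrow> 'a list set \<Rightarrow> 'a list set" where
  "swap k S = {drop k ws @ take k ws | ws. ws \<in> S}"

lemma swap_mem:
  assumes "S \<subseteq> power_set (k + m)" "length ys = m" 
  shows "ys @ xs \<in> swap k S \<longleftrightarrow> xs @ ys \<in> S \<and> length xs = k"
proof
  assume "ys @ xs \<in> swap k S"
  then obtain ws where ws: "ws \<in> S" "ys @ xs = drop k ws @ take k ws" by (auto simp: swap_def)
  then have "length (drop k ws) = m" using assms(1) by auto
  then have "ys = drop k ws" "xs = take k ws" using ws(2) assms(2) by (auto simp: append_eq_append_conv)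
  then show "xs @ ys \<in> S \<and> length xs = k" using ws(1) assms(1) by auto
next
  assume "xs @ ys \<in> S \<and> length xs = k"
  then show "ys @ xs \<in> swap k S" unfolding swap_def by (auto intro!: exI[of _ "xs @ ys"])
qed

lemma constr_reindex:
  assumes "constr m S" "length is = m" "set is \<subseteq> {..<k}"
  shows "constr k {ws. length ws = k \<and> map (nth ws) is \<in> S}"
proof -
  have "constr k {ws. length ws = k \<and> map (val (nth ws)) (map Leaf is) \<in> S}"
    by (rule constr_pre[OF assms(1)]) (use assms(2,3) in auto)
  then show ?thesis by (simp add: o_def)
qed

lemma map_nth_block:
  "map (nth (xs @ ys @ zs)) [length xs..<length xs + length ys] = ys"
  by (rule nth_equalityI) (auto simp: nth_append)

lemma constr_swap:
  assumes "constr (k + m) S"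
  shows "constr (m + k) (swap k S)"
proof -
  have nth: "map (nth ws) ([m..<m + k] @ [0..<m]) = drop m ws @ take m ws" if "length ws = m + k" for ws :: "'a list"
    using that by (intro nth_equalityI) (auto simp: nth_append)
  have "swap k S = {ws. length ws = m + k \<and> map (nth ws) ([m..<m + k] @ [0..<m]) \<in> S}"
  proof (intro equalityI subsetI)
    fix ws assume "ws \<in> swap k S"
    then obtain vs where vs: "vs \<in> S" "ws = drop k vs @ take k vs" by (auto simp: swap_def)
    then have "length vs = k + m" using constr_length[OF assms] by auto
    then show "ws \<in> {ws. length ws = m + k \<and> map (nth ws) ([m..<m + k] @ [0..<m]) \<in> S}"
      using vs nth[of ws] by simp
  next
    fix ws assume "ws \<in> {ws. length ws = m + k \<and> map (nth ws) ([m..<m + k] @ [0..<m]) \<in> S}"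
    then have "drop m ws @ take m ws \<in> S" "length ws = m + k" using nth[of ws] by auto
    then show "ws \<in> swap k S" unfolding swap_def by (auto intro!: exI[of _ "drop m ws @ take m ws"])
  qed
  moreover have "constr (m + k) {ws. length ws = m + k \<and> map (nth ws) ([m..<m + k] @ [0..<m]) \<in> S}"
    by (rule constr_reindex[OF assms]) auto
  ultimately show ?thesis by (simp only:)
qed

lemma mapval_swap: "length ts = k + m \<Longrightarrow> ws \<in> locus (drop k ts @ take k ts) \<longleftrightarrow>
    (\<exists>ws'. ws' \<in> locus ts \<and> ws = drop k ws' @ take k ws')"
  unfolding locus_def by (auto simp: drop_map take_map)

lemma euler_swap:
  assumes z: "z ^ n = z" and S: "constr (k + m) S"
  shows "euler z (swap k S) = euler z S"
proof -
  obtain L where L: "wfL L" "\<forall>(a, ts)\<in>set L. length ts = k + m" "fn L = ind S"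
    using representation[OF S] by blast
  define L' where "L' = map (\<lambda>(a, ts). (a, drop k ts @ take k ts)) L"
  have wf: "wfL L'" using L(1) by (fastforce simp: L'_def dest: in_set_takeD in_set_dropD)
  have "rk (drop k ts @ take k ts) = rk ts" for ts
    using varsl_take_drop[of ts k] by (simp add: rk_def Un_commute)
  then have ev: "ev z L' = ev z L" unfolding L'_def by (induction L) auto
  have len: "fn M ws = 0" if "length ws \<noteq> k + m" "\<forall>(a, ts)\<in>set M. length ts = k + m" for M ws
    using that length_locus by (induction M) auto
  have fn': "fn (map (\<lambda>(a, ts). (a, drop k ts @ take k ts)) M) (ys @ xs) = fn M (xs @ ys)"
    if "\<forall>(a, ts)\<in>set M. length ts = k + m" "length xs = k" "length ys = m" for M xs ys
    using that(1)
  proof (induction M)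
    case (Cons e M)
    obtain a ts where e: "e = (a, ts)" by (cases e)
    have "ys @ xs \<in> locus (drop k ts @ take k ts) \<longleftrightarrow> ys @ xs \<in> swap k (locus ts)"
      using mapval_swap[of ts k m "ys @ xs"] Cons.prems e by (auto simp: swap_def)
    also have "\<dots> \<longleftrightarrow> xs @ ys \<in> locus ts"
      using swap_mem[of "locus ts" k m ys xs] length_locus[of _ ts] that(2,3) Cons.prems e by fastforce
    finally show ?case using Cons e by simp
  qed simp
  have "fn L' ws = ind (swap k S) ws" for ws
  proof (cases "length ws = k + m")
    case True
    define ys xs where "ys = take m ws" and "xs = drop m ws"
    have ws: "ws = ys @ xs" "length ys = m" "length xs = k" using True by (auto simp: ys_def xs_def)
    show ?thesis
      using fn'[OF L(2) ws(3,2)] L(3) swap_mem[OF constr_length[OF S] ws(2), of xs] ws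
      by (simp add: L'_def ind_def)
  next
    case False
    then have "ws \<notin> swap k S" using constr_length[OF S] by (auto simp: swap_def)
    moreover have "\<forall>(a, ts)\<in>set L'. length ts = k + m" using L(2) by (auto simp: L'_def)
    ultimately show ?thesis using len[OF False] by (simp add: ind_def)
  qed
  then have "fn L' = ind (swap k S)" by blast
  then show ?thesis using chi_fn[OF z wf] chi_fn[OF z L(1)] ev L(3) by (simp add: euler_def)
qed

section \<open>Definable subsets of the disjoint union of the powers\<close>

lemma Def_iff: "A \<in> Def n l \<longleftrightarrow> finite (length ` A) \<and> (\<forall>k. constr k {xs \<in> A. length xs = k})"
  by (simp add: Def_def definable_iff_constr)

lemma Def_finite: "A \<in> Def n l \<Longrightarrow> finite (length ` A)"
  and Def_piece: "A \<in> Def n l \<Longrightarrow> constr k {xs \<in> A. length xs = k}"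
  by (auto simp: Def_iff)

lemma Def_constr: "constr k S \<Longrightarrow> S \<in> Def n l"
proof -
  assume S: "constr k S"
  have "length ` S \<subseteq> {k}" using constr_length[OF S] by auto
  moreover have "{xs \<in> S. length xs = m} = (if m = k then S else {})" for m
    using constr_length[OF S] by auto
  ultimately show ?thesis using S constr.empty by (auto simp: Def_iff finite_subset)
qed

lemma Def_Un: "A \<in> Def n l \<Longrightarrow> B \<in> Def n l \<Longrightarrow> A \<union> B \<in> Def n l"
proof -
  assume A: "A \<in> Def n l" "B \<in> Def n l"
  have "{xs \<in> A \<union> B. length xs = m} = {xs \<in> A. length xs = m} \<union> {xs \<in> B. length xs = m}" for m by auto
  then show ?thesis using A by (auto simp: Def_iff image_Un intro: constr.union)
qed

lemma Def_Diff: "A \<in> Def n l \<Longrightarrow> B \<in> Def n l \<Longrightarrow> A - B \<in> Def n l"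
proof -
  assume A: "A \<in> Def n l" "B \<in> Def n l"
  have "{xs \<in> A - B. length xs = m} = {xs \<in> A. length xs = m} - {xs \<in> B. length xs = m}" for m by auto
  moreover have "finite (length ` (A - B))" using Def_finite[OF A(1)] by (rule finite_subset[rotated]) auto
  ultimately show ?thesis using A by (auto simp: Def_iff intro: constr_Diff)
qed

lemma Def_empty: "{} \<in> Def n l"
  using Def_constr[OF constr.empty[of 0]] .

lemma Def_pieces: "A = (\<Union>k\<in>length ` A. {xs \<in> A. length xs = k})"
  by auto

lemma spanned_Def: assumes "A \<in> Def n l" shows "spanned (ind A)"
proof -
  have "0 ^ n = (0 :: complex)" using n_pos by simp
  from euler_UN[OF this Def_finite[OF assms], of "\<lambda>k. {xs \<in> A. length xs = k}"]
  have "spanned (ind (\<Union>k\<in>length ` A. {xs \<in> A. length xs = k}))"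
    using spanned_ind[OF Def_piece[OF assms]] by auto
  then show ?thesis by (simp only: Def_pieces[of A, symmetric])
qed

lemma euler_add: "z ^ n = z \<Longrightarrow> A \<in> Def n l \<Longrightarrow> B \<in> Def n l \<Longrightarrow> A \<inter> B = {} \<Longrightarrow>
    euler z (A \<union> B) = euler z A + euler z B"
  by (intro euler_Un spanned_Def)

definition graph_piece :: "('a list \<Rightarrow> 'a list) \<Rightarrow> 'a list set \<Rightarrow> nat \<Rightarrow> nat \<Rightarrow> 'a list set" where
  "graph_piece f A k m = {xs @ f xs | xs. xs \<in> A \<and> length xs = k \<and> length (f xs) = m}"

lemma definable_bij_iff:
  "definable_bij n l A B f \<longleftrightarrow> bij_betw f A B \<and> (\<forall>k m. constr (k + m) (graph_piece f A k m))"
  by (simp add: definable_bij_def definable_iff_constr graph_piece_def)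

lemma graph_piece_mem:
  "length xs = k \<Longrightarrow> xs @ ys \<in> graph_piece f A k m \<longleftrightarrow> xs \<in> A \<and> ys = f xs \<and> length ys = m"
  by (auto simp: graph_piece_def)

text \<open>
  Both projections of the graph are injective, so the graph has the Euler characteristic of the
  domain and that of the range. The graph is cut into pieces with constant lengths.
\<close>

theorem euler_bij:
  assumes z: "z ^ n = z" and A: "A \<in> Def n l" and B: "B \<in> Def n l" and f: "definable_bij n l A B f"
  shows "euler z A = euler z B"
proof -
  let ?I = "length ` A \<times> length ` B"
  define SA where "SA = (\<lambda>(k, m). {xs \<in> A. length xs = k \<and> length (f xs) = m})"
  define SB where "SB = (\<lambda>(k, m). {f xs | xs. xs \<in> A \<and> length xs = k \<and> length (f xs) = m})"
  have bij: "bij_betw f A B" and G: "\<And>k m. constr (k + m) (graph_piece f A k m)"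
    using f by (auto simp: definable_bij_iff)
  have fin: "finite ?I" using A B Def_finite by blast
  have fA: "f ` A = B" "inj_on f A" using bij by (auto simp: bij_betw_def)
  have SA: "SA (k, m) = {xs. length xs = k \<and> (\<exists>ys. xs @ ys \<in> graph_piece f A k m)}" for k m
    by (auto simp: SA_def graph_piece_mem)
  have SA': "SA (k, m) = {xs. length xs = k \<and> (\<exists>ys. length ys = m \<and> xs @ ys \<in> graph_piece f A k m)}" for k m
    by (auto simp: SA_def graph_piece_mem)
  have len: "graph_piece f A k m \<subseteq> power_set (k + m)" for k m using constr_length[OF G] .
  have sw: "ys @ xs \<in> swap k (graph_piece f A k m) \<longleftrightarrow> xs \<in> A \<and> ys = f xs \<and> length xs = k"
    if "length ys = m" for xs ys k m
    using swap_mem[OF len that] graph_piece_mem that by auto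
  have Gs: "constr (m + k) (swap k (graph_piece f A k m))" for k m
    by (rule constr_swap[OF G])
  have SB: "SB (k, m) = {ys. length ys = m \<and> (\<exists>xs. ys @ xs \<in> swap k (graph_piece f A k m))}" for k m
    by (auto simp: SB_def sw)
  have SB': "SB (k, m) = {ys. length ys = m \<and> (\<exists>xs. length xs = k \<and> ys @ xs \<in> swap k (graph_piece f A k m))}" for k m
    by (auto simp: SB_def sw)
  have "euler z (SA (k, m)) = euler z (graph_piece f A k m)" for k m
    unfolding SA by (rule euler_projection[OF z G]) (auto simp: graph_piece_mem)
  moreover have "euler z (SB (k, m)) = euler z (swap k (graph_piece f A k m))" for k m
    unfolding SB using fA(2) by (intro euler_projection[OF z Gs]) (auto simp: sw inj_on_def)
  ultimately have eq: "euler z (SA i) = euler z (SB i)" for i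
    using euler_swap[OF z G] by (cases i) simp
  have "spanned (ind (SA i))" for i
    using spanned_ind[OF constr_proj[OF G]] by (cases i) (simp add: SA')
  then have sumA: "euler z (\<Union>i\<in>?I. SA i) = (\<Sum>i\<in>?I. euler z (SA i))"
    by (intro euler_UN[OF z fin, THEN conjunct2]) (auto simp: SA_def)
  have "spanned (ind (SB i))" for i
    using spanned_ind[OF constr_proj[OF Gs]] by (cases i) (simp add: SB')
  moreover have "SB i \<inter> SB j = {}" if "i \<noteq> j" for i j
  proof -
    have "i = j" if ys: "ys \<in> SB i" "ys \<in> SB j" for ys
    proof -
      obtain xs xs' where "xs \<in> A" "ys = f xs" "i = (length xs, length ys)"
        "xs' \<in> A" "ys = f xs'" "j = (length xs', length ys)"
        using ys by (auto simp: SB_def split: prod.splits)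
      then show ?thesis using inj_onD[OF fA(2), of xs xs'] by auto
    qed
    then show ?thesis using that by blast
  qed
  ultimately have "euler z (\<Union>i\<in>?I. SB i) = (\<Sum>i\<in>?I. euler z (SB i))"
    by (intro euler_UN[OF z fin, THEN conjunct2])
  moreover note sumA
  moreover have "(\<Union>i\<in>?I. SA i) = A" "(\<Union>i\<in>?I. SB i) = B" using fA(1) by (auto simp: SA_def SB_def)
  ultimately show ?thesis using eq by simp
qed

section \<open>Products\<close>

definition conc :: "'a list set \<Rightarrow> 'a list set \<Rightarrow> 'a list set" where
  "conc A B = (\<lambda>(xs, ys). xs @ ys) ` (A \<times> B)"

abbreviation conc_inj :: "'a list set \<Rightarrow> 'a list set \<Rightarrow> bool" where
  "conc_inj A B \<equiv> inj_on (\<lambda>(xs, ys). xs @ ys) (A \<times> B)"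

text \<open>
  The indicator function of a product of two sets of lists, when concatenation is injective on it:
  at most one way of splitting a list contributes.
\<close>

definition convolve :: "('a list \<Rightarrow> complex) \<Rightarrow> ('a list \<Rightarrow> complex) \<Rightarrow> 'a list \<Rightarrow> complex" where
  "convolve f g = (\<lambda>ws. \<Sum>k\<le>length ws. f (take k ws) * g (drop k ws))"

lemma chi_scale: "z ^ n = z \<Longrightarrow> spanned f \<Longrightarrow> chi z (\<lambda>xs. c * f xs) = c * chi z f"
proof -
  assume z: "z ^ n = z" and "spanned f"
  then obtain L where L: "wfL L" "f = fn L" by (auto simp: spanned_def)
  then have "(\<lambda>xs. c * f xs) = fn (scale c L)" by (simp add: fun_eq_iff)
  then show ?thesis using L chi_fn[OF z, of "scale c L"] chi_fn[OF z, of L] by simp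
qed

text \<open>
  The product of two loci is a locus: shift the variables of the second one past those of the first.
\<close>

lemma convolve_locus:
  assumes "wfl ts" "wfl ss"
  shows "\<exists>us. wfl us \<and> rk us = rk ts + rk ss \<and>
    convolve (\<lambda>xs. of_bool (xs \<in> locus ts)) (\<lambda>xs. of_bool (xs \<in> locus ss)) = (\<lambda>xs. of_bool (xs \<in> locus us))"
proof -
  obtain N where N: "\<forall>j\<in>varsl ts. j < N" using finite_nat_set_iff_bounded[of "varsl ts"] by auto
  define ss' where "ss' = map (subst (\<lambda>j. Leaf (j + N))) ss"
  let ?us = "ts @ ss'"
  have vss': "varsl ss' = (\<lambda>j. j + N) ` varsl ss" by (auto simp: ss'_def vars_subst)
  have wf: "wfl ?us" using assms by (auto simp: ss'_def intro!: wf_subst)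
  have "card (varsl ts \<union> varsl ss') = card (varsl ts) + card (varsl ss')"
    using N by (intro card_Un_disjoint) (auto simp: vss' simp del: UN_simps)
  moreover have "card (varsl ss') = card (varsl ss)" unfolding vss' by (intro card_image) auto
  ultimately have rk: "rk ?us = rk ts + rk ss" by (simp add: rk_def)
  have mem: "ws \<in> locus ?us \<longleftrightarrow> length ws \<ge> length ts \<and> take (length ts) ws \<in> locus ts \<and> drop (length ts) ws \<in> locus ss" for ws
  proof
    assume "ws \<in> locus ?us"
    then obtain z where "ws = map (val z) ?us" by (rule locusE)
    then have "ws = map (val z) ts @ map (val (pull (\<lambda>j. Leaf (j + N)) z)) ss"
      by (simp add: ss'_def mapval_subst[unfolded map_map] del: map_eq_conv)
    then show "length ws \<ge> length ts \<and> take (length ts) ws \<in> locus ts \<and> drop (length ts) ws \<in> locus ss"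
      by (simp add: locusI)
  next
    assume *: "length ws \<ge> length ts \<and> take (length ts) ws \<in> locus ts \<and> drop (length ts) ws \<in> locus ss"
    then obtain x y where xy: "take (length ts) ws = map (val x) ts" "drop (length ts) ws = map (val y) ss"
      by (auto simp: locus_def)
    let ?z = "\<lambda>j. if j < N then x j else y (j - N)"
    have "map (val ?z) ts = map (val x) ts" using N by (intro mapval_cong) auto
    moreover have "pull (\<lambda>j. Leaf (j + N)) ?z = y" by (auto simp: pull_def)
    then have "map (val ?z) ss' = map (val y) ss" unfolding ss'_def mapval_subst by simp
    ultimately have "map (val ?z) ?us = take (length ts) ws @ drop (length ts) ws"
      by (simp only: map_append xy)
    then have "map (val ?z) ?us = ws" by (simp only: append_take_drop_id)
    then show "ws \<in> locus ?us" using locusI by metis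
  qed
  have "convolve (\<lambda>xs. of_bool (xs \<in> locus ts)) (\<lambda>xs. of_bool (xs \<in> locus ss)) ws = of_bool (ws \<in> locus ?us)" for ws
  proof -
    have "convolve (\<lambda>xs. of_bool (xs \<in> locus ts)) (\<lambda>xs. of_bool (xs \<in> locus ss)) ws =
      (\<Sum>k\<le>length ws. if k = length ts then of_bool (ws \<in> locus ?us) else 0)"
      unfolding convolve_def
    proof (rule sum.cong[OF refl])
      fix k assume k: "k \<in> {..length ws}"
      show "of_bool (take k ws \<in> locus ts) * of_bool (drop k ws \<in> locus ss) =
          (if k = length ts then of_bool (ws \<in> locus ?us) else (0 :: complex))"
      proof (cases "k = length ts")
        case True
        have "ws \<in> locus ?us \<longleftrightarrow> take k ws \<in> locus ts \<and> drop k ws \<in> locus ss"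
          unfolding mem[of ws] using True k by blast
        then show ?thesis using True by (simp only: of_bool_conj if_True refl)
      next
        case False
        have "take k ws \<notin> locus ts" using False k length_locus[of "take k ws" ts] by auto
        then show ?thesis using False by (simp only: of_bool_eq mult_zero_left if_False)
      qed
    qed
    also have "\<dots> = of_bool (ws \<in> locus ?us)"
    proof (cases "ws \<in> locus ?us")
      case True
      then have "length ts \<le> length ws" unfolding mem[of ws] by blast
      then show ?thesis by (simp add: sum.delta)
    next
      case False
      then show ?thesis by (simp only: of_bool_eq if_cancel sum.neutral_const)
    qed
    finally show ?thesis .
  qed
  then have "convolve (\<lambda>xs. of_bool (xs \<in> locus ts)) (\<lambda>xs. of_bool (xs \<in> locus ss)) = (\<lambda>xs. of_bool (xs \<in> locus ?us))"
    by blast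
  then show ?thesis using wf rk by blast
qed

lemma convolve_linear_right: "convolve f (\<lambda>xs. b * s xs + h xs) = (\<lambda>ws. b * convolve f s ws + convolve f h ws)"
  and convolve_linear_left: "convolve (\<lambda>xs. b * s xs + h xs) f = (\<lambda>ws. b * convolve s f ws + convolve h f ws)"
  by (rule ext, simp add: convolve_def algebra_simps sum.distrib sum_distrib_left)+

lemma chi_convolve:
  assumes z: "z ^ n = z" and "spanned f" "spanned g"
  shows "spanned (convolve f g) \<and> chi z (convolve f g) = chi z f * chi z g"
  using assms(2)
proof (induction rule: spanned_induct)
  case 1
  then show ?case using spanned_0 chi_0[OF z] by (simp add: convolve_def)
next
  case (2 a ts f)
  let ?t = "\<lambda>xs. of_bool (xs \<in> locus ts) :: complex"
  have *: "spanned (convolve ?t g) \<and> chi z (convolve ?t g) = chi z ?t * chi z g"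
    using assms(3)
  proof (induction rule: spanned_induct)
    case 1
    then show ?case using spanned_0 chi_0[OF z] by (simp add: convolve_def)
  next
    case (2 b ss h)
    let ?s = "\<lambda>xs. of_bool (xs \<in> locus ss) :: complex"
    obtain us where us: "wfl us" "rk us = rk ts + rk ss" "convolve ?t ?s = (\<lambda>xs. of_bool (xs \<in> locus us))"
      using convolve_locus[OF \<open>wfl ts\<close> \<open>wfl ss\<close>] by blast
    have sp: "spanned (convolve ?t ?s)" unfolding us(3) using us(1) by (rule spanned_locus)
    have ch: "chi z (convolve ?t ?s) = chi z ?t * chi z ?s"
      unfolding us(3) using chi_locus[OF z] us \<open>wfl ts\<close> \<open>wfl ss\<close> by (simp add: power_add)
    have eq: "convolve ?t (\<lambda>xs. b * ?s xs + h xs) = (\<lambda>xs. b * convolve ?t ?s xs + convolve ?t h xs)"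
      by (rule convolve_linear_right)
    have ss: "spanned ?s" using \<open>wfl ss\<close> by (rule spanned_locus)
    show ?case unfolding eq using 2 sp ch ss
      by (simp add: spanned_add spanned_scale chi_add[OF z] chi_scale[OF z] algebra_simps)
  qed
  have eq: "convolve (\<lambda>xs. a * ?t xs + f xs) g = (\<lambda>xs. a * convolve ?t g xs + convolve f g xs)"
    by (rule convolve_linear_left)
  have ss: "spanned ?t" using \<open>wfl ts\<close> by (rule spanned_locus)
  show ?case unfolding eq using 2 * ss
    by (simp add: spanned_add spanned_scale chi_add[OF z] chi_scale[OF z] algebra_simps)
qed

theorem euler_conc:
  assumes z: "z ^ n = z" and A: "A \<in> Def n l" and B: "B \<in> Def n l" and inj: "conc_inj A B"
  shows "euler z (conc A B) = euler z A * euler z B"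
proof -
  have "convolve (ind A) (ind B) ws = ind (conc A B) ws" for ws
  proof (cases "ws \<in> conc A B")
    case True
    then obtain xs ys where xy: "ws = xs @ ys" "xs \<in> A" "ys \<in> B" by (auto simp: conc_def)
    have "convolve (ind A) (ind B) ws = (\<Sum>k\<le>length ws. if k = length xs then 1 else 0)"
      unfolding convolve_def
    proof (rule sum.cong[OF refl])
      fix k assume k: "k \<in> {..length ws}"
      have "k = length xs" if "take k ws \<in> A" "drop k ws \<in> B"
      proof -
        have "(take k ws, drop k ws) = (xs, ys)"
          using inj by (rule inj_onD) (use xy(2,3) that in \<open>simp_all add: xy(1)[symmetric]\<close>)
        then show ?thesis using k by auto
      qed
      then show "ind A (take k ws) * ind B (drop k ws) = (if k = length xs then 1 else 0)"
        using xy by (auto simp: ind_def)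
    qed
    then show ?thesis using True xy by (simp add: ind_def sum.delta)
  next
    case False
    have "take k ws \<notin> A \<or> drop k ws \<notin> B" for k
    proof (rule ccontr)
      assume "\<not> (take k ws \<notin> A \<or> drop k ws \<notin> B)"
      then have "take k ws @ drop k ws \<in> conc A B" unfolding conc_def by (intro image_eqI[of _ _ "(take k ws, drop k ws)"]) auto
      then show False using False by simp
    qed
    then show ?thesis using False by (auto simp: convolve_def ind_def intro!: sum.neutral)
  qed
  then have "convolve (ind A) (ind B) = ind (conc A B)" by blast
  then show ?thesis using chi_convolve[OF z spanned_Def[OF A] spanned_Def[OF B]] by (simp add: euler_def)
qed

section \<open>Definable bijections\<close>

lemma graph_pieceI: "xs \<in> A \<Longrightarrow> length xs = k \<Longrightarrow> length (f xs) = m \<Longrightarrow> xs @ f xs \<in> graph_piece f A k m"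
  by (auto simp: graph_piece_def)

lemma graph_pieceE:
  assumes "ws \<in> graph_piece f A k m"
  obtains xs where "ws = xs @ f xs" "xs \<in> A" "length xs = k" "length (f xs) = m"
  using assms by (auto simp: graph_piece_def)

lemma Def_image:
  assumes "A \<in> Def n l" "\<And>k m. constr (k + m) (graph_piece f A k m)" "finite (length ` f ` A)"
  shows "f ` A \<in> Def n l"
proof -
  have "constr m {ys \<in> f ` A. length ys = m}" for m
  proof -
    let ?P = "\<lambda>k. {ys. length ys = m \<and> (\<exists>xs. length xs = k \<and> ys @ xs \<in> swap k (graph_piece f A k m))}"
    have sw: "ys @ xs \<in> swap k (graph_piece f A k m) \<longleftrightarrow> xs \<in> A \<and> ys = f xs \<and> length xs = k"
      if "length ys = m" for xs ys k
      using swap_mem[OF constr_length[OF assms(2)] that] graph_piece_mem that by auto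
    have P: "ys \<in> ?P k \<longleftrightarrow> length ys = m \<and> (\<exists>xs\<in>A. ys = f xs \<and> length xs = k)" for ys k
      using sw[of ys] by blast
    have "{ys \<in> f ` A. length ys = m} = (\<Union>k\<in>length ` A. ?P k)"
      unfolding set_eq_iff UN_iff P by blast
    moreover have "constr m (?P k)" for k
      by (rule constr_proj, rule constr_swap, rule assms(2))
    ultimately show ?thesis using Def_finite[OF assms(1)] by (simp only: constr_UN)
  qed
  then show ?thesis using assms(3) by (simp add: Def_iff)
qed

text \<open>
  Maps that are given by trees in each length have constructible graphs.
\<close>

lemma term_bij:
  assumes A: "A \<in> Def n l" and inj: "inj_on f A"
    and us: "\<And>k. k \<in> length ` A \<Longrightarrow> \<exists>us. wfl us \<and> varsl us \<subseteq> {..<k} \<and>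
      (\<forall>xs\<in>A. length xs = k \<longrightarrow> f xs = map (val (nth xs)) us)"
  shows "f ` A \<in> Def n l" "definable_bij n l A (f ` A) f"
proof -
  have "\<forall>k\<in>length ` A. \<exists>us. wfl us \<and> varsl us \<subseteq> {..<k} \<and>
      (\<forall>xs\<in>A. length xs = k \<longrightarrow> f xs = map (val (nth xs)) us)" using us by blast
  from bchoice[OF this] obtain u where uu: "\<forall>k\<in>length ` A. wfl (u k) \<and> varsl (u k) \<subseteq> {..<k} \<and>
      (\<forall>xs\<in>A. length xs = k \<longrightarrow> f xs = map (val (nth xs)) (u k))" by (elim exE)
  have u: "wfl (u k)" "varsl (u k) \<subseteq> {..<k}" if "k \<in> length ` A" for k
    using bspec[OF uu that] by blast+
  have u3: "f xs = map (val (nth xs)) (u (length xs))" if "xs \<in> A" for xs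
    using bspec[OF uu imageI[OF that, of length]] that by blast
  have "constr (k + m) (graph_piece f A k m)" for k m
  proof (cases "k \<in> length ` A \<and> length (u k) = m")
    case True
    then have uk: "wfl (u k)" "varsl (u k) \<subseteq> {..<k}" "length (u k) = m" using u by auto
    let ?T = "{ws. length ws = k + m \<and> map (nth ws) [0..<k] \<in> {xs \<in> A. length xs = k}}"
    have "graph_piece f A k m = ?T \<inter> locus (map Leaf [0..<k] @ u k)"
    proof (intro equalityI subsetI)
      fix ws assume "ws \<in> graph_piece f A k m"
      then obtain xs where xs: "ws = xs @ f xs" "xs \<in> A" "length xs = k" "length (f xs) = m" by (rule graph_pieceE)
      have "map (nth (xs @ f xs)) [0..<k] = xs" using map_nth_block[of "[]" xs "f xs"] xs(3) by simp
      moreover have "ws = map (val (nth xs)) (map Leaf [0..<k] @ u k)"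
        using xs u3[OF xs(2)] map_nth[of xs] by (simp add: o_def)
      then have "ws \<in> locus (map Leaf [0..<k] @ u k)" using locusI by metis
      ultimately show "ws \<in> ?T \<inter> locus (map Leaf [0..<k] @ u k)" using xs by simp
    next
      fix ws assume ws: "ws \<in> ?T \<inter> locus (map Leaf [0..<k] @ u k)"
      then obtain z where z: "ws = map z [0..<k] @ map (val z) (u k)" by (auto simp: locus_def o_def)
      let ?xs = "map z [0..<k]"
      have "map (nth ws) [0..<k] = ?xs" using map_nth_block[of "[]" ?xs "map (val z) (u k)"] z by simp
      then have xs: "?xs \<in> A" using ws by (simp del: map_eq_conv)
      have "map (val (nth ?xs)) (u k) = map (val z) (u k)"
        by (rule mapval_cong) (use uk(2) in auto)
      then have "f ?xs = map (val z) (u k)" using u3[OF xs] by simp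
      then show "ws \<in> graph_piece f A k m" using graph_pieceI[OF xs, of k f m] z uk(3) by simp
    qed
    moreover have "constr (k + m) ?T" by (rule constr_reindex[OF Def_piece[OF A]]) auto
    moreover have "constr (k + m) (locus (map Leaf [0..<k] @ u k))"
      using uk by (intro constr_locus) auto
    ultimately show ?thesis by (simp only: constr_Int)
  next
    case False
    have "graph_piece f A k m = {}"
    proof (rule ccontr)
      assume "graph_piece f A k m \<noteq> {}"
      then obtain ws where "ws \<in> graph_piece f A k m" by blast
      then obtain xs where xs: "xs \<in> A" "length xs = k" "length (f xs) = m" by (rule graph_pieceE)
      then have "length (u k) = m" using u3[OF xs(1)] by simp
      then show False using False xs by blast
    qed
    then show ?thesis by (simp add: constr.empty)
  qed
  note G = this
  have "length ` f ` A \<subseteq> (\<lambda>k. length (u k)) ` length ` A" using u3 by fastforce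
  then have "finite (length ` f ` A)" using Def_finite[OF A] by (meson finite_imageI finite_subset)
  then show "f ` A \<in> Def n l" using Def_image[OF A G] by blast
  show "definable_bij n l A (f ` A) f"
    unfolding definable_bij_iff using inj G by (auto simp: bij_betw_def)
qed

lemma definable_bij_id: "A \<in> Def n l \<Longrightarrow> definable_bij n l A A id"
proof -
  assume A: "A \<in> Def n l"
  have "definable_bij n l A (id ` A) id"
  proof (rule term_bij(2)[OF A])
    fix k
    have "id xs = map (val (nth xs)) (map Leaf [0..<k])" if "length xs = k" for xs
      using that map_nth[of xs] by (simp add: o_def)
    then show "\<exists>us. wfl us \<and> varsl us \<subseteq> {..<k} \<and> (\<forall>xs\<in>A. length xs = k \<longrightarrow> id xs = map (val (nth xs)) us)"
      by (intro exI[of _ "map Leaf [0..<k]"]) auto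
  qed simp
  then show ?thesis by simp
qed

lemma definable_bij_inv:
  assumes "definable_bij n l A B f"
  shows "definable_bij n l B A (inv_into A f)"
proof -
  have bij: "bij_betw f A B" and G: "\<And>k m. constr (k + m) (graph_piece f A k m)"
    using assms by (auto simp: definable_bij_iff)
  have inv: "\<And>xs. xs \<in> A \<Longrightarrow> inv_into A f (f xs) = xs" "B = f ` A"
    using bij by (auto simp: bij_betw_def)
  have "graph_piece (inv_into A f) B m k = swap k (graph_piece f A k m)" for k m
  proof (intro equalityI subsetI)
    fix ws assume "ws \<in> graph_piece (inv_into A f) B m k"
    then obtain ys where ys: "ws = ys @ inv_into A f ys" "ys \<in> B" "length ys = m" "length (inv_into A f ys) = k"
      by (rule graph_pieceE)
    then obtain xs where xs: "xs \<in> A" "ys = f xs" using inv(2) by auto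
    have "xs @ ys \<in> graph_piece f A k m" using graph_pieceI[OF xs(1), of k f m] xs ys inv(1)[OF xs(1)] by simp
    then show "ws \<in> swap k (graph_piece f A k m)"
      unfolding swap_def using ys xs inv(1)[OF xs(1)] by (auto intro!: exI[of _ "xs @ ys"])
  next
    fix ws assume "ws \<in> swap k (graph_piece f A k m)"
    then obtain vs where vs: "vs \<in> graph_piece f A k m" "ws = drop k vs @ take k vs" by (auto simp: swap_def)
    from vs(1) obtain xs where xs: "vs = xs @ f xs" "xs \<in> A" "length xs = k" "length (f xs) = m" by (rule graph_pieceE)
    then have "ws = f xs @ inv_into A f (f xs)" using vs(2) inv(1) by simp
    then show "ws \<in> graph_piece (inv_into A f) B m k"
      using graph_pieceI[of "f xs" B m "inv_into A f" k] xs inv by auto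
  qed
  then show ?thesis unfolding definable_bij_iff using bij_betw_inv_into[OF bij] constr_swap[OF G] by simp
qed

text \<open>
  The graph of a composite is a projection of a constructible set, so this needs quantifier
  elimination, and a case distinction over the finitely many lengths that occur in \<open>B\<close>.
\<close>

lemma definable_bij_comp:
  assumes B: "B \<in> Def n l" and f: "definable_bij n l A B f" and g: "definable_bij n l B C g"
  shows "definable_bij n l A C (g \<circ> f)"
proof -
  have bijf: "bij_betw f A B" and F: "\<And>k m. constr (k + m) (graph_piece f A k m)"
    and bijg: "bij_betw g B C" and G: "\<And>k m. constr (k + m) (graph_piece g B k m)"
    using f g by (auto simp: definable_bij_iff)
  have fB: "\<And>xs. xs \<in> A \<Longrightarrow> f xs \<in> B" using bijf by (auto simp: bij_betw_def)
  have "constr (k + m) (graph_piece (g \<circ> f) A k m)" for k m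
  proof -
    let ?U = "\<lambda>j. {us. length us = k + m + j \<and> map (nth us) ([0..<k] @ [k + m..<k + m + j]) \<in> graph_piece f A k j} \<inter>
                 {us. length us = k + m + j \<and> map (nth us) ([k + m..<k + m + j] @ [k..<k + m]) \<in> graph_piece g B j m}"
    let ?P = "\<lambda>j. {ws. length ws = k + m \<and> (\<exists>ys. length ys = j \<and> ws @ ys \<in> ?U j)}"
    have "constr (k + m + j) (?U j)" for j
      by (intro constr_Int constr_reindex[OF F] constr_reindex[OF G]) auto
    then have P: "constr (k + m) (?P j)" for j by (rule constr_proj)
    have U: "xs @ zs @ ys \<in> ?U j \<longleftrightarrow> xs \<in> A \<and> ys = f xs \<and> zs = g ys"
      if "length xs = k" "length zs = m" "length ys = j" for xs ys zs j
    proof -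
      have "map (nth (xs @ zs @ ys)) [0..<k] = xs" "map (nth (xs @ zs @ ys)) [k..<k + m] = zs"
        "map (nth (xs @ zs @ ys)) [k + m..<k + m + j] = ys"
        using map_nth_block[of "[]" xs "zs @ ys"] map_nth_block[of xs zs ys] map_nth_block[of "xs @ zs" ys "[]"] that
        by (simp_all add: add.assoc)
      then show ?thesis using that fB by (auto simp: graph_piece_mem)
    qed
    have "graph_piece (g \<circ> f) A k m = (\<Union>j\<in>length ` B. ?P j)"
    proof (intro equalityI subsetI)
      fix ws assume "ws \<in> graph_piece (g \<circ> f) A k m"
      then obtain xs where xs: "ws = xs @ g (f xs)" "xs \<in> A" "length xs = k" "length (g (f xs)) = m"
        by (rule graph_pieceE) simp
      then have "xs @ g (f xs) @ f xs \<in> ?U (length (f xs))" by (subst U) auto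
      then have "ws \<in> ?P (length (f xs))" using xs by auto
      then show "ws \<in> (\<Union>j\<in>length ` B. ?P j)" using fB[OF xs(2)] by blast
    next
      fix ws assume "ws \<in> (\<Union>j\<in>length ` B. ?P j)"
      then obtain j ys where ws: "length ws = k + m" "length ys = j" "ws @ ys \<in> ?U j" by blast
      then have split: "take k ws @ drop k ws @ ys \<in> ?U j" "length (take k ws) = k" "length (drop k ws) = m"
        by (simp_all only: append_assoc[symmetric] append_take_drop_id length_take length_drop)
      then have "take k ws \<in> A" "ys = f (take k ws)" "drop k ws = g ys"
        using U[OF split(2,3) ws(2)] by blast+
      then have "take k ws @ (g \<circ> f) (take k ws) \<in> graph_piece (g \<circ> f) A k m"
        using split by (intro graph_pieceI) auto
      then show "ws \<in> graph_piece (g \<circ> f) A k m" using \<open>drop k ws = g ys\<close> \<open>ys = f (take k ws)\<close>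
        by (metis append_take_drop_id comp_apply)
    qed
    then show ?thesis using constr_UN[OF Def_finite[OF B], of "k + m" ?P] P by simp
  qed
  then show ?thesis unfolding definable_bij_iff using bij_betw_trans[OF bijf bijg] by blast
qed

abbreviation equi :: "'a list set \<Rightarrow> 'a list set \<Rightarrow> bool" (infix "\<approx>" 50) where
  "A \<approx> B \<equiv> (A, B) \<in> def_equiv n l"

lemma equi_iff: "A \<approx> B \<longleftrightarrow> A \<in> Def n l \<and> B \<in> Def n l \<and> (\<exists>f. definable_bij n l A B f)"
  by (simp add: def_equiv_def)

lemma equiv_def_equiv: "equiv (Def n l) (def_equiv n l)"
proof (rule equivI)
  show "refl_on (Def n l) (def_equiv n l)"
    by (rule refl_onI) (use definable_bij_id in \<open>auto simp: equi_iff\<close>)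
  show "sym (def_equiv n l)" by (rule symI) (use definable_bij_inv in \<open>auto simp: equi_iff\<close>)
  show "trans (def_equiv n l)" 
    by (rule transI) (unfold equi_iff, blast intro: definable_bij_comp)
  show "def_equiv n l \<subseteq> Def n l \<times> Def n l" by (auto simp: def_equiv_def)
qed

lemma equi_refl: "A \<in> Def n l \<Longrightarrow> A \<approx> A"
  using equiv_def_equiv by (simp add: equiv_def refl_on_def)

lemma equi_sym: "A \<approx> B \<Longrightarrow> B \<approx> A"
  using equiv_def_equiv by (meson equivE symD)

lemma equi_Un:
  assumes "A \<approx> A'" "B \<approx> B'" "A \<inter> B = {}" "A' \<inter> B' = {}"
  shows "A \<union> B \<approx> A' \<union> B'"
proof -
  obtain f g where f: "definable_bij n l A A' f" and g: "definable_bij n l B B' g"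
    using assms by (auto simp: equi_iff)
  define h where "h = (\<lambda>xs. if xs \<in> A then f xs else g xs)"
  have hA: "h xs = f xs" if "xs \<in> A" for xs using that by (simp add: h_def)
  have hB: "h xs = g xs" if "xs \<in> B" for xs using that assms(3) by (auto simp: h_def)
  have "bij_betw h A A'" "bij_betw h B B'"
    using f g bij_betw_cong[of A h f A'] bij_betw_cong[of B h g B'] hA hB by (auto simp: definable_bij_iff)
  then have "bij_betw h (A \<union> B) (A' \<union> B')" using assms(4) by (rule bij_betw_combine)
  moreover have "graph_piece h (A \<union> B) k m = graph_piece f A k m \<union> graph_piece g B k m" for k m
    unfolding graph_piece_def using hA hB by auto metis+
  ultimately have "definable_bij n l (A \<union> B) (A' \<union> B') h"
    using f g by (simp add: definable_bij_iff constr.union)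
  then show ?thesis using assms(1,2) Def_Un by (auto simp: equi_iff)
qed

lemma constr_conc:
  assumes "constr i S" "constr j T"
  shows "constr (i + j) (conc S T)"
proof -
  have "conc S T = {ws. length ws = i + j \<and> map (nth ws) [0..<i] \<in> S} \<inter>
      {ws. length ws = i + j \<and> map (nth ws) [i..<i + j] \<in> T}" (is "_ = ?R")
  proof (intro equalityI subsetI)
    fix ws assume "ws \<in> conc S T"
    then obtain x y where xy: "ws = x @ y" "x \<in> S" "y \<in> T" by (auto simp: conc_def)
    then have "length x = i" "length y = j" using assms[THEN constr_length] by auto
    then show "ws \<in> ?R" using xy map_nth_block[of "[]" x y] map_nth_block[of x y "[]"] by simp
  next
    fix ws assume ws: "ws \<in> ?R"
    then have "map (nth ws) [0..<i] @ map (nth ws) [i..<i + j] = ws"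
      by (intro nth_equalityI) (auto simp: nth_append)
    then show "ws \<in> conc S T" using ws
      unfolding conc_def by (intro image_eqI[of _ _ "(map (nth ws) [0..<i], map (nth ws) [i..<i + j])"]) auto
  qed
  moreover have "constr (i + j) ?R"
    by (intro constr_Int constr_reindex[OF assms(1)] constr_reindex[OF assms(2)]) auto
  ultimately show ?thesis by simp
qed

lemma Def_conc:
  assumes A: "A \<in> Def n l" and B: "B \<in> Def n l"
  shows "conc A B \<in> Def n l"
proof -
  have "length ` conc A B \<subseteq> (\<lambda>(i, j). i + j) ` (length ` A \<times> length ` B)"
    unfolding conc_def by force
  then have "finite (length ` conc A B)"
    using Def_finite[OF A] Def_finite[OF B] by (meson finite_SigmaI finite_imageI finite_subset)
  moreover have "constr k {ws \<in> conc A B. length ws = k}" for k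
  proof -
    let ?P = "\<lambda>i. conc {xs \<in> A. length xs = i} {xs \<in> B. length xs = k - i}"
    have "{ws \<in> conc A B. length ws = k} = (\<Union>i\<in>{..k}. ?P i)"
    proof (intro equalityI subsetI)
      fix ws assume "ws \<in> {ws \<in> conc A B. length ws = k}"
      then obtain x y where xy: "ws = x @ y" "x \<in> A" "y \<in> B" "length x + length y = k" by (auto simp: conc_def)
      then have "ws \<in> ?P (length x)" unfolding conc_def by (intro image_eqI[of _ _ "(x, y)"]) auto
      then show "ws \<in> (\<Union>i\<in>{..k}. ?P i)" using xy(4) by auto
    qed (auto simp: conc_def)
    moreover have "constr k (?P i)" if "i \<in> {..k}" for i
      using constr_conc[OF Def_piece[OF A, of i] Def_piece[OF B, of "k - i"]] that by simp
    ultimately show ?thesis using constr_UN[of "{..k}" k ?P] by simp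
  qed
  ultimately show ?thesis by (simp add: Def_iff)
qed

lemma constr_conc_graph:
  assumes "constr (i + i') S" "constr (j + j') T"
  shows "constr (i + j + (i' + j'))
    {x @ y @ x' @ y' | x y x' y'. length x = i \<and> length y = j \<and> length x' = i' \<and> length y' = j' \<and> x @ x' \<in> S \<and> y @ y' \<in> T}"
    (is "constr ?N ?L")
proof -
  let ?R = "{ws. length ws = ?N \<and> map (nth ws) ([0..<i] @ [i + j..<i + j + i']) \<in> S} \<inter>
      {ws. length ws = ?N \<and> map (nth ws) ([i..<i + j] @ [i + j + i'..<i + j + i' + j']) \<in> T}"
  have block: "map (nth (x @ y @ x' @ y')) [0..<i] = x" "map (nth (x @ y @ x' @ y')) [i..<i + j] = y"
      "map (nth (x @ y @ x' @ y')) [i + j..<i + j + i'] = x'"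
      "map (nth (x @ y @ x' @ y')) [i + j + i'..<i + j + i' + j'] = y'"
    if "length x = i" "length y = j" "length x' = i'" "length y' = j'" for x y x' y' :: "'a list"
    using map_nth_block[of "[]" x "y @ x' @ y'"] map_nth_block[of x y "x' @ y'"]
      map_nth_block[of "x @ y" x' y'] map_nth_block[of "x @ y @ x'" y' "[]"] that
    by (simp_all add: add.assoc)
  have "?L = ?R"
  proof (intro equalityI subsetI)
    fix ws assume "ws \<in> ?L"
    then obtain x y x' y' where "ws = x @ y @ x' @ y'" "length x = i" "length y = j" "length x' = i'" "length y' = j'"
      "x @ x' \<in> S" "y @ y' \<in> T" by blast
    then show "ws \<in> ?R" by (simp add: block)
  next
    fix ws assume ws: "ws \<in> ?R"
    define x y x' y' where "x = take i ws" and "y = take j (drop i ws)" and "x' = take i' (drop (i + j) ws)"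
      and "y' = drop (i + j + i') ws"
    have "ws = x @ y @ x' @ y'"
      unfolding x_def y_def x'_def y'_def by (metis append_take_drop_id drop_drop add.commute)
    moreover have "length x = i" "length y = j" "length x' = i'" "length y' = j'"
      using ws by (auto simp: x_def y_def x'_def y'_def)
    ultimately show "ws \<in> ?L" using ws by (auto simp: block)
  qed
  moreover have "constr ?N ?R"
    by (intro constr_Int constr_reindex[OF assms(1)] constr_reindex[OF assms(2)]) auto
  ultimately show ?thesis by simp
qed

lemma equi_conc:
  assumes "A \<approx> A'" "B \<approx> B'" and inj: "conc_inj A B" "conc_inj A' B'"
  shows "conc A B \<approx> conc A' B'"
proof -
  obtain f g where f: "definable_bij n l A A' f" and g: "definable_bij n l B B' g"
    using assms by (auto simp: equi_iff)
  have bijf: "bij_betw f A A'" and F: "\<And>k m. constr (k + m) (graph_piece f A k m)"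
    and bijg: "bij_betw g B B'" and G: "\<And>k m. constr (k + m) (graph_piece g B k m)"
    using f g by (auto simp: definable_bij_iff)
  define h where "h ws = (case inv_into (A \<times> B) (\<lambda>(xs, ys). xs @ ys) ws of (xs, ys) \<Rightarrow> f xs @ g ys)" for ws
  have h: "h (xs @ ys) = f xs @ g ys" if "xs \<in> A" "ys \<in> B" for xs ys
    using inv_into_f_f[OF inj(1), of "(xs, ys)"] that by (simp add: h_def)
  have "bij_betw h (conc A B) (conc A' B')"
  proof (rule bij_betwI')
    fix ws vs assume "ws \<in> conc A B" "vs \<in> conc A B"
    then obtain x y x' y' where xy: "ws = x @ y" "x \<in> A" "y \<in> B" "vs = x' @ y'" "x' \<in> A" "y' \<in> B"
      by (auto simp: conc_def)
    have mem: "f x \<in> A'" "f x' \<in> A'" "g y \<in> B'" "g y' \<in> B'"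
      using xy bijf bijg by (auto simp: bij_betw_def)
    have "x = x' \<and> y = y'" if "f x @ g y = f x' @ g y'"
    proof -
      have "(f x, g y) = (f x', g y')" by (rule inj_onD[OF inj(2)]) (use that mem in auto)
      then show ?thesis using bijf bijg xy by (auto simp: bij_betw_def inj_on_def)
    qed
    moreover have "h ws = f x @ g y" "h vs = f x' @ g y'" using xy h by auto
    ultimately show "h ws = h vs \<longleftrightarrow> ws = vs" using xy by metis
  next
    fix ws assume "ws \<in> conc A B"
    then obtain x y where "ws = x @ y" "x \<in> A" "y \<in> B" by (auto simp: conc_def)
    then show "h ws \<in> conc A' B'" using h bijf bijg unfolding conc_def by (force simp: bij_betw_def)
  next
    fix vs assume "vs \<in> conc A' B'"
    then obtain x' y' where "vs = x' @ y'" "x' \<in> A'" "y' \<in> B'" by (auto simp: conc_def)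
    moreover from this obtain x y where "x \<in> A" "x' = f x" "y \<in> B" "y' = g y"
      using bijf bijg by (auto simp: bij_betw_def)
    ultimately show "\<exists>ws\<in>conc A B. vs = h ws"
      unfolding conc_def using h by (intro bexI[of _ "x @ y"]) auto
  qed
  moreover have "constr (k + m) (graph_piece h (conc A B) k m)" for k m
  proof -
    let ?P = "\<lambda>(i, i'). {x @ y @ x' @ y' | x y x' y'. length x = i \<and> length y = k - i \<and> length x' = i' \<and>
        length y' = m - i' \<and> x @ x' \<in> graph_piece f A i i' \<and> y @ y' \<in> graph_piece g B (k - i) (m - i')}"
    have "graph_piece h (conc A B) k m = (\<Union>p\<in>{..k} \<times> {..m}. ?P p)"
    proof (intro equalityI subsetI)
      fix ws assume "ws \<in> graph_piece h (conc A B) k m"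
      then obtain v where v: "ws = v @ h v" "v \<in> conc A B" "length v = k" "length (h v) = m" by (rule graph_pieceE)
      then obtain x y where xy: "v = x @ y" "x \<in> A" "y \<in> B" by (auto simp: conc_def)
      then have len: "length x + length y = k" "length (f x) + length (g y) = m" using v h by auto
      have "ws \<in> ?P (length x, length (f x))"
        unfolding prod.case using v xy h len
        by (intro CollectI exI[of _ x] exI[of _ y] exI[of _ "f x"] exI[of _ "g y"]) (auto simp: graph_piece_mem)
      then show "ws \<in> (\<Union>p\<in>{..k} \<times> {..m}. ?P p)" using len by (intro UN_I[of "(length x, length (f x))"]) auto
    next
      fix ws assume "ws \<in> (\<Union>p\<in>{..k} \<times> {..m}. ?P p)"
      then obtain i i' where ii: "i \<le> k" "i' \<le> m" "ws \<in> ?P (i, i')" by blast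
      then obtain x y x' y' where xy: "ws = x @ y @ x' @ y'" "length x = i" "length y = k - i" "length x' = i'"
        "length y' = m - i'" "x @ x' \<in> graph_piece f A i i'" "y @ y' \<in> graph_piece g B (k - i) (m - i')" by auto
      then have *: "x \<in> A" "x' = f x" "y \<in> B" "y' = g y" by (auto simp: graph_piece_mem)
      have "x @ y \<in> conc A B" unfolding conc_def using * by force
      then have "(x @ y) @ h (x @ y) \<in> graph_piece h (conc A B) k m"
        using xy ii * h by (intro graph_pieceI) auto
      then show "ws \<in> graph_piece h (conc A B) k m" using xy * h by simp
    qed
    moreover have "constr (k + m) (?P p)" if "p \<in> {..k} \<times> {..m}" for p
    proof -
      obtain i i' where p: "p = (i, i')" by (cases p)
      have "i + (k - i) + (i' + (m - i')) = k + m" using that p by auto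
      then show ?thesis using constr_conc_graph[OF F[of i i'] G[of "k - i" "m - i'"]] p by simp
    qed
    ultimately show ?thesis using constr_UN[of "{..k} \<times> {..m}" "k + m" ?P] by simp
  qed
  ultimately have "definable_bij n l (conc A B) (conc A' B') h" by (simp add: definable_bij_iff)
  then show ?thesis using assms(1,2) Def_conc by (auto simp: equi_iff)
qed

text \<open>
  Appending constants whose number depends on the length gives a definable bijection when the new
  length determines the old one.
\<close>

lemma equi_pad:
  assumes A: "A \<in> Def n l" and g: "inj (\<lambda>k. k + g k)"
  shows "A \<approx> (\<lambda>xs. xs @ replicate (g (length xs)) c) ` A"
proof -
  let ?f = "\<lambda>xs. xs @ replicate (g (length xs)) c"
  have inj: "inj_on ?f A"
  proof (rule inj_onI)
    fix xs ys assume eq: "?f xs = ?f ys"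
    then have "length (?f xs) = length (?f ys)" by (rule arg_cong)
    then have "length xs + g (length xs) = length ys + g (length ys)" by simp
    then have "length xs = length ys" by (rule injD[OF g])
    then show "xs = ys" using eq by simp
  qed
  have us: "\<exists>us. wfl us \<and> varsl us \<subseteq> {..<k} \<and> (\<forall>xs\<in>A. length xs = k \<longrightarrow> ?f xs = map (val (nth xs)) us)" for k
  proof -
    have "?f xs = map (val (nth xs)) (map Leaf [0..<k] @ replicate (g k) (Const c))" if "length xs = k" for xs
      using that map_nth[of xs] by (simp add: o_def)
    then show ?thesis by (intro exI[of _ "map Leaf [0..<k] @ replicate (g k) (Const c)"]) auto
  qed
  show ?thesis using term_bij[OF A inj us] A unfolding equi_iff by blast
qed

text \<open>
  All lengths in the copy exceed those in \<open>B\<close>.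
\<close>

lemma disjoint_copy:
  assumes "A \<in> Def n l" "B \<in> Def n l"
  shows "\<exists>A'. A \<approx> A' \<and> A' \<inter> B = {}"
proof -
  fix c :: 'a
  obtain N where N: "\<forall>k\<in>length ` B. k < N"
    using Def_finite[OF assms(2)] finite_nat_set_iff_bounded by blast
  have "inj (\<lambda>k. k + N)" by (auto intro: injI)
  then have "A \<approx> (\<lambda>xs. xs @ replicate N c) ` A" using equi_pad[OF assms(1), of "\<lambda>_. N"] by simp
  moreover have "(\<lambda>xs. xs @ replicate N c) ` A \<inter> B = {}" using N by fastforce
  ultimately show ?thesis by blast
qed

text \<open>
  The lengths of the elements of \<open>A\<close> are less than \<open>N\<close>. In the copy, the lengths are multiples of
  \<open>N + 1\<close>, so the length of a concatenation determines the lengths of both factors.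
\<close>

lemma conc_inj_copy:
  assumes "A \<in> Def n l" "B \<in> Def n l"
  shows "\<exists>B'. B \<approx> B' \<and> conc_inj A B'"
proof -
  fix c :: 'a
  obtain N where N: "\<forall>k\<in>length ` A. k < N"
    using Def_finite[OF assms(1)] finite_nat_set_iff_bounded by blast
  let ?f = "\<lambda>xs. xs @ replicate (length xs * N) c"
  have "inj (\<lambda>k. k + k * N)" by (rule injI) (metis mult.commute mult_Suc mult_cancel1 nat.distinct(1))
  then have "B \<approx> ?f ` B" using equi_pad[OF assms(2), of "\<lambda>k. k * N"] by simp
  moreover have "conc_inj A (?f ` B)"
  proof (rule inj_onI, clarify)
    fix x x' y y' assume xy: "x \<in> A" "x' \<in> A" "y \<in> B" "y' \<in> B" "x @ ?f y = x' @ ?f y'"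
    have "length (x @ ?f y) = length (x' @ ?f y')" using xy(5) by (rule arg_cong)
    then have "length x + length y * Suc N = length x' + length y' * Suc N" by simp
    moreover have "length x < Suc N" "length x' < Suc N" using N xy by (auto simp: less_Suc_eq)
    ultimately have "length x = length x'" by (metis mod_less mod_mult_self1)
    then show "x = x' \<and> ?f y = ?f y'" using xy(5) by simp
  qed
  ultimately show ?thesis by blast
qed

section \<open>The semiring of classes\<close>

abbreviation cls :: "'a list set \<Rightarrow> 'a list set set" where
  "cls A \<equiv> def_equiv n l `` {A}"

abbreviation SR :: "'a list set set ring" where
  "SR \<equiv> def_semiring n l"

lemma cls_eq_iff: "A \<in> Def n l \<Longrightarrow> B \<in> Def n l \<Longrightarrow> cls A = cls B \<longleftrightarrow> A \<approx> B"
  using eq_equiv_class_iff[OF equiv_def_equiv] by blast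

lemma carrier_SR: "carrier SR = cls ` Def n l"
  by (auto simp: def_semiring_def quotient_def)

lemma cls_in_carrier: "A \<in> Def n l \<Longrightarrow> cls A \<in> carrier SR"
  by (simp add: carrier_SR)

lemma carrierE:
  assumes "a \<in> carrier SR"
  obtains A where "A \<in> Def n l" "a = cls A"
  using assms by (auto simp: carrier_SR)

lemma add_cls:
  assumes A: "A \<in> Def n l" and B: "B \<in> Def n l" and disj: "A \<inter> B = {}"
  shows "cls A \<oplus>\<^bsub>SR\<^esub> cls B = cls (A \<union> B)"
proof -
  have "cls (A' \<union> B') = cls (A \<union> B)" if "A' \<in> cls A" "B' \<in> cls B" "A' \<inter> B' = {}" for A' B'
  proof -
    have "A \<union> B \<approx> A' \<union> B'" using that disj by (intro equi_Un) auto
    then show ?thesis using cls_eq_iff[of "A \<union> B" "A' \<union> B'"] equi_iff by metis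
  qed
  then have "(\<Union>A'\<in>cls A. \<Union>B'\<in>{B' \<in> cls B. A' \<inter> B' = {}}. cls (A' \<union> B')) = cls (A \<union> B)"
    using equi_refl[OF A] equi_refl[OF B] disj by blast
  then show ?thesis by (simp add: def_semiring_def)
qed

lemma mult_cls:
  assumes A: "A \<in> Def n l" and B: "B \<in> Def n l" and inj: "conc_inj A B"
  shows "cls A \<otimes>\<^bsub>SR\<^esub> cls B = cls (conc A B)"
proof -
  have "cls (conc A' B') = cls (conc A B)" if "A' \<in> cls A" "B' \<in> cls B" "conc_inj A' B'" for A' B'
  proof -
    have "conc A B \<approx> conc A' B'" using that inj by (intro equi_conc) auto
    then show ?thesis using cls_eq_iff[of "conc A B" "conc A' B'"] equi_iff by metis
  qed
  then have "(\<Union>A'\<in>cls A. \<Union>B'\<in>{B' \<in> cls B. conc_inj A' B'}. cls (conc A' B')) = cls (conc A B)"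
    using equi_refl[OF A] equi_refl[OF B] inj by blast
  then show ?thesis by (simp add: def_semiring_def conc_def)
qed

lemma disjoint_reps:
  assumes "a \<in> carrier SR" "B \<in> Def n l"
  obtains A where "A \<in> Def n l" "a = cls A" "A \<inter> B = {}"
proof -
  obtain A where A: "A \<in> Def n l" "a = cls A" using assms(1) by (rule carrierE)
  obtain A' where A': "A \<approx> A'" "A' \<inter> B = {}" using disjoint_copy[OF A(1) assms(2)] by blast
  then show ?thesis using A that[of A'] by (metis cls_eq_iff equi_iff)
qed

lemma zero_SR: "\<zero>\<^bsub>SR\<^esub> = cls {}"
  and one_SR: "\<one>\<^bsub>SR\<^esub> = cls {[]}"
  by (simp_all add: def_semiring_def)

lemma abelian_monoid_SR: "abelian_monoid SR"
proof (rule abelian_monoidI)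
  show zero: "\<zero>\<^bsub>SR\<^esub> \<in> carrier SR" unfolding zero_SR by (rule cls_in_carrier[OF Def_empty])
  fix x assume x: "x \<in> carrier SR"
  then obtain A where A: "A \<in> Def n l" "x = cls A" by (rule carrierE)
  show "\<zero>\<^bsub>SR\<^esub> \<oplus>\<^bsub>SR\<^esub> x = x" unfolding zero_SR A(2) using add_cls[OF Def_empty A(1)] by simp
  fix y assume y: "y \<in> carrier SR"
  obtain B where B: "B \<in> Def n l" "y = cls B" "B \<inter> A = {}" using y A(1) by (rule disjoint_reps)
  have AB: "A \<union> B \<in> Def n l" "A \<inter> B = {}" using A B Def_Un by auto
  show "x \<oplus>\<^bsub>SR\<^esub> y \<in> carrier SR"
    unfolding A(2) B(2) add_cls[OF A(1) B(1) AB(2)] using AB(1) by (rule cls_in_carrier)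
  show "x \<oplus>\<^bsub>SR\<^esub> y = y \<oplus>\<^bsub>SR\<^esub> x"
    unfolding A(2) B(2) add_cls[OF A(1) B(1) AB(2)] add_cls[OF B(1) A(1) B(3)] by (simp add: Un_commute)
  fix z assume z: "z \<in> carrier SR"
  obtain C where C: "C \<in> Def n l" "z = cls C" "C \<inter> (A \<union> B) = {}" using z AB(1) by (rule disjoint_reps)
  have d: "B \<union> C \<in> Def n l" "B \<inter> C = {}" "A \<inter> (B \<union> C) = {}" "(A \<union> B) \<inter> C = {}" using B C AB Def_Un by auto
  show "x \<oplus>\<^bsub>SR\<^esub> y \<oplus>\<^bsub>SR\<^esub> z = x \<oplus>\<^bsub>SR\<^esub> (y \<oplus>\<^bsub>SR\<^esub> z)"
    unfolding A(2) B(2) C(2) add_cls[OF A(1) B(1) AB(2)] add_cls[OF B(1) C(1) d(2)]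
      add_cls[OF A(1) d(1) d(3)] add_cls[OF AB(1) C(1) d(4)] by (simp add: Un_assoc)
qed

interpretation SR: abelian_monoid SR
  by (rule abelian_monoid_SR)

lemma one_SR_closed: "\<one>\<^bsub>SR\<^esub> \<in> carrier SR"
proof -
  have "locus [] = {[]}" by (auto simp: locus_def)
  then show ?thesis unfolding one_SR using Def_constr[OF constr_locus[of "[]" 0]] by (intro cls_in_carrier) simp
qed

lemma mult_reps:
  assumes "a \<in> carrier SR" "b \<in> carrier SR"
  obtains A B where "A \<in> Def n l" "a = cls A" "B \<in> Def n l" "b = cls B" "conc_inj A B"
proof -
  obtain A where A: "A \<in> Def n l" "a = cls A" using assms(1) by (rule carrierE)
  obtain B where B: "B \<in> Def n l" "b = cls B" using assms(2) by (rule carrierE)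
  obtain B' where B': "B \<approx> B'" "conc_inj A B'" using conc_inj_copy[OF A(1) B(1)] by blast
  then show ?thesis using A B that[of A B'] by (metis cls_eq_iff equi_iff)
qed

lemma mult_SR_closed:
  assumes "a \<in> carrier SR" "b \<in> carrier SR"
  shows "a \<otimes>\<^bsub>SR\<^esub> b \<in> carrier SR"
proof -
  obtain A B where AB: "A \<in> Def n l" "a = cls A" "B \<in> Def n l" "b = cls B" "conc_inj A B"
    using assms by (rule mult_reps)
  then show ?thesis using mult_cls cls_in_carrier[OF Def_conc] by simp
qed

text \<open>
  The Euler characteristic of a class; by invariance, it does not depend on the representative.
\<close>

definition euler_class :: "complex \<Rightarrow> 'a list set set \<Rightarrow> complex" where
  "euler_class z a = euler z (SOME A. A \<in> a)"

lemma euler_class_cls: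
  assumes "z ^ n = z" "A \<in> Def n l"
  shows "euler_class z (cls A) = euler z A"
proof -
  have "A \<in> cls A" using equi_refl[OF assms(2)] by simp
  then have "(SOME B. B \<in> cls A) \<in> cls A" by (rule someI)
  then have "A \<approx> (SOME B. B \<in> cls A)" by simp
  then show ?thesis unfolding euler_class_def equi_iff using euler_bij[OF assms(1)] by metis
qed

lemma euler_class_zero: "z ^ n = z \<Longrightarrow> euler_class z \<zero>\<^bsub>SR\<^esub> = 0"
  unfolding zero_SR by (simp add: euler_class_cls Def_empty euler_empty)

lemma euler_class_one: "z ^ n = z \<Longrightarrow> euler_class z \<one>\<^bsub>SR\<^esub> = 1"
proof -
  assume z: "z ^ n = z"
  have "locus [] = {[]}" by (auto simp: locus_def)
  then show ?thesis unfolding one_SR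
    using Def_constr[OF constr_locus[of "[]" 0]] euler_locus[OF z, of "[]"] z by (simp add: euler_class_cls rk_def)
qed

lemma euler_class_add:
  assumes "z ^ n = z" "a \<in> carrier SR" "b \<in> carrier SR"
  shows "euler_class z (a \<oplus>\<^bsub>SR\<^esub> b) = euler_class z a + euler_class z b"
proof -
  obtain A where A: "A \<in> Def n l" "a = cls A" using assms(2) by (rule carrierE)
  obtain B where B: "B \<in> Def n l" "b = cls B" "B \<inter> A = {}" using assms(3) A(1) by (rule disjoint_reps)
  have d: "A \<inter> B = {}" using B by auto
  show ?thesis
    unfolding A(2) B(2) add_cls[OF A(1) B(1) d]
    using A(1) B(1) d assms(1) by (simp add: euler_class_cls Def_Un euler_add)
qed

lemma euler_class_mult:
  assumes "z ^ n = z" "a \<in> carrier SR" "b \<in> carrier SR"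
  shows "euler_class z (a \<otimes>\<^bsub>SR\<^esub> b) = euler_class z a * euler_class z b"
proof -
  obtain A B where AB: "A \<in> Def n l" "a = cls A" "B \<in> Def n l" "b = cls B" "conc_inj A B"
    using assms(2,3) by (rule mult_reps)
  show ?thesis
    unfolding AB(2,4) mult_cls[OF AB(1,3,5)]
    using AB assms(1) by (simp add: euler_class_cls Def_conc euler_conc)
qed

section \<open>Every class is a formal difference of sums of powers\<close>

definition pw :: "nat \<Rightarrow> 'a list set set" where
  "pw r = cls (power_set r)"

text \<open>
  The value in the semiring of a polynomial with natural coefficients at the class of the structure.
  The polynomial is given by the list of its exponents with multiplicity.
\<close>

definition psum :: "nat list \<Rightarrow> 'a list set set" where
  "psum rs = foldr (\<lambda>r a. pw r \<oplus>\<^bsub>SR\<^esub> a) rs \<zero>\<^bsub>SR\<^esub>"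

lemma pw_closed [simp]: "pw r \<in> carrier SR"
  unfolding pw_def using Def_constr[OF constr_power] by (rule cls_in_carrier)

lemma psum_simps [simp]: "psum [] = \<zero>\<^bsub>SR\<^esub>" "psum (r # rs) = pw r \<oplus>\<^bsub>SR\<^esub> psum rs"
  by (simp_all add: psum_def)

lemma psum_closed [simp]: "psum rs \<in> carrier SR"
  by (induction rs) auto

lemma psum_append: "psum (rs @ qs) = psum rs \<oplus>\<^bsub>SR\<^esub> psum qs"
  by (induction rs) (auto simp: SR.a_assoc)

lemma psum_remove1: "r \<in> set rs \<Longrightarrow> psum rs = pw r \<oplus>\<^bsub>SR\<^esub> psum (remove1 r rs)"
  by (induction rs) (auto simp: SR.a_lcomm)

lemma psum_mset: "mset rs = mset qs \<Longrightarrow> psum rs = psum qs"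
proof (induction rs arbitrary: qs)
  case (Cons r rs)
  then have "r \<in> set qs" "mset rs = mset (remove1 r qs)"
    by (metis list.set_intros(1) set_mset_mset, metis mset_remove1 remove1.simps(2))
  then show ?case using Cons.IH[of "remove1 r qs"] psum_remove1[of r qs] by (simp only: psum_simps)
qed simp

lemma euler_class_pw: "z ^ n = z \<Longrightarrow> euler_class z (pw r) = z ^ r"
proof -
  assume z: "z ^ n = z"
  have "rk (map Leaf [0..<r]) = r" by (simp add: rk_def)
  then have "euler z (power_set r) = z ^ r"
    using euler_locus[OF z, of "map Leaf [0..<r]"] by (simp add: locus_Leaf)
  then show ?thesis unfolding pw_def using euler_class_cls[OF z Def_constr[OF constr_power]] by simp
qed

lemma euler_class_psum: "z ^ n = z \<Longrightarrow> euler_class z (psum rs) = (\<Sum>r\<leftarrow>rs. z ^ r)"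
  by (induction rs) (auto simp: euler_class_zero euler_class_add euler_class_pw)

text \<open>
  The parametrisation itself is the definable bijection.
\<close>

lemma locus_equi_power:
  assumes "wfl ts"
  shows "locus ts \<approx> power_set (rk ts)"
proof -
  obtain js where js: "set js = varsl ts" "distinct js"
    using finite_distinct_list[of "varsl ts"] by auto
  have js_nth: "\<exists>i<length js. j = js ! i" if "j \<in> varsl ts" for j
  proof -
    have "j \<in> set js" using that js(1) by blast
    then show ?thesis by (metis in_set_conv_nth)
  qed
  have len: "length js = rk ts" using js distinct_card by (fastforce simp: rk_def)
  define A where "A = locus (map Leaf [0..<length js])"
  have A: "A = power_set (length js)" by (simp add: A_def locus_Leaf)
  define \<sigma> :: "nat \<Rightarrow> 'a tree" where "\<sigma> = (\<lambda>j. Leaf (the (map_of (zip js [0..<length js]) j)))"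
  have \<sigma>: "\<sigma> (js ! i) = Leaf i" if "i < length js" for i
    using that js(2) by (simp add: \<sigma>_def map_of_zip_nth)
  let ?us = "map (subst \<sigma>) ts"
  define f where "f xs = map (val (nth xs)) ?us" for xs :: "'a list"
  have f: "f xs = map (val (pull \<sigma> (nth xs))) ts" for xs unfolding f_def mapval_subst ..
  have inj: "inj_on f A"
  proof (rule inj_onI)
    fix xs ys assume xy: "xs \<in> A" "ys \<in> A" "f xs = f ys"
    show "xs = ys"
    proof (rule nth_equalityI)
      show "length xs = length ys" using xy A by simp
      fix i assume "i < length xs"
      then have i: "i < length js" using xy A by simp
      then have "js ! i \<in> varsl ts" using js(1) nth_mem by blast
      then have "pull \<sigma> (nth xs) (js ! i) = pull \<sigma> (nth ys) (js ! i)"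
        using mapval_inj[OF assms] xy(3) unfolding f by blast
      then show "xs ! i = ys ! i" using \<sigma>[OF i] by (simp add: pull_def)
    qed
  qed
  have DA: "A \<in> Def n l" unfolding A by (rule Def_constr[OF constr_power])
  have us: "\<exists>us. wfl us \<and> varsl us \<subseteq> {..<k} \<and> (\<forall>xs\<in>A. length xs = k \<longrightarrow> f xs = map (val (nth xs)) us)"
    if "k \<in> length ` A" for k
  proof (rule exI[of _ ?us], intro conjI)
    have k: "k = length js" using that A by auto
    show "wfl ?us" using assms by (auto intro!: wf_subst simp: \<sigma>_def)
    have "vars (\<sigma> j) \<subseteq> {..<k}" if "j \<in> varsl ts" for j
    proof -
      obtain i where "i < length js" "j = js ! i" using js_nth \<open>j \<in> varsl ts\<close> by blast
      then show ?thesis using \<sigma> k by simp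
    qed
    then show "varsl ?us \<subseteq> {..<k}" by (auto simp: vars_subst)
  qed (simp add: f_def)
  note term_bij[OF DA inj us]
  moreover have "f ` A = locus ts"
  proof (intro equalityI subsetI)
    fix ws assume "ws \<in> f ` A"
    then show "ws \<in> locus ts" unfolding f using locusI by auto
  next
    fix ws assume "ws \<in> locus ts"
    then obtain z where z: "ws = map (val z) ts" by (rule locusE)
    have "map (val z) ts = map (val (pull \<sigma> (nth (map z js)))) ts"
    proof (rule mapval_cong)
      fix j assume "j \<in> varsl ts"
      then obtain i where "i < length js" "j = js ! i" using js_nth by blast
      then show "z j = pull \<sigma> (nth (map z js)) j" using \<sigma> by (simp add: pull_def)
    qed
    then have "ws = f (map z js)" unfolding f using z by simp
    moreover have "map z js \<in> A" using A by simp
    ultimately show "ws \<in> f ` A" by blast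
  qed
  ultimately have "A \<approx> locus ts" using DA by (auto simp: equi_iff)
  then show ?thesis using A len equi_sym by simp
qed

text \<open>
  The class of the set is an integer polynomial in the class of the structure, stated without
  subtraction because the semiring has none.
\<close>

definition power_difference :: "'a list set \<Rightarrow> bool" where
  "power_difference A \<longleftrightarrow> A \<in> Def n l \<and> (\<exists>qs rs. cls A \<oplus>\<^bsub>SR\<^esub> psum qs = psum rs)"

lemma power_difference_locus: "wfl ts \<Longrightarrow> power_difference (locus ts)"
proof -
  assume ts: "wfl ts"
  have "locus ts \<in> Def n l" "cls (locus ts) = pw (rk ts)"
    using locus_equi_power[OF ts] cls_eq_iff by (auto simp: equi_iff pw_def)
  then show ?thesis unfolding power_difference_def by (intro conjI exI[of _ "[]"] exI[of _ "[rk ts]"]) auto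
qed

lemma power_difference_empty: "power_difference {}"
proof -
  have "cls {} \<oplus>\<^bsub>SR\<^esub> psum [] = psum []" unfolding zero_SR[symmetric] by simp
  then show ?thesis unfolding power_difference_def using Def_empty by blast
qed

lemma power_difference_Diff:
  assumes "power_difference A" "power_difference B" "A \<subseteq> B"
  shows "power_difference (B - A)"
proof -
  obtain qa ra qb rb where A: "A \<in> Def n l" "cls A \<oplus>\<^bsub>SR\<^esub> psum qa = psum ra"
    and B: "B \<in> Def n l" "cls B \<oplus>\<^bsub>SR\<^esub> psum qb = psum rb" using assms by (auto simp: power_difference_def)
  have D: "B - A \<in> Def n l" using A B Def_Diff by blast
  have "A \<union> (B - A) = B" using assms(3) by blast
  then have eq: "cls A \<oplus>\<^bsub>SR\<^esub> cls (B - A) = cls B" using add_cls[OF A(1) D] by auto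
  note cl = cls_in_carrier[OF A(1)] cls_in_carrier[OF D]
  \<comment> \<open>Subtraction is not available, so the presentation of \<open>A\<close> is added on both sides.\<close>
  have "cls (B - A) \<oplus>\<^bsub>SR\<^esub> psum (ra @ qb) = cls (B - A) \<oplus>\<^bsub>SR\<^esub> ((cls A \<oplus>\<^bsub>SR\<^esub> psum qa) \<oplus>\<^bsub>SR\<^esub> psum qb)"
    by (simp add: psum_append A(2))
  also have "\<dots> = ((cls A \<oplus>\<^bsub>SR\<^esub> cls (B - A)) \<oplus>\<^bsub>SR\<^esub> psum qb) \<oplus>\<^bsub>SR\<^esub> psum qa"
    using cl by (simp add: SR.a_ac)
  also have "\<dots> = psum (rb @ qa)" by (simp only: eq B(2) psum_append)
  finally show ?thesis using D by (auto simp: power_difference_def)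
qed

lemma power_difference_Un:
  assumes "power_difference A" "power_difference B" "A \<inter> B = {}"
  shows "power_difference (A \<union> B)"
proof -
  obtain qa ra qb rb where A: "A \<in> Def n l" "cls A \<oplus>\<^bsub>SR\<^esub> psum qa = psum ra"
    and B: "B \<in> Def n l" "cls B \<oplus>\<^bsub>SR\<^esub> psum qb = psum rb" using assms by (auto simp: power_difference_def)
  note cl = cls_in_carrier[OF A(1)] cls_in_carrier[OF B(1)]
  have "cls (A \<union> B) \<oplus>\<^bsub>SR\<^esub> psum (qa @ qb) = (cls A \<oplus>\<^bsub>SR\<^esub> cls B) \<oplus>\<^bsub>SR\<^esub> (psum qa \<oplus>\<^bsub>SR\<^esub> psum qb)"
    by (simp add: psum_append add_cls[OF A(1) B(1) assms(3)])
  also have "\<dots> = (cls A \<oplus>\<^bsub>SR\<^esub> psum qa) \<oplus>\<^bsub>SR\<^esub> (cls B \<oplus>\<^bsub>SR\<^esub> psum qb)"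
    using cl by (simp add: SR.a_ac)
  also have "\<dots> = psum (ra @ rb)" by (simp only: A(2) B(2) psum_append)
  finally show ?thesis using A B Def_Un by (auto simp: power_difference_def)
qed

text \<open>
  A Dynkin argument. Loci, the empty set, proper differences and disjoint unions are differences of
  sums of powers, but intersections are not covered by these operations. Let \<open>gd B\<close> mean that the
  intersections of \<open>B\<close> with all loci are such differences. Intersecting with a locus preserves \<open>gd\<close>,
  because loci are closed under intersection, and so does intersecting with any Boolean combination
  of loci.
\<close>

lemma power_difference_constr:
  assumes "constr k S"
  shows "power_difference S"
proof -
  define gd where "gd B \<longleftrightarrow> (\<forall>ts. wfl ts \<longrightarrow> length ts = k \<longrightarrow> power_difference (locus ts \<inter> B))" for B
  have gd0: "gd (power_set k)" unfolding gd_def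
  proof (intro allI impI)
    fix ts assume "wfl ts" "length ts = k"
    moreover from this have "locus ts \<inter> power_set k = locus ts" using length_locus by auto
    ultimately show "power_difference (locus ts \<inter> power_set k)" using power_difference_locus by simp
  qed
  have "\<forall>C. constr k C \<longrightarrow> gd C \<longrightarrow> gd (C \<inter> S)"
    using assms
  proof (induction rule: constr_induct_bool)
    case (locus ss)
    show ?case
    proof (intro allI impI)
      fix C assume C: "constr k C" "gd C"
      show "gd (C \<inter> locus ss)" unfolding gd_def
      proof (intro allI impI)
        fix ts assume ts: "wfl ts" "length ts = k"
        have "locus ts \<inter> (C \<inter> locus ss) = (locus ts \<inter> locus ss) \<inter> C" by blast
        moreover have "power_difference ((locus ts \<inter> locus ss) \<inter> C)"
          using locus_Int[OF ts(1) locus(1)] C(2) ts(2) power_difference_empty unfolding gd_def by auto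
        ultimately show "power_difference (locus ts \<inter> (C \<inter> locus ss))" by simp
      qed
    qed
  next
    case (Int S T)
    then show ?case using constr_Int by (metis Int_assoc)
  next
    case (compl S)
    show ?case
    proof (intro allI impI)
      fix C assume C: "constr k C" "gd C"
      show "gd (C \<inter> (power_set k - S))" unfolding gd_def
      proof (intro allI impI)
        fix ts assume ts: "wfl ts" "length ts = k"
        have "locus ts \<inter> (C \<inter> (power_set k - S)) = (locus ts \<inter> C) - (locus ts \<inter> (C \<inter> S))"
          using constr_length[OF C(1)] by blast
        moreover have "power_difference ((locus ts \<inter> C) - (locus ts \<inter> (C \<inter> S)))"
          using C compl ts unfolding gd_def by (intro power_difference_Diff) auto
        ultimately show "power_difference (locus ts \<inter> (C \<inter> (power_set k - S)))" by simp
      qed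
    qed
  qed
  then have "gd (power_set k \<inter> S)" using gd0 constr_power by blast
  then have "power_difference (locus (map Leaf [0..<k]) \<inter> (power_set k \<inter> S))" unfolding gd_def by simp
  moreover have "locus (map Leaf [0..<k]) \<inter> (power_set k \<inter> S) = S"
    using constr_length[OF assms] by (auto simp: locus_Leaf)
  ultimately show ?thesis by simp
qed

lemma power_difference_Def:
  assumes "A \<in> Def n l"
  shows "power_difference A"
proof -
  have "power_difference (\<Union>k\<in>K. {xs \<in> A. length xs = k})" if "finite K" for K
    using that
  proof (induction K rule: finite_induct)
    case (insert k K)
    have "power_difference ({xs \<in> A. length xs = k} \<union> (\<Union>k\<in>K. {xs \<in> A. length xs = k}))"
      using insert power_difference_constr[OF Def_piece[OF assms]] by (intro power_difference_Un) auto
    then show ?case by simp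
  qed (simp add: power_difference_empty)
  from this[OF Def_finite[OF assms]] show ?thesis by (simp only: Def_pieces[of A, symmetric])
qed

section \<open>Comparing sums of powers\<close>

text \<open>
  The representative of an exponent modulo the identity \<open>X ^ n = X\<close>. For \<open>n = 1\<close>, taking the remainder
  modulo \<open>0\<close> makes it the identity, as it should be. For \<open>n \<ge> 2\<close>, its values are less than \<open>n\<close>.
\<close>

definition red :: "nat \<Rightarrow> nat" where
  "red r = (if r = 0 then 0 else (r - 1) mod (n - 1) + 1)"

text \<open>
  The constructor joins the last \<open>n\<close> coordinates to a single one.
\<close>

lemma pw_add: "pw (r + n) = pw (r + 1)"
proof -
  let ?A = "power_set (r + n)" and ?us = "map Leaf [0..<r] @ [Node (map Leaf [r..<r + n])]"
  define f where "f xs = take r xs @ [join (drop r xs)]" for xs :: "'a list"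
  have inj: "inj_on f ?A"
    by (rule inj_onI) (auto simp: f_def join_inj, metis append_take_drop_id)
  have A: "?A \<in> Def n l" by (rule Def_constr[OF constr_power])
  have us: "\<exists>us. wfl us \<and> varsl us \<subseteq> {..<k} \<and> (\<forall>xs\<in>?A. length xs = k \<longrightarrow> f xs = map (val (nth xs)) us)"
    if "k \<in> length ` ?A" for k
  proof (rule exI[of _ ?us], intro conjI)
    have k: "k = r + n" using that by auto
    show "wfl ?us" "varsl ?us \<subseteq> {..<k}" using k by auto
    show "\<forall>xs\<in>?A. length xs = k \<longrightarrow> f xs = map (val (nth xs)) ?us"
    proof (intro ballI impI)
      fix xs assume "xs \<in> ?A"
      then have "map (nth xs) [0..<r] = take r xs" "map (nth xs) [r..<r + n] = drop r xs"
        by (auto intro!: nth_equalityI)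
      then show "f xs = map (val (nth xs)) ?us" by (simp add: f_def o_def)
    qed
  qed
  note term_bij[OF A inj us]
  moreover have "f ` ?A = power_set (r + 1)"
  proof (intro equalityI subsetI)
    fix ws assume "ws \<in> f ` ?A"
    then show "ws \<in> power_set (r + 1)" by (auto simp: f_def)
  next
    fix ws :: "'a list" assume ws: "ws \<in> power_set (r + 1)"
    let ?x = "last ws"
    have "ws = take r ws @ [?x]" using ws by (metis (mono_tags, lifting) Suc_eq_plus1 append_butlast_last_id butlast_conv_take diff_Suc_1 length_0_conv mem_Collect_eq nat.distinct(1))
    then have "ws = f (take r ws @ map (\<lambda>i. l i ?x) [0..<n])" using ws by (simp add: f_def join_l)
    moreover have "take r ws @ map (\<lambda>i. l i ?x) [0..<n] \<in> ?A" using ws by simp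
    ultimately show "ws \<in> f ` ?A" by blast
  qed
  ultimately have "?A \<approx> power_set (r + 1)" using A by (auto simp: equi_iff)
  then show ?thesis unfolding pw_def using cls_eq_iff by (auto simp: equi_iff)
qed

lemma red_less: "n \<ge> 2 \<Longrightarrow> red r < n"
  using mod_less_divisor[of "n - 1" "r - 1"] by (auto simp: red_def simp del: mod_less_divisor)

lemma red_id: "\<not> (n \<ge> 2 \<and> r \<ge> n) \<Longrightarrow> red r = r"
proof -
  assume small: "\<not> (n \<ge> 2 \<and> r \<ge> n)"
  show "red r = r"
  proof (cases "n = 1")
    case True
    then have "n - 1 = 0" by simp
    then show ?thesis unfolding red_def by simp
  next
    case n1: False
    then have "r < n" using small n_pos by auto
    then have "r = 0 \<or> (r - 1) mod (n - 1) = r - 1" using n1 by (auto intro!: mod_less)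
    then show ?thesis by (auto simp: red_def)
  qed
qed

lemma pw_red: "pw r = pw (red r)"
proof (induction r rule: less_induct)
  case (less r)
  show ?case
  proof (cases "n \<ge> 2 \<and> r \<ge> n")
    case True
    define s where "s = r - n"
    have r: "r = s + n" using True by (simp add: s_def)
    have "pw r = pw (s + 1)" unfolding r by (rule pw_add)
    also have "\<dots> = pw (red (s + 1))" by (rule less) (use True r in simp)
    also have "red (s + 1) = red r"
    proof -
      have "r - 1 = s + (n - 1)" "r \<noteq> 0" using r True by auto
      then show ?thesis by (simp add: red_def)
    qed
    finally show ?thesis .
  next
    case False
    then have "red r = r" by (rule red_id)
    then show ?thesis by simp
  qed
qed

lemma psum_red: "psum rs = psum (map red rs)"
  using pw_red by (induction rs) auto

lemma card_fixed_powers: "n \<ge> 2 \<Longrightarrow> card {z :: complex. z ^ n = z} = n"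
proof -
  assume n: "n \<ge> 2"
  have "z ^ n = z \<longleftrightarrow> z = 0 \<or> z ^ (n - 1) = 1" for z :: complex
  proof -
    have "z ^ n = z * z ^ (n - 1)" using n by (metis n_pos power_eq_if not_one_le_zero)
    then show ?thesis by auto
  qed
  then have "{z :: complex. z ^ n = z} = insert 0 {z. z ^ (n - 1) = 1}" by auto
  moreover have "card {z :: complex. z ^ (n - 1) = 1} = n - 1" using n by (intro card_roots_unity_eq) simp
  moreover have "finite {z :: complex. z ^ (n - 1) = 1}" using n by (intro finite_roots_unity) simp
  moreover have "(0 :: complex) \<notin> {z. z ^ (n - 1) = 1}" using n by (simp add: zero_power)
  ultimately show ?thesis using n by simp
qed

text \<open>
  A polynomial in reduced exponents that vanishes at all fixed points of \<open>z \<mapsto> z ^ n\<close> is zero: for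
  \<open>n \<ge> 2\<close> its degree is less than \<open>n\<close>, the number of fixed points, and for \<open>n = 1\<close> all complex numbers
  are fixed points.
\<close>

lemma red_polynomial_zero:
  fixes c :: "nat \<Rightarrow> complex"
  assumes "\<And>i. i > N \<Longrightarrow> c i = 0" "n \<ge> 2 \<Longrightarrow> (\<And>i. i \<ge> n \<Longrightarrow> c i = 0)"
    and zero: "\<And>z. z ^ n = z \<Longrightarrow> (\<Sum>i\<le>N. c i * z ^ i) = 0"
  shows "c k = 0"
proof (rule ccontr)
  assume k: "c k \<noteq> 0"
  define M where "M = (if n \<ge> 2 then n - 1 else N)"
  have kM: "k \<le> M"
  proof (cases "n \<ge> 2")
    case True
    then have "\<not> k \<ge> n" using assms(2) k by blast
    then show ?thesis using True by (simp add: M_def)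
  next
    case False
    then show ?thesis using assms(1)[of k] k by (auto simp: M_def not_less[symmetric])
  qed
  have "(\<Sum>i\<le>M. c i * z ^ i) = (\<Sum>i\<le>N. c i * z ^ i)" for z
  proof (cases "n \<ge> 2")
    case True
    have "c i = 0" if "\<not> i \<le> M" for i using that True by (intro assms(2)) (auto simp: M_def)
    then have "(\<Sum>i\<le>M. c i * z ^ i) = (\<Sum>i\<le>max M N. c i * z ^ i)"
      by (intro sum.mono_neutral_left) auto
    also have "\<dots> = (\<Sum>i\<le>N. c i * z ^ i)"
      using assms(1) by (intro sum.mono_neutral_right) auto
    finally show ?thesis .
  qed (simp add: M_def)
  then have "{z :: complex. z ^ n = z} \<subseteq> {z. (\<Sum>i\<le>M. c i * z ^ i) = 0}" using zero by auto
  moreover have R: "finite {z. (\<Sum>i\<le>M. c i * z ^ i) = 0}" "card {z. (\<Sum>i\<le>M. c i * z ^ i) = 0} \<le> M"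
    using polyfun_rootbound[of c k M] k kM by blast+
  ultimately have fin: "finite {z :: complex. z ^ n = z}" "card {z :: complex. z ^ n = z} \<le> M"
    by (blast intro: finite_subset, meson card_mono order_trans)
  show False
  proof (cases "n \<ge> 2")
    case True
    then show False using fin(2) card_fixed_powers by (simp add: M_def)
  next
    case False
    then have "n = 1" using n_pos by simp
    then show False using fin(1) infinite_UNIV_char_0[where 'a = complex] by simp
  qed
qed

lemma power_red: "z ^ n = (z :: complex) \<Longrightarrow> z ^ red r = z ^ r"
  using pw_red[of r] euler_class_pw by metis

lemma sum_list_power: "set rs \<subseteq> {..N} \<Longrightarrow> (\<Sum>r\<leftarrow>rs. z ^ r) = (\<Sum>i\<le>N. of_nat (count (mset rs) i) * (z :: complex) ^ i)"
proof (induction rs)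
  case (Cons r rs)
  have "(\<Sum>i\<le>N. of_nat (count (mset (r # rs)) i) * z ^ i) =
      (\<Sum>i\<le>N. (if i = r then z ^ i else 0) + of_nat (count (mset rs) i) * z ^ i)"
    by (rule sum.cong) (auto simp: algebra_simps)
  also have "\<dots> = z ^ r + (\<Sum>i\<le>N. of_nat (count (mset rs) i) * z ^ i)"
    using Cons.prems by (simp add: sum.distrib)
  finally show ?case using Cons by simp
qed simp

text \<open>
  Sums of powers with the same Euler characteristics are equal already in the semiring: after the
  reduction of the exponents, the lists of exponents are permutations of each other.
\<close>

lemma psum_eqI:
  assumes "\<And>z :: complex. z ^ n = z \<Longrightarrow> (\<Sum>r\<leftarrow>rs. z ^ r) = (\<Sum>r\<leftarrow>qs. z ^ r)"
  shows "psum rs = psum qs"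
proof -
  let ?rs = "map red rs" and ?qs = "map red qs"
  obtain N where N: "set ?rs \<subseteq> {..N}" "set ?qs \<subseteq> {..N}"
    using finite_nat_set_iff_bounded_le[of "set ?rs \<union> set ?qs"] by auto
  let ?c = "\<lambda>i. of_nat (count (mset ?rs) i) - of_nat (count (mset ?qs) i) :: complex"
  have "?c i = 0" for i
  proof (rule red_polynomial_zero[of N ?c])
    fix i
    show "?c i = 0" if "i > N" 
    proof -
      have "i \<notin> set ?rs" "i \<notin> set ?qs" using that N by auto
      then have "count (mset ?rs) i = 0" "count (mset ?qs) i = 0" by (simp_all only: count_eq_zero_iff set_mset_mset not_False_eq_True)
      then show ?thesis by simp
    qed
    show "?c i = 0" if "n \<ge> 2" "i \<ge> n"
    proof -
      have "i \<notin> set (map red xs)" for xs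
        using that(2) red_less[OF that(1)] by (metis imageE leD set_map)
      then have "i \<notin> set ?rs" "i \<notin> set ?qs" by blast+
      then have "count (mset ?rs) i = 0" "count (mset ?qs) i = 0" by (simp_all only: count_eq_zero_iff set_mset_mset not_False_eq_True)
      then show ?thesis by simp
    qed
  next
    fix z :: complex assume z: "z ^ n = z"
    have "(\<Sum>r\<leftarrow>?rs. z ^ r) = (\<Sum>r\<leftarrow>?qs. z ^ r)"
      using assms[OF z] power_red[OF z] by (simp add: o_def)
    then show "(\<Sum>i\<le>N. ?c i * z ^ i) = 0"
      unfolding sum_list_power[OF N(1)] sum_list_power[OF N(2)] by (simp add: algebra_simps sum_subtractf)
  qed
  then have "count (mset ?rs) i = count (mset ?qs) i" for i by (metis eq_iff_diff_eq_0 of_nat_eq_iff)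
  then have "mset ?rs = mset ?qs" by (rule multiset_eqI)
  then show ?thesis using psum_mset psum_red by metis
qed

text \<open>
  Two classes with the same Euler characteristics become equal after adding the sums of powers that
  occur negatively in their presentations as formal differences.
\<close>

theorem cancel_rel_SR:
  "cancel_rel SR = {(a, b). a \<in> carrier SR \<and> b \<in> carrier SR \<and> (\<forall>z. z ^ n = z \<longrightarrow> euler_class z a = euler_class z b)}"
proof (intro equalityI subrelI)
  fix a b assume "(a, b) \<in> cancel_rel SR"
  then obtain c where c: "a \<in> carrier SR" "b \<in> carrier SR" "c \<in> carrier SR" "a \<oplus>\<^bsub>SR\<^esub> c = b \<oplus>\<^bsub>SR\<^esub> c"
    by (auto simp: cancel_rel_def)
  then have "euler_class z a = euler_class z b" if "z ^ n = z" for z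
    using euler_class_add[OF that] by (metis add_right_cancel)
  then show "(a, b) \<in> {(a, b). a \<in> carrier SR \<and> b \<in> carrier SR \<and> (\<forall>z. z ^ n = z \<longrightarrow> euler_class z a = euler_class z b)}"
    using c by blast
next
  fix a b assume "(a, b) \<in> {(a, b). a \<in> carrier SR \<and> b \<in> carrier SR \<and> (\<forall>z. z ^ n = z \<longrightarrow> euler_class z a = euler_class z b)}"
  then have ab: "a \<in> carrier SR" "b \<in> carrier SR" "\<And>z. z ^ n = z \<Longrightarrow> euler_class z a = euler_class z b" by auto
  obtain A B where A: "A \<in> Def n l" "a = cls A" and B: "B \<in> Def n l" "b = cls B"
    using ab(1,2) by (meson carrierE)
  obtain qa ra qb rb where qa: "a \<oplus>\<^bsub>SR\<^esub> psum qa = psum ra" and qb: "b \<oplus>\<^bsub>SR\<^esub> psum qb = psum rb"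
    using power_difference_Def[OF A(1)] power_difference_Def[OF B(1)] A(2) B(2) unfolding power_difference_def by blast
  have "psum (ra @ qb) = psum (rb @ qa)"
  proof (rule psum_eqI)
    fix z :: complex assume z: "z ^ n = z"
    have "(\<Sum>r\<leftarrow>ra. z ^ r) = euler_class z a + (\<Sum>r\<leftarrow>qa. z ^ r)" "(\<Sum>r\<leftarrow>rb. z ^ r) = euler_class z b + (\<Sum>r\<leftarrow>qb. z ^ r)"
      using arg_cong[OF qa, of "euler_class z"] arg_cong[OF qb, of "euler_class z"] ab(1,2) z
      by (simp_all add: euler_class_add euler_class_psum)
    then show "(\<Sum>r\<leftarrow>ra @ qb. z ^ r) = (\<Sum>r\<leftarrow>rb @ qa. z ^ r)" using ab(3)[OF z] by simp
  qed
  then have "(a \<oplus>\<^bsub>SR\<^esub> psum qa) \<oplus>\<^bsub>SR\<^esub> psum qb = (b \<oplus>\<^bsub>SR\<^esub> psum qb) \<oplus>\<^bsub>SR\<^esub> psum qa"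
    by (simp only: psum_append qa qb)
  then have "a \<oplus>\<^bsub>SR\<^esub> (psum qa \<oplus>\<^bsub>SR\<^esub> psum qb) = b \<oplus>\<^bsub>SR\<^esub> (psum qa \<oplus>\<^bsub>SR\<^esub> psum qb)"
    using ab(1,2) by (simp add: SR.a_ac)
  then show "(a, b) \<in> cancel_rel SR" using ab(1,2) unfolding cancel_rel_def by auto
qed

end

section \<open>Rings with evaluations\<close>

text \<open>
  A homomorphism to functions with values in a commutative ring, for structures \<open>R\<close> of which only the
  operations are given. Once \<open>E\<close> is injective, as it is after the quotients below, computations in \<open>R\<close>
  become computations with functions, and the laws of the operations on classes come for free.
\<close>

definition evaluated :: "('b, 'm) ring_scheme \<Rightarrow> ('b \<Rightarrow> 'z \<Rightarrow> 'v :: comm_ring_1) \<Rightarrow> ('z \<Rightarrow> 'v) \<Rightarrow> bool" where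
  "evaluated R E u \<longleftrightarrow>
     \<one>\<^bsub>R\<^esub> \<in> carrier R \<and> E \<one>\<^bsub>R\<^esub> = u \<and> \<zero>\<^bsub>R\<^esub> \<in> carrier R \<and> E \<zero>\<^bsub>R\<^esub> = (\<lambda>_. 0) \<and>
     (\<forall>a\<in>carrier R. \<forall>b\<in>carrier R. a \<oplus>\<^bsub>R\<^esub> b \<in> carrier R \<and> E (a \<oplus>\<^bsub>R\<^esub> b) = (\<lambda>z. E a z + E b z) \<and>
        a \<otimes>\<^bsub>R\<^esub> b \<in> carrier R \<and> E (a \<otimes>\<^bsub>R\<^esub> b) = (\<lambda>z. E a z * E b z))"

text \<open>
  Both quotient constructions of the Grothendieck ring turn out to be quotients by such a relation.
\<close>

definition kernel_rel :: "'b set \<Rightarrow> ('b \<Rightarrow> 'w) \<Rightarrow> 'b rel" where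
  "kernel_rel X \<phi> = {(a, b). a \<in> X \<and> b \<in> X \<and> \<phi> a = \<phi> b}"

definition class_val :: "('b \<Rightarrow> 'w) \<Rightarrow> 'b set \<Rightarrow> 'w" where
  "class_val \<phi> A = \<phi> (SOME a. a \<in> A)"

lemma class_val: "a \<in> X \<Longrightarrow> class_val \<phi> (kernel_rel X \<phi> `` {a}) = \<phi> a"
proof -
  assume "a \<in> X"
  then have "a \<in> kernel_rel X \<phi> `` {a}" by (simp add: kernel_rel_def)
  then have "(SOME b. b \<in> kernel_rel X \<phi> `` {a}) \<in> kernel_rel X \<phi> `` {a}" by (rule someI)
  then have "\<phi> a = \<phi> (SOME b. b \<in> kernel_rel X \<phi> `` {a})" unfolding kernel_rel_def by blast
  then show ?thesis unfolding class_val_def by simp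
qed

lemma class_eqI: "a \<in> X \<Longrightarrow> b \<in> X \<Longrightarrow> \<phi> a = \<phi> b \<Longrightarrow> kernel_rel X \<phi> `` {a} = kernel_rel X \<phi> `` {b}"
  by (auto simp: kernel_rel_def)

lemma inj_class_val: "inj_on (class_val \<phi>) (X // kernel_rel X \<phi>)"
proof (rule inj_onI)
  fix A B assume AB: "A \<in> X // kernel_rel X \<phi>" "B \<in> X // kernel_rel X \<phi>" "class_val \<phi> A = class_val \<phi> B"
  obtain a where a: "a \<in> X" "A = kernel_rel X \<phi> `` {a}" using AB(1) by (rule quotientE)
  obtain b where b: "b \<in> X" "B = kernel_rel X \<phi> `` {b}" using AB(2) by (rule quotientE)
  show "A = B" using class_eqI[OF a(1) b(1), of \<phi>] AB(3) a b by (simp add: class_val)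
qed

text \<open>
  Operations that are compatible with \<open>\<phi>\<close> descend to the quotient in the form in which the two
  quotient constructions define them.
\<close>

lemma class_op:
  assumes "a \<in> X" "b \<in> X" "\<And>a b. a \<in> X \<Longrightarrow> b \<in> X \<Longrightarrow> f a b \<in> X"
    "\<And>a b a' b'. a \<in> X \<Longrightarrow> b \<in> X \<Longrightarrow> a' \<in> X \<Longrightarrow> b' \<in> X \<Longrightarrow> \<phi> a = \<phi> a' \<Longrightarrow> \<phi> b = \<phi> b' \<Longrightarrow> \<phi> (f a b) = \<phi> (f a' b')"
  shows "(\<Union>a'\<in>kernel_rel X \<phi> `` {a}. \<Union>b'\<in>kernel_rel X \<phi> `` {b}. kernel_rel X \<phi> `` {f a' b'}) =
    kernel_rel X \<phi> `` {f a b}"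
proof -
  have "kernel_rel X \<phi> `` {f a' b'} = kernel_rel X \<phi> `` {f a b}"
    if "a' \<in> kernel_rel X \<phi> `` {a}" "b' \<in> kernel_rel X \<phi> `` {b}" for a' b'
  proof (rule class_eqI)
    have ab': "a' \<in> X" "b' \<in> X" "\<phi> a' = \<phi> a" "\<phi> b' = \<phi> b" using that by (auto simp: kernel_rel_def)
    show "f a' b' \<in> X" "f a b \<in> X" using assms(1-3) ab' by auto
    show "\<phi> (f a' b') = \<phi> (f a b)" using assms(1,2,4) ab' by metis
  qed
  moreover have "a \<in> kernel_rel X \<phi> `` {a}" "b \<in> kernel_rel X \<phi> `` {b}"
    using assms(1,2) by (auto simp: kernel_rel_def)
  ultimately show ?thesis by blast
qed

lemma evaluated_cancel_quotient:
  assumes S: "evaluated S E u" and R: "cancel_rel S = kernel_rel (carrier S) E"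
  shows "evaluated (cancel_quotient S) (class_val E) u"
    "inj_on (class_val E) (carrier (cancel_quotient S))"
    "class_val E ` carrier (cancel_quotient S) = E ` carrier S"
proof -
  let ?R = "kernel_rel (carrier S) E"
  note E = S[unfolded evaluated_def]
  have carr: "carrier (cancel_quotient S) = carrier S // ?R"
    by (simp add: cancel_quotient_def R)
  have add: "?R `` {a} \<oplus>\<^bsub>cancel_quotient S\<^esub> ?R `` {b} = ?R `` {a \<oplus>\<^bsub>S\<^esub> b}"
    if "a \<in> carrier S" "b \<in> carrier S" for a b
    unfolding cancel_quotient_def ring.simps R by (rule class_op[OF that]) (use E in auto)
  have mult: "?R `` {a} \<otimes>\<^bsub>cancel_quotient S\<^esub> ?R `` {b} = ?R `` {a \<otimes>\<^bsub>S\<^esub> b}"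
    if "a \<in> carrier S" "b \<in> carrier S" for a b
    unfolding cancel_quotient_def monoid.simps R by (rule class_op[OF that]) (use E in auto)
  have one: "\<one>\<^bsub>cancel_quotient S\<^esub> = ?R `` {\<one>\<^bsub>S\<^esub>}" and zero: "\<zero>\<^bsub>cancel_quotient S\<^esub> = ?R `` {\<zero>\<^bsub>S\<^esub>}"
    by (simp_all add: cancel_quotient_def R)
  show "evaluated (cancel_quotient S) (class_val E) u"
    unfolding evaluated_def carr one zero
  proof (intro conjI ballI)
    fix x y assume "x \<in> carrier S // ?R" "y \<in> carrier S // ?R"
    then obtain a b where ab: "a \<in> carrier S" "x = ?R `` {a}" "b \<in> carrier S" "y = ?R `` {b}"
      by (meson quotientE)
    have cl: "a \<oplus>\<^bsub>S\<^esub> b \<in> carrier S" "a \<otimes>\<^bsub>S\<^esub> b \<in> carrier S" using E ab by auto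
    show "x \<oplus>\<^bsub>cancel_quotient S\<^esub> y \<in> carrier S // ?R" "x \<otimes>\<^bsub>cancel_quotient S\<^esub> y \<in> carrier S // ?R"
      unfolding ab(2,4) add[OF ab(1,3)] mult[OF ab(1,3)] using cl by (auto intro: quotientI)
    show "class_val E (x \<oplus>\<^bsub>cancel_quotient S\<^esub> y) = (\<lambda>z. class_val E x z + class_val E y z)"
      "class_val E (x \<otimes>\<^bsub>cancel_quotient S\<^esub> y) = (\<lambda>z. class_val E x z * class_val E y z)"
      unfolding ab(2,4) add[OF ab(1,3)] mult[OF ab(1,3)] using cl ab E by (simp_all add: class_val)
  qed (use E in \<open>auto simp: class_val intro: quotientI\<close>)
  show "inj_on (class_val E) (carrier (cancel_quotient S))"
    unfolding carr by (rule inj_class_val)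
  show "class_val E ` carrier (cancel_quotient S) = E ` carrier S"
    unfolding carr quotient_def by (auto simp: class_val intro!: image_eqI)
qed

definition diff_val :: "('b \<Rightarrow> 'z \<Rightarrow> 'v :: comm_ring_1) \<Rightarrow> 'b \<times> 'b \<Rightarrow> 'z \<Rightarrow> 'v" where
  "diff_val E = (\<lambda>(a, b) z. E a z - E b z)"

text \<open>
  For an injective evaluation, the defining relation of formal differences is equality of the
  differences of the values.
\<close>

lemma evaluated_difference_ring:
  assumes S: "evaluated S E u" and inj: "inj_on E (carrier S)"
  shows "evaluated (difference_ring S) (class_val (diff_val E)) u"
    "inj_on (class_val (diff_val E)) (carrier (difference_ring S))"
    "class_val (diff_val E) ` carrier (difference_ring S) =
      {\<lambda>z. v z - w z | v w. v \<in> E ` carrier S \<and> w \<in> E ` carrier S}"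
proof -
  let ?X = "carrier S \<times> carrier S" and ?\<phi> = "diff_val E"
  let ?R = "kernel_rel ?X ?\<phi>"
  note E = S[unfolded evaluated_def]
  have "a \<oplus>\<^bsub>S\<^esub> d = c \<oplus>\<^bsub>S\<^esub> b \<longleftrightarrow> ?\<phi> (a, b) = ?\<phi> (c, d)"
    if "a \<in> carrier S" "b \<in> carrier S" "c \<in> carrier S" "d \<in> carrier S" for a b c d
  proof -
    have "a \<oplus>\<^bsub>S\<^esub> d = c \<oplus>\<^bsub>S\<^esub> b \<longleftrightarrow> E (a \<oplus>\<^bsub>S\<^esub> d) = E (c \<oplus>\<^bsub>S\<^esub> b)"
      using inj_on_eq_iff[OF inj, of "a \<oplus>\<^bsub>S\<^esub> d" "c \<oplus>\<^bsub>S\<^esub> b"] E that by simp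
    also have "\<dots> \<longleftrightarrow> (\<lambda>z. E a z + E d z) = (\<lambda>z. E c z + E b z)" using E that by simp
    also have "\<dots> \<longleftrightarrow> ?\<phi> (a, b) = ?\<phi> (c, d)" by (auto simp: diff_val_def fun_eq_iff algebra_simps)
    finally show ?thesis .
  qed
  then have R: "diff_rel S = ?R" unfolding diff_rel_def kernel_rel_def by auto
  have carr: "carrier (difference_ring S) = ?X // ?R" by (simp add: difference_ring_def R)
  define ad where "ad p q = (fst p \<oplus>\<^bsub>S\<^esub> fst q, snd p \<oplus>\<^bsub>S\<^esub> snd q)" for p q
  define mu where "mu p q = (fst p \<otimes>\<^bsub>S\<^esub> fst q \<oplus>\<^bsub>S\<^esub> snd p \<otimes>\<^bsub>S\<^esub> snd q, fst p \<otimes>\<^bsub>S\<^esub> snd q \<oplus>\<^bsub>S\<^esub> snd p \<otimes>\<^bsub>S\<^esub> fst q)" for p q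
  have ad: "ad p q \<in> ?X" "?\<phi> (ad p q) = (\<lambda>z. ?\<phi> p z + ?\<phi> q z)" if "p \<in> ?X" "q \<in> ?X" for p q
    using that E by (auto simp: ad_def diff_val_def fun_eq_iff split: prod.splits)
  have mu: "mu p q \<in> ?X" "?\<phi> (mu p q) = (\<lambda>z. ?\<phi> p z * ?\<phi> q z)" if "p \<in> ?X" "q \<in> ?X" for p q
    using that E by (auto simp: mu_def diff_val_def fun_eq_iff algebra_simps split: prod.splits)
  have add: "?R `` {p} \<oplus>\<^bsub>difference_ring S\<^esub> ?R `` {q} = ?R `` {ad p q}" if "p \<in> ?X" "q \<in> ?X" for p q
  proof -
    have "?R `` {p} \<oplus>\<^bsub>difference_ring S\<^esub> ?R `` {q} = (\<Union>p'\<in>?R `` {p}. \<Union>q'\<in>?R `` {q}. ?R `` {ad p' q'})"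
      by (simp add: difference_ring_def R ad_def case_prod_beta)
    also have "\<dots> = ?R `` {ad p q}" by (rule class_op[OF that]) (use ad in auto)
    finally show ?thesis .
  qed
  have mult: "?R `` {p} \<otimes>\<^bsub>difference_ring S\<^esub> ?R `` {q} = ?R `` {mu p q}" if "p \<in> ?X" "q \<in> ?X" for p q
  proof -
    have "?R `` {p} \<otimes>\<^bsub>difference_ring S\<^esub> ?R `` {q} = (\<Union>p'\<in>?R `` {p}. \<Union>q'\<in>?R `` {q}. ?R `` {mu p' q'})"
      by (simp add: difference_ring_def R mu_def case_prod_beta)
    also have "\<dots> = ?R `` {mu p q}" by (rule class_op[OF that]) (use mu in auto)
    finally show ?thesis .
  qed
  have one: "\<one>\<^bsub>difference_ring S\<^esub> = ?R `` {(\<one>\<^bsub>S\<^esub>, \<zero>\<^bsub>S\<^esub>)}"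
    and zero: "\<zero>\<^bsub>difference_ring S\<^esub> = ?R `` {(\<zero>\<^bsub>S\<^esub>, \<zero>\<^bsub>S\<^esub>)}"
    by (simp_all add: difference_ring_def R)
  have units: "(\<one>\<^bsub>S\<^esub>, \<zero>\<^bsub>S\<^esub>) \<in> ?X" "?\<phi> (\<one>\<^bsub>S\<^esub>, \<zero>\<^bsub>S\<^esub>) = u" "(\<zero>\<^bsub>S\<^esub>, \<zero>\<^bsub>S\<^esub>) \<in> ?X" "?\<phi> (\<zero>\<^bsub>S\<^esub>, \<zero>\<^bsub>S\<^esub>) = (\<lambda>_. 0)"
    using E by (auto simp: diff_val_def)
  show "evaluated (difference_ring S) (class_val ?\<phi>) u"
    unfolding evaluated_def carr one zero
  proof (intro conjI ballI)
    fix x y assume "x \<in> ?X // ?R" "y \<in> ?X // ?R"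
    then obtain p q where pq: "p \<in> ?X" "x = ?R `` {p}" "q \<in> ?X" "y = ?R `` {q}" by (meson quotientE)
    show "x \<oplus>\<^bsub>difference_ring S\<^esub> y \<in> ?X // ?R" "x \<otimes>\<^bsub>difference_ring S\<^esub> y \<in> ?X // ?R"
      unfolding pq(2,4) add[OF pq(1,3)] mult[OF pq(1,3)] using ad(1) mu(1) pq by (auto intro: quotientI)
    show "class_val ?\<phi> (x \<oplus>\<^bsub>difference_ring S\<^esub> y) = (\<lambda>z. class_val ?\<phi> x z + class_val ?\<phi> y z)"
      "class_val ?\<phi> (x \<otimes>\<^bsub>difference_ring S\<^esub> y) = (\<lambda>z. class_val ?\<phi> x z * class_val ?\<phi> y z)"
      unfolding pq(2,4) add[OF pq(1,3)] mult[OF pq(1,3)]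
        class_val[OF pq(1)] class_val[OF pq(3)] class_val[OF ad(1)[OF pq(1,3)]] class_val[OF mu(1)[OF pq(1,3)]]
      by (rule ad(2)[OF pq(1,3)], rule mu(2)[OF pq(1,3)])
  next
    show "class_val ?\<phi> (?R `` {(\<one>\<^bsub>S\<^esub>, \<zero>\<^bsub>S\<^esub>)}) = u" unfolding class_val[OF units(1)] by (rule units(2))
    show "class_val ?\<phi> (?R `` {(\<zero>\<^bsub>S\<^esub>, \<zero>\<^bsub>S\<^esub>)}) = (\<lambda>_. 0)" unfolding class_val[OF units(3)] by (rule units(4))
    show "?R `` {(\<one>\<^bsub>S\<^esub>, \<zero>\<^bsub>S\<^esub>)} \<in> ?X // ?R" using units(1) by (rule quotientI)
    show "?R `` {(\<zero>\<^bsub>S\<^esub>, \<zero>\<^bsub>S\<^esub>)} \<in> ?X // ?R" using units(3) by (rule quotientI)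
  qed
  show "inj_on (class_val ?\<phi>) (carrier (difference_ring S))"
    unfolding carr by (rule inj_class_val)
  have "class_val ?\<phi> ` carrier (difference_ring S) = ?\<phi> ` ?X"
  proof (intro equalityI subsetI)
    fix f assume "f \<in> class_val ?\<phi> ` (carrier (difference_ring S))"
    then obtain p where "p \<in> ?X" "f = class_val ?\<phi> (?R `` {p})"
      unfolding carr by (elim imageE quotientE) blast
    then show "f \<in> ?\<phi> ` ?X" using class_val[of p ?X ?\<phi>] by blast
  next
    fix f assume "f \<in> ?\<phi> ` ?X"
    then obtain p where p: "p \<in> ?X" "f = ?\<phi> p" by blast
    then have "f = class_val ?\<phi> (?R `` {p})" using class_val[of p ?X ?\<phi>] by simp
    then show "f \<in> class_val ?\<phi> ` (carrier (difference_ring S))"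
      unfolding carr using quotientI[OF p(1), of ?R] by blast
  qed
  also have "\<dots> = {\<lambda>z. v z - w z | v w. v \<in> E ` carrier S \<and> w \<in> E ` carrier S}"
    unfolding diff_val_def by auto
  finally show "class_val ?\<phi> ` carrier (difference_ring S) =
      {\<lambda>z. v z - w z | v w. v \<in> E ` carrier S \<and> w \<in> E ` carrier S}" .
qed

text \<open>
  An element of \<open>R\<close> corresponds to the coset of all elements of \<open>P\<close> with the same values.
\<close>

lemma iso_quotient_of_evaluated:
  assumes R: "evaluated R E u" "inj_on E (carrier R)" and P: "evaluated P e u" "ideal I P"
    and same: "E ` carrier R = e ` carrier P"
    and ker: "\<And>p q. p \<in> carrier P \<Longrightarrow> q \<in> carrier P \<Longrightarrow> I +>\<^bsub>P\<^esub> p = I +>\<^bsub>P\<^esub> q \<longleftrightarrow> e p = e q"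
  shows "R \<simeq> P Quot I"
proof -
  interpret ideal I P by (rule P(2))
  have hom: "(+>\<^bsub>P\<^esub>) I \<in> ring_hom P (P Quot I)" by (rule rcos_ring_hom)
  \<comment> \<open>Any choice will do, since the coset of \<open>r a\<close> depends only on the values of \<open>a\<close>.\<close>
  define r where "r a = (SOME p. p \<in> carrier P \<and> e p = E a)" for a
  have r: "r a \<in> carrier P" "e (r a) = E a" if "a \<in> carrier R" for a
  proof -
    have "\<exists>p. p \<in> carrier P \<and> e p = E a" using same that by (metis imageE imageI)
    from someI_ex[OF this] show "r a \<in> carrier P" "e (r a) = E a" by (auto simp: r_def)
  qed
  define h where "h a = I +>\<^bsub>P\<^esub> r a" for a
  have h: "h a = I +>\<^bsub>P\<^esub> p" if "a \<in> carrier R" "p \<in> carrier P" "e p = E a" for a p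
    using ker[OF r(1)[OF that(1)] that(2)] r(2)[OF that(1)] that(3) by (simp add: h_def)
  note ER = R(1)[unfolded evaluated_def] and EP = P(1)[unfolded evaluated_def]
  have "h \<in> ring_iso R (P Quot I)"
  proof (rule ring_iso_memI)
    fix x y assume xy: "x \<in> carrier R" "y \<in> carrier R"
    show "h x \<in> carrier (P Quot I)" unfolding h_def by (rule ring_hom_closed[OF hom r(1)[OF xy(1)]])
    have "h (x \<otimes>\<^bsub>R\<^esub> y) = I +>\<^bsub>P\<^esub> (r x \<otimes>\<^bsub>P\<^esub> r y)"
      by (rule h) (use ER EP xy r in auto)
    then show "h (x \<otimes>\<^bsub>R\<^esub> y) = h x \<otimes>\<^bsub>P Quot I\<^esub> h y"
      unfolding h_def using ring_hom_mult[OF hom r(1)[OF xy(1)] r(1)[OF xy(2)]] by simp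
    have "h (x \<oplus>\<^bsub>R\<^esub> y) = I +>\<^bsub>P\<^esub> (r x \<oplus>\<^bsub>P\<^esub> r y)"
      by (rule h) (use ER EP xy r in auto)
    then show "h (x \<oplus>\<^bsub>R\<^esub> y) = h x \<oplus>\<^bsub>P Quot I\<^esub> h y"
      unfolding h_def using ring_hom_add[OF hom r(1)[OF xy(1)] r(1)[OF xy(2)]] by simp
  next
    have "h \<one>\<^bsub>R\<^esub> = I +>\<^bsub>P\<^esub> \<one>\<^bsub>P\<^esub>" by (rule h) (use ER EP in auto)
    then show "h \<one>\<^bsub>R\<^esub> = \<one>\<^bsub>P Quot I\<^esub>" using ring_hom_one[OF hom] by simp
  next
    have "inj_on h (carrier R)"
    proof (rule inj_onI)
      fix x y assume xy: "x \<in> carrier R" "y \<in> carrier R" "h x = h y"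
      then have "e (r x) = e (r y)" using ker[OF r(1) r(1)] by (simp add: h_def)
      then show "x = y" using r(2) xy R(2) by (simp add: inj_on_eq_iff)
    qed
    moreover have "h ` carrier R = carrier (P Quot I)"
    proof (intro equalityI subsetI)
      fix X assume "X \<in> h ` carrier R"
      then show "X \<in> carrier (P Quot I)" unfolding h_def using ring_hom_closed[OF hom r(1)] by auto
    next
      fix X assume "X \<in> carrier (P Quot I)"
      then obtain p where p: "p \<in> carrier P" "X = I +>\<^bsub>P\<^esub> p" by (auto simp: FactRing_simps)
      obtain a where a: "a \<in> carrier R" "E a = e p" using same p(1) by (metis imageE imageI)
      have "h a = X" unfolding p(2) by (rule h) (use a p in auto)
      then show "X \<in> h ` carrier R" using a(1) by blast
    qed
    ultimately show "bij_betw h (carrier R) (carrier (P Quot I))" by (simp add: bij_betw_def)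
  qed
  then show ?thesis unfolding is_ring_iso_def by blast
qed

section \<open>Evaluating integer polynomials\<close>

interpretation ZX: UP_cring \<Z> ZX
  by (rule UP_cring.intro[OF int_is_cring])

lemma carrier_ZX: "p \<in> carrier ZX \<longleftrightarrow> (\<exists>N. \<forall>i>N. p i = 0)"
  by (auto simp: UP_def up_def bound_def)

lemma coeff_ZX: "p \<in> carrier ZX \<Longrightarrow> coeff ZX p = p"
  by (simp add: UP_def)

lemma monom_ZX: "monom ZX c k i = (if i = k then c else 0)"
  by (simp add: UP_def)

lemma one_ZX: "\<one>\<^bsub>ZX\<^esub> i = (if i = 0 then 1 else 0)"
  and zero_ZX: "\<zero>\<^bsub>ZX\<^esub> i = 0"
  by (simp_all add: UP_def)

lemma add_ZX: "p \<in> carrier ZX \<Longrightarrow> q \<in> carrier ZX \<Longrightarrow> (p \<oplus>\<^bsub>ZX\<^esub> q) i = p i + q i"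
  by (simp add: UP_def)

lemma mult_ZX: "p \<in> carrier ZX \<Longrightarrow> q \<in> carrier ZX \<Longrightarrow> (p \<otimes>\<^bsub>ZX\<^esub> q) i = (\<Sum>k\<le>i. p k * q (i - k))"
  by (simp add: UP_def int_finsum_eq)

lemma minus_ZX: "p \<in> carrier ZX \<Longrightarrow> q \<in> carrier ZX \<Longrightarrow> (p \<ominus>\<^bsub>ZX\<^esub> q) i = p i - q i"
  using ZX.coeff_minus[of p q] coeff_ZX[of p] coeff_ZX[of q] coeff_ZX[of "p \<ominus>\<^bsub>ZX\<^esub> q"]
  by (simp add: int_a_minus_eq)

lemma X_pow_ZX: "X_ZX [^]\<^bsub>ZX\<^esub> (k :: nat) = monom ZX 1 k"
  using ZX.monom_pow[of 1 1 k] by simp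

text \<open>
  Elements of the polynomial ring are coefficient functions. Their support is finite, so the sum is
  the intended one; a sum over an infinite support would be zero by convention.
\<close>

definition eval_ZX :: "(nat \<Rightarrow> int) \<Rightarrow> complex \<Rightarrow> complex" where
  "eval_ZX p z = (\<Sum>i | p i \<noteq> 0. of_int (p i) * z ^ i)"

lemma eval_ZX_eq: "\<forall>i>N. p i = 0 \<Longrightarrow> eval_ZX p z = (\<Sum>i\<le>N. of_int (p i) * z ^ i)"
  unfolding eval_ZX_def by (rule sum.mono_neutral_left) (auto simp: not_less[symmetric])

lemma eval_ZX_add: "p \<in> carrier ZX \<Longrightarrow> q \<in> carrier ZX \<Longrightarrow> eval_ZX (p \<oplus>\<^bsub>ZX\<^esub> q) z = eval_ZX p z + eval_ZX q z"
proof -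
  assume pq: "p \<in> carrier ZX" "q \<in> carrier ZX"
  then obtain M N where "\<forall>i>M. p i = 0" "\<forall>i>N. q i = 0" by (auto simp: carrier_ZX)
  then have *: "\<forall>i>max M N. p i = 0" "\<forall>i>max M N. q i = 0" "\<forall>i>max M N. (p \<oplus>\<^bsub>ZX\<^esub> q) i = 0"
    by (auto simp: add_ZX[OF pq])
  show ?thesis
    unfolding eval_ZX_eq[OF *(1)] eval_ZX_eq[OF *(2)] eval_ZX_eq[OF *(3)]
    by (simp add: add_ZX[OF pq] sum.distrib algebra_simps)
qed

lemma eval_ZX_mult: "p \<in> carrier ZX \<Longrightarrow> q \<in> carrier ZX \<Longrightarrow> eval_ZX (p \<otimes>\<^bsub>ZX\<^esub> q) z = eval_ZX p z * eval_ZX q z"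
proof -
  assume pq: "p \<in> carrier ZX" "q \<in> carrier ZX"
  then obtain M N where MN: "\<forall>i>M. p i = 0" "\<forall>i>N. q i = 0" by (auto simp: carrier_ZX)
  have *: "\<forall>i>M + N. (p \<otimes>\<^bsub>ZX\<^esub> q) i = 0"
  proof (intro allI impI)
    fix i assume i: "M + N < i"
    have "p k * q (i - k) = 0" for k using MN i by (cases "k > M") auto
    then show "(p \<otimes>\<^bsub>ZX\<^esub> q) i = 0" unfolding mult_ZX[OF pq] by (intro sum.neutral) blast
  qed
  have "eval_ZX p z * eval_ZX q z = (\<Sum>r\<le>M + N. (\<Sum>k\<le>r. of_int (p k) * of_int (q (r - k))) * z ^ r)"
    unfolding eval_ZX_eq[OF MN(1)] eval_ZX_eq[OF MN(2)]
    by (rule polynomial_product) (use MN in auto)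
  also have "\<dots> = eval_ZX (p \<otimes>\<^bsub>ZX\<^esub> q) z"
    unfolding eval_ZX_eq[OF *] by (simp add: mult_ZX[OF pq])
  finally show ?thesis by simp
qed

lemma eval_ZX_monom: "eval_ZX (monom ZX c k) z = of_int c * z ^ k"
proof -
  have "eval_ZX (monom ZX c k) z = (\<Sum>i\<le>k. of_int (monom ZX c k i) * z ^ i)" by (rule eval_ZX_eq) (simp add: monom_ZX)
  also have "\<dots> = (\<Sum>i\<le>k. if i = k then of_int c * z ^ k else 0)" by (rule sum.cong) (auto simp: monom_ZX)
  finally show ?thesis by simp
qed

lemma eval_ZX_zero: "eval_ZX \<zero>\<^bsub>ZX\<^esub> z = 0"
  by (simp add: eval_ZX_def zero_ZX)

lemma eval_ZX_minus:
  assumes "p \<in> carrier ZX" "q \<in> carrier ZX"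
  shows "eval_ZX (p \<ominus>\<^bsub>ZX\<^esub> q) z = eval_ZX p z - eval_ZX q z"
proof -
  have "p = (p \<ominus>\<^bsub>ZX\<^esub> q) \<oplus>\<^bsub>ZX\<^esub> q"
    using assms by (intro ext) (simp add: add_ZX minus_ZX ZX.P.minus_closed)
  then have "eval_ZX p z = eval_ZX (p \<ominus>\<^bsub>ZX\<^esub> q) z + eval_ZX q z" using eval_ZX_add[of "p \<ominus>\<^bsub>ZX\<^esub> q" q z] assms by simp
  then show ?thesis by simp
qed

lemma int_one_eq: "\<one>\<^bsub>\<Z>\<^esub> = 1"
  by simp

lemma one_ZX_monom: "\<one>\<^bsub>ZX\<^esub> = monom ZX 1 0"
  by (rule ext) (simp add: one_ZX monom_ZX)

lemma monom_closed_ZX [simp]: "monom ZX c k \<in> carrier ZX"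
  by (rule ZX.monom_closed) simp

context acyclic_cantor
begin

abbreviation fixed_ideal :: "(nat \<Rightarrow> int) set" where
  "fixed_ideal \<equiv> Idl\<^bsub>ZX\<^esub> {X_ZX \<ominus>\<^bsub>ZX\<^esub> X_ZX [^]\<^bsub>ZX\<^esub> n}"

text \<open>
  Functions on the fixed points of \<open>z \<mapsto> z ^ n\<close>, extended by zero so that equality on the fixed points
  is equality of functions.
\<close>

definition on_fixed :: "(complex \<Rightarrow> complex) \<Rightarrow> complex \<Rightarrow> complex" where
  "on_fixed f = (\<lambda>z. if z ^ n = z then f z else 0)"

lemma on_fixed_eq_iff: "on_fixed f = on_fixed g \<longleftrightarrow> (\<forall>z. z ^ n = z \<longrightarrow> f z = g z)"
  by (auto simp: on_fixed_def fun_eq_iff)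

lemma fixed_ideal: "ideal fixed_ideal ZX"
  by (rule ZX.P.genideal_ideal) (simp add: X_pow_ZX)

lemma fixed_ideal_eq: "fixed_ideal = {q \<otimes>\<^bsub>ZX\<^esub> (monom ZX 1 1 \<ominus>\<^bsub>ZX\<^esub> monom ZX 1 n) | q. q \<in> carrier ZX}"
proof -
  have "monom ZX 1 1 \<ominus>\<^bsub>ZX\<^esub> monom ZX 1 n \<in> carrier ZX" by (intro ZX.P.minus_closed monom_closed_ZX)
  from ZX.P.cgenideal_eq_genideal[OF this] show ?thesis
    unfolding X_pow_ZX unfolding int_one_eq cgenideal_def by (rule sym)
qed

lemma red_shift: "red (s + n) = red (s + 1)"
proof -
  have "s + n - 1 = s + (n - 1)" "s + n \<noteq> 0" using n_pos by auto
  then show ?thesis by (simp add: red_def)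
qed

text \<open>
  The difference of \<open>X ^ (s + n)\<close> and \<open>X ^ (s + 1)\<close> is a multiple of \<open>X - X ^ n\<close>.
\<close>

lemma monom_red: "monom ZX c i \<ominus>\<^bsub>ZX\<^esub> monom ZX c (red i) \<in> fixed_ideal"
proof (induction i rule: less_induct)
  case (less i)
  interpret I: ideal fixed_ideal ZX by (rule fixed_ideal)
  show ?case
  proof (cases "n \<ge> 2 \<and> i \<ge> n")
    case True
    define s where "s = i - n"
    have i: "i = s + n" using True by (simp add: s_def)
    have "monom ZX (- c) s \<otimes>\<^bsub>ZX\<^esub> (monom ZX 1 1 \<ominus>\<^bsub>ZX\<^esub> monom ZX 1 n) \<in> fixed_ideal"
      unfolding fixed_ideal_eq by auto
    also have "monom ZX (- c) s \<otimes>\<^bsub>ZX\<^esub> (monom ZX 1 1 \<ominus>\<^bsub>ZX\<^esub> monom ZX 1 n) =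
        (monom ZX (- c) s \<otimes>\<^bsub>ZX\<^esub> monom ZX 1 1) \<ominus>\<^bsub>ZX\<^esub> (monom ZX (- c) s \<otimes>\<^bsub>ZX\<^esub> monom ZX 1 n)"
      by (simp add: ZX.P.r_minus ZX.P.r_distr ZX.P.minus_eq)
    also have "\<dots> = monom ZX (- c) (s + 1) \<ominus>\<^bsub>ZX\<^esub> monom ZX (- c) (s + n)"
      using ZX.monom_mult[of "- c" 1 s 1] ZX.monom_mult[of "- c" 1 s n] by simp
    also have "\<dots> = monom ZX c i \<ominus>\<^bsub>ZX\<^esub> monom ZX c (s + 1)"
      by (rule ext) (simp only: minus_ZX monom_closed_ZX monom_ZX i, auto)
    finally have 1: "monom ZX c i \<ominus>\<^bsub>ZX\<^esub> monom ZX c (s + 1) \<in> fixed_ideal" .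
    have 2: "monom ZX c (s + 1) \<ominus>\<^bsub>ZX\<^esub> monom ZX c (red (s + 1)) \<in> fixed_ideal"
      by (rule less) (use True i in simp)
    have "(monom ZX c i \<ominus>\<^bsub>ZX\<^esub> monom ZX c (s + 1)) \<oplus>\<^bsub>ZX\<^esub>
        (monom ZX c (s + 1) \<ominus>\<^bsub>ZX\<^esub> monom ZX c (red (s + 1))) = monom ZX c i \<ominus>\<^bsub>ZX\<^esub> monom ZX c (red i)"
      by (rule ext) (simp add: add_ZX minus_ZX ZX.P.minus_closed i red_shift)
    then show ?thesis using I.a_closed[OF 1 2] by simp
  next
    case False
    then have "red i = i" by (rule red_id)
    then have "monom ZX c i \<ominus>\<^bsub>ZX\<^esub> monom ZX c (red i) = \<zero>\<^bsub>ZX\<^esub>" by (intro ext) (simp add: minus_ZX zero_ZX)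
    then show ?thesis using I.zero_closed by simp
  qed
qed

lemma reduce_mod_ideal:
  assumes "\<forall>i\<ge>N. p i = 0"
  shows "\<exists>r\<in>carrier ZX. p \<ominus>\<^bsub>ZX\<^esub> r \<in> fixed_ideal \<and> (\<forall>i. i \<ge> n \<longrightarrow> n \<ge> 2 \<longrightarrow> r i = 0)"
  using assms
proof (induction N arbitrary: p)
  interpret I: ideal fixed_ideal ZX by (rule fixed_ideal)
  {
    case 0
    then have "p = \<zero>\<^bsub>ZX\<^esub>" by (intro ext) (simp add: zero_ZX)
    then have "p \<ominus>\<^bsub>ZX\<^esub> \<zero>\<^bsub>ZX\<^esub> = \<zero>\<^bsub>ZX\<^esub>" by (intro ext) (simp add: minus_ZX zero_ZX)
    then have "p \<ominus>\<^bsub>ZX\<^esub> \<zero>\<^bsub>ZX\<^esub> \<in> fixed_ideal" using I.zero_closed by simp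
    then show ?case by (intro bexI[of _ "\<zero>\<^bsub>ZX\<^esub>"] conjI allI impI zero_ZX ZX.P.zero_closed)
  next
    case (Suc N)
    define p' where "p' = p(N := 0)"
    have p'0: "\<forall>i\<ge>N. p' i = 0" using Suc.prems by (auto simp: p'_def)
    from Suc.IH[OF p'0] obtain r where r: "r \<in> carrier ZX" "p' \<ominus>\<^bsub>ZX\<^esub> r \<in> fixed_ideal"
      "\<And>i. i \<ge> n \<Longrightarrow> n \<ge> 2 \<Longrightarrow> r i = 0" by blast
    have pc: "p \<in> carrier ZX" "p' \<in> carrier ZX"
      using Suc.prems p'0 by (auto simp: carrier_ZX intro!: exI[of _ N])
    define c where "c = p N"
    let ?m = "monom ZX c N" and ?m' = "monom ZX c (red N)"
    have "(p' \<ominus>\<^bsub>ZX\<^esub> r) \<oplus>\<^bsub>ZX\<^esub> (?m \<ominus>\<^bsub>ZX\<^esub> ?m') = p \<ominus>\<^bsub>ZX\<^esub> (r \<oplus>\<^bsub>ZX\<^esub> ?m')"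
    proof -
      have "p i = p' i + ?m i" for i by (simp add: p'_def monom_ZX c_def)
      then show ?thesis using pc r(1)
        by (intro ext) (simp add: add_ZX minus_ZX ZX.P.minus_closed ZX.P.add.m_closed)
    qed
    moreover have "(p' \<ominus>\<^bsub>ZX\<^esub> r) \<oplus>\<^bsub>ZX\<^esub> (?m \<ominus>\<^bsub>ZX\<^esub> ?m') \<in> fixed_ideal"
      by (rule I.a_closed[OF r(2) monom_red])
    ultimately have "p \<ominus>\<^bsub>ZX\<^esub> (r \<oplus>\<^bsub>ZX\<^esub> ?m') \<in> fixed_ideal" by simp
    moreover have "(r \<oplus>\<^bsub>ZX\<^esub> ?m') i = 0" if "i \<ge> n" "n \<ge> 2" for i
    proof -
      have "i \<noteq> red N" using red_less[OF that(2), of N] that(1) by simp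
      then show ?thesis using r that by (simp add: add_ZX monom_ZX)
    qed
    ultimately show ?case using r(1) by (intro bexI[of _ "r \<oplus>\<^bsub>ZX\<^esub> ?m'"]) auto
  }
qed

lemma eval_ZX_fixed_ideal:
  assumes "p \<in> fixed_ideal" "z ^ n = z"
  shows "eval_ZX p z = 0"
proof -
  obtain q where q: "q \<in> carrier ZX" "p = q \<otimes>\<^bsub>ZX\<^esub> (monom ZX 1 1 \<ominus>\<^bsub>ZX\<^esub> monom ZX 1 n)"
    using assms(1) unfolding fixed_ideal_eq by blast
  have "eval_ZX p z = eval_ZX q z * (z - z ^ n)"
    unfolding q(2) using q(1) by (simp add: eval_ZX_mult eval_ZX_minus eval_ZX_monom)
  then show ?thesis using assms(2) by simp
qed

text \<open>
  The ideal is the vanishing ideal of the fixed points: a polynomial is congruent to a reduced one,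
  and a reduced one that vanishes at all fixed points is zero.
\<close>

lemma fixed_ideal_iff:
  assumes "p \<in> carrier ZX"
  shows "p \<in> fixed_ideal \<longleftrightarrow> (\<forall>z. z ^ n = z \<longrightarrow> eval_ZX p z = 0)"
proof
  assume zero: "\<forall>z. z ^ n = z \<longrightarrow> eval_ZX p z = 0"
  obtain N where "\<forall>i>N. p i = 0" using assms by (auto simp: carrier_ZX)
  then have "\<forall>i\<ge>Suc N. p i = 0" by auto
  from reduce_mod_ideal[OF this] obtain r where r: "r \<in> carrier ZX" "p \<ominus>\<^bsub>ZX\<^esub> r \<in> fixed_ideal"
      "\<And>i. i \<ge> n \<Longrightarrow> n \<ge> 2 \<Longrightarrow> r i = 0" by blast
  obtain M where M: "\<forall>i>M. r i = 0" using r(1) by (auto simp: carrier_ZX)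
  have "eval_ZX r z = 0" if "z ^ n = z" for z
    using eval_ZX_fixed_ideal[OF r(2) that] zero that eval_ZX_minus[OF assms r(1)] by simp
  then have z0: "(\<Sum>i\<le>M. of_int (r i) * z ^ i) = 0" if "z ^ n = z" for z :: complex
    using that eval_ZX_eq[OF M, of z] by simp
  have "(of_int (r k) :: complex) = 0" for k
    by (rule red_polynomial_zero[of M "\<lambda>i. of_int (r i)"]) (use M r(3) z0 in auto)
  then have "r i = 0" for i by simp
  then have "p \<ominus>\<^bsub>ZX\<^esub> r = p" using assms r(1) by (intro ext) (simp add: minus_ZX)
  then show "p \<in> fixed_ideal" using r(2) by simp
qed (use eval_ZX_fixed_ideal in blast)

lemma coset_eq_iff:
  assumes "p \<in> carrier ZX" "q \<in> carrier ZX"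
  shows "fixed_ideal +>\<^bsub>ZX\<^esub> p = fixed_ideal +>\<^bsub>ZX\<^esub> q \<longleftrightarrow> on_fixed (eval_ZX p) = on_fixed (eval_ZX q)"
proof -
  interpret I: ideal fixed_ideal ZX by (rule fixed_ideal)
  have "fixed_ideal +>\<^bsub>ZX\<^esub> p = fixed_ideal +>\<^bsub>ZX\<^esub> q \<longleftrightarrow> p \<ominus>\<^bsub>ZX\<^esub> q \<in> fixed_ideal"
    by (rule ZX.P.quotient_eq_iff_same_a_r_cos[OF fixed_ideal assms, symmetric])
  also have "\<dots> \<longleftrightarrow> on_fixed (eval_ZX p) = on_fixed (eval_ZX q)"
    using fixed_ideal_iff[of "p \<ominus>\<^bsub>ZX\<^esub> q"] assms eval_ZX_minus[OF assms]
    by (simp add: on_fixed_eq_iff ZX.P.minus_closed)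
  finally show ?thesis .
qed

lemma evaluated_ZX: "evaluated ZX (\<lambda>p. on_fixed (eval_ZX p)) (on_fixed (\<lambda>_. 1))"
  unfolding evaluated_def
proof (intro conjI ballI)
  show "on_fixed (eval_ZX \<one>\<^bsub>ZX\<^esub>) = on_fixed (\<lambda>_. 1)"
    unfolding one_ZX_monom on_fixed_eq_iff eval_ZX_monom by simp
  show "on_fixed (eval_ZX \<zero>\<^bsub>ZX\<^esub>) = (\<lambda>_. 0)" by (rule ext) (simp add: on_fixed_def eval_ZX_zero)
  fix p q assume pq: "p \<in> carrier ZX" "q \<in> carrier ZX"
  show "on_fixed (eval_ZX (p \<oplus>\<^bsub>ZX\<^esub> q)) = (\<lambda>z. on_fixed (eval_ZX p) z + on_fixed (eval_ZX q) z)"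
    "on_fixed (eval_ZX (p \<otimes>\<^bsub>ZX\<^esub> q)) = (\<lambda>z. on_fixed (eval_ZX p) z * on_fixed (eval_ZX q) z)"
    by (rule ext, simp add: on_fixed_def eval_ZX_add[OF pq] eval_ZX_mult[OF pq])+
  show "p \<oplus>\<^bsub>ZX\<^esub> q \<in> carrier ZX" "p \<otimes>\<^bsub>ZX\<^esub> q \<in> carrier ZX"
    using pq by (rule ZX.P.add.m_closed, rule ZX.P.m_closed)
qed (rule ZX.P.one_closed, rule ZX.P.zero_closed)

section \<open>The Grothendieck ring\<close>

definition euler_function :: "'a list set set \<Rightarrow> complex \<Rightarrow> complex" where
  "euler_function a = on_fixed (\<lambda>z. euler_class z a)"

lemma evaluated_SR: "evaluated SR euler_function (on_fixed (\<lambda>_. 1))"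
  unfolding evaluated_def euler_function_def
  using one_SR_closed abelian_monoid.zero_closed[OF abelian_monoid_SR]
    abelian_monoid.a_closed[OF abelian_monoid_SR] mult_SR_closed
  by (auto simp: on_fixed_def fun_eq_iff euler_class_one euler_class_zero euler_class_add euler_class_mult)

lemma cancel_rel_kernel: "cancel_rel SR = kernel_rel (carrier SR) euler_function"
  unfolding cancel_rel_SR kernel_rel_def euler_function_def on_fixed_eq_iff ..

definition difference_of_powers :: "nat list \<Rightarrow> nat list \<Rightarrow> complex \<Rightarrow> complex" where
  "difference_of_powers rs qs = on_fixed (\<lambda>z. (\<Sum>r\<leftarrow>rs. z ^ r) - (\<Sum>r\<leftarrow>qs. z ^ r))"

lemma euler_function_psum: "euler_function (psum rs) = difference_of_powers rs []"
  by (auto simp: euler_function_def difference_of_powers_def on_fixed_eq_iff euler_class_psum)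

lemma euler_function_difference:
  assumes "a \<in> carrier SR"
  shows "\<exists>rs qs. euler_function a = difference_of_powers rs qs"
proof -
  obtain A where A: "A \<in> Def n l" "a = cls A" using assms by (rule carrierE)
  obtain qs rs where "a \<oplus>\<^bsub>SR\<^esub> psum qs = psum rs" using power_difference_Def[OF A(1)] A(2) by (auto simp: power_difference_def)
  then have "euler_class z a + (\<Sum>r\<leftarrow>qs. z ^ r) = (\<Sum>r\<leftarrow>rs. z ^ r)" if "z ^ n = z" for z
    using euler_class_add[OF that assms psum_closed[of qs]] euler_class_psum[OF that] by metis
  then have "euler_function a = difference_of_powers rs qs"
    unfolding euler_function_def difference_of_powers_def on_fixed_eq_iff by (simp add: algebra_simps)
  then show ?thesis by blast
qed

text \<open>
  The values on the Grothendieck ring are the differences of sums of powers, in one direction since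
  every class is a formal difference, in the other since the powers themselves are available.
\<close>

lemma values_K0:
  "{\<lambda>z. v z - w z | v w. v \<in> euler_function ` carrier SR \<and> w \<in> euler_function ` carrier SR} =
    {difference_of_powers rs qs | rs qs. True}" (is "?L = ?R")
proof (intro equalityI subsetI)
  fix f assume "f \<in> ?L"
  then obtain a b where ab: "a \<in> carrier SR" "b \<in> carrier SR" "f = (\<lambda>z. euler_function a z - euler_function b z)" by auto
  obtain ra qa rb qb where "euler_function a = difference_of_powers ra qa" "euler_function b = difference_of_powers rb qb"
    using euler_function_difference ab by metis
  then have "f = difference_of_powers (ra @ qb) (qa @ rb)"
    unfolding ab(3) by (auto simp: difference_of_powers_def on_fixed_def fun_eq_iff)
  then show "f \<in> ?R" by blast
next
  fix f assume "f \<in> ?R"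
  then obtain rs qs where f: "f = difference_of_powers rs qs" by blast
  have "f = (\<lambda>z. euler_function (psum rs) z - euler_function (psum qs) z)"
    unfolding f euler_function_psum by (auto simp: difference_of_powers_def on_fixed_def fun_eq_iff)
  then show "f \<in> ?L" using psum_closed by blast
qed

lemma eval_ZX_sum_list_monom: "\<exists>p\<in>carrier ZX. \<forall>z. eval_ZX p z = (\<Sum>r\<leftarrow>rs. z ^ r)"
proof (induction rs)
  case Nil
  show ?case using eval_ZX_zero by (intro bexI[of _ "\<zero>\<^bsub>ZX\<^esub>"]) auto
next
  case (Cons r rs)
  then obtain p where "p \<in> carrier ZX" "\<forall>z. eval_ZX p z = (\<Sum>r\<leftarrow>rs. z ^ r)" by blast
  then show ?case by (intro bexI[of _ "monom ZX 1 r \<oplus>\<^bsub>ZX\<^esub> p"]) (auto simp: eval_ZX_add eval_ZX_monom)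
qed

lemma values_ZX: "(\<lambda>p. on_fixed (eval_ZX p)) ` carrier ZX = {difference_of_powers rs qs | rs qs. True}" (is "?L = ?R")
proof (intro equalityI subsetI)
  fix f assume "f \<in> ?L"
  then obtain p where p: "p \<in> carrier ZX" "f = on_fixed (eval_ZX p)" by blast
  obtain N where N: "\<forall>i>N. p i = 0" using p(1) by (auto simp: carrier_ZX)
  have rep: "(\<Sum>r\<leftarrow>concat (map (\<lambda>i. replicate (c i) i) [0..<Suc N]). z ^ r) = (\<Sum>i\<le>N. of_nat (c i) * z ^ i)"
    for c and z :: complex
    by (induction N) (auto simp: sum_list_replicate)
  have "eval_ZX p z = (\<Sum>i\<le>N. of_nat (nat (p i)) * z ^ i) - (\<Sum>i\<le>N. of_nat (nat (- p i)) * z ^ i)" for z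
  proof -
    have "(of_int k :: complex) = of_nat (nat k) - of_nat (nat (- k))" for k
      by (cases "k \<ge> 0") auto
    then show ?thesis unfolding eval_ZX_eq[OF N] by (simp add: left_diff_distrib sum_subtractf)
  qed
  then have "f = difference_of_powers (concat (map (\<lambda>i. replicate (nat (p i)) i) [0..<Suc N]))
      (concat (map (\<lambda>i. replicate (nat (- p i)) i) [0..<Suc N]))"
    unfolding p(2) difference_of_powers_def rep on_fixed_eq_iff by blast
  then show "f \<in> ?R" by blast
next
  fix f assume "f \<in> ?R"
  then obtain rs qs where f: "f = difference_of_powers rs qs" by blast
  obtain p q where pq: "p \<in> carrier ZX" "\<And>z. eval_ZX p z = (\<Sum>r\<leftarrow>rs. z ^ r)" "q \<in> carrier ZX" "\<And>z. eval_ZX q z = (\<Sum>r\<leftarrow>qs. z ^ r)"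
    using eval_ZX_sum_list_monom by metis
  have "f = on_fixed (eval_ZX (p \<ominus>\<^bsub>ZX\<^esub> q))"
    unfolding f difference_of_powers_def on_fixed_eq_iff by (simp add: eval_ZX_minus pq)
  then show "f \<in> ?L" using pq by (auto intro: ZX.P.minus_closed)
qed

theorem K0_iso: "K0 n l \<simeq> ZX Quot fixed_ideal"
proof -
  note C = evaluated_cancel_quotient[OF evaluated_SR cancel_rel_kernel]
  note D = evaluated_difference_ring[OF C(1,2)]
  show ?thesis
    unfolding K0_def
    by (rule iso_quotient_of_evaluated[OF D(1,2) evaluated_ZX fixed_ideal _ coset_eq_iff])
      (simp_all only: D(3) C(3) values_K0 values_ZX)
qed

end

theorem theorem1p3:
  fixes n :: nat and l :: "nat \<Rightarrow> 'a \<Rightarrow> 'a"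
  assumes "n \<ge> 1"
    and "bij_betw (\<lambda>x. map (\<lambda>i. l i x) [0..<n]) UNIV {xs. length xs = n}"
    and "\<And>w x. w \<noteq> [] \<Longrightarrow> set w \<subseteq> {..<n} \<Longrightarrow> foldr l w x \<noteq> x"
  shows "K0 n l \<simeq> ZX Quot (Idl\<^bsub>ZX\<^esub> {X_ZX \<ominus>\<^bsub>ZX\<^esub> X_ZX [^]\<^bsub>ZX\<^esub> n})"
  by (rule acyclic_cantor.K0_iso, unfold_locales) (fact assms)+

end
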